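(* Let $1\le p<\infty$, $\alpha>-1$ and $a>\frac12$. Write $\sigma=\mathrm{Re}(s)$ for $s\in\mathbb{C}$. (1) There exist constants $c_1,C_1>0$ depending only on $p,\alpha,a$ such that for every $s\in\mathbb{C}$ with $\sigma\in(1/2,a)$, $$\frac{c_1}{(\sigma-1/2)^{\frac{\alpha+2}{p}}}\le \|\delta_s\|_{(\mathcal{A}^p_{\alpha,\infty})^*}\le \frac{C_1}{(\sigma-1/2)^{\frac{\alpha+2}{p}}}.$$ (2) There exist constants $c_2,C_2>0$ depending only on $p,\alpha$ such that for every $s\in\mathbb{C}$ with $\sigma>1/2$, $$c_2\Big(\frac{\sigma}{\sigma-1/2}\Big)^{\frac{\alpha+2}{p}}\le \|\delta_s\|_{(\mathcal{A}^p_{\alpha})^*}\le C_2\Big(\frac{\sigma}{\sigma-1/2}\Big)^{\frac{\alpha+2}{p}}.$$ (3) In particular, there exist $\sigma_0>1/2$ and constants $c_3,C_3>0$, depending only on $p,\alpha$, such that for every $s\in\mathbb{C}$ with $\sigma\in(1/2,\sigma_0)$, both $\|\delta_s\|_{(\mathcal{A}^p_{\alpha,\infty})^*}$ and $\|\delta_s\|_{(\mathcal{A}^p_{\alpha})^*}$ lie between $c_3(\sigma-1/2)^{-\frac{\alpha+2}{p}}$ and $C_3(\sigma-1/2)^{-\frac{\alpha+2}{p}}$.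
   Context: A Dirichlet polynomial is a finite sum $P(s)=\sum_{n=1}^N a_n n^{-s}$, $a_n\in\mathbb{C}$. The infinite torus $\mathbb{T}^\infty$, with normalized Haar measure $m_\infty$, is identified with the group of completely multiplicative maps $\chi:\mathbb{N}\to\{|z|=1\}$ (determined by arbitrary values at the primes). For $1\le p<\infty$, $\|P\|_{\mathcal{H}^p}=\big(\int_{\mathbb{T}^\infty}|\sum_{n} a_n\chi(n)|^p\,dm_\infty(\chi)\big)^{1/p}$. For $\sigma\ge0$, $P_\sigma(s)=P(s+\sigma)$. For $\alpha>-1$, let $d\mu_\alpha(\sigma)=\frac{2^{\alpha+1}}{\Gamma(\alpha+1)}\sigma^\alpha e^{-2\sigma}\,d\sigma$, a probability measure on $(0,\infty)$, and set $\|P\|_{\mathcal{A}^p_\alpha}=\big(\int_0^\infty\|P_\sigma\|_{\mathcal{H}^p}^p\,d\mu_\alpha(\sigma)\big)^{1/p}$. The space $\mathcal{A}^p_\alpha$ is the completion of the Dirichlet polynomials in this norm; its elements are identified with Dirichlet series $\sum_{n\ge1}a_nn^{-s}$ (coefficientwise limits of Cauchy sequences of Dirichlet polynomials), and it is known that these converge and are analytic in $\{\mathrm{Re}(s)>1/2\}$ with bounded point evaluations there. $\mathcal{A}^p_{\alpha,\infty}$ is the subspace of $\mathcal{A}^p_\alpha$ (same norm) of series with first coefficient $a_1=0$. For $\mathrm{Re}(s)>1/2$, $\delta_s(f)=f(s)$ is the point evaluation functional; $\|\delta_s\|_{X^*}$ is its norm as a functional on $X$. *)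

theory Defs
  imports "HOL-Probability.Probability" "HOL-Computational_Algebra.Computational_Algebra"
begin

section \<open>Dirichlet polynomials and Dirichlet series\<close>

text \<open>A Dirichlet series is represented by its coefficient sequence; index \<open>0\<close>
  is unused and always carries the coefficient \<open>0\<close>.\<close>

type_synonym dseries = "nat \<Rightarrow> complex"

definition dirichlet_polys :: "dseries set" where
  "dirichlet_polys = {a. a 0 = 0 \<and> finite {n. a n \<noteq> 0}}"

definition dseries_eval :: "dseries \<Rightarrow> complex \<Rightarrow> complex" where
  "dseries_eval a s = (\<Sum>n. a n * of_nat n powr (- s))"

definition dseries_shift :: "real \<Rightarrow> dseries \<Rightarrow> dseries" where
  "dseries_shift \<sigma> a = (\<lambda>n. a n * of_real (real n powr (- \<sigma>)))"

lemma dseries_eval_shift: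
  "dseries_eval (dseries_shift \<sigma> a) s = dseries_eval a (s + of_real \<sigma>)"
proof -
  have "of_real (real n powr (- \<sigma>)) * of_nat n powr (- s)
        = (of_nat n :: complex) powr (- (s + of_real \<sigma>))" for n
    using powr_of_real[of "real n" "- \<sigma>"]
    by (simp add: powr_add[symmetric] add.commute flip: powr_of_real)
  then show ?thesis
    by (simp add: dseries_eval_def dseries_shift_def mult.assoc)
qed


section \<open>The infinite torus\<close>

definition circle_measure :: "complex measure" where
  "circle_measure = distr (uniform_measure lborel {0..2 * pi}) borel cis"

definition torus_measure :: "(nat \<Rightarrow> complex) measure" where
  "torus_measure = PiM {q. prime q} (\<lambda>_. circle_measure)"

text \<open>The completely multiplicative map with prescribed values at the primes.\<close>

definition torus_char :: "(nat \<Rightarrow> complex) \<Rightarrow> nat \<Rightarrow> complex" where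
  "torus_char \<omega> n = (\<Prod>q\<in>prime_factors n. \<omega> q ^ multiplicity q n)"

lemma torus_char_prime: "prime q \<Longrightarrow> torus_char \<omega> q = \<omega> q"
  by (simp add: torus_char_def prime_factorization_prime)

lemma torus_char_mult:
  assumes "m > 0" "n > 0"
  shows "torus_char \<omega> (m * n) = torus_char \<omega> m * torus_char \<omega> n"
proof -
  have ext: "torus_char \<omega> k = (\<Prod>q\<in>prime_factors (m * n). \<omega> q ^ multiplicity q k)"
    if "k dvd m * n" for k
    unfolding torus_char_def
  proof (rule prod.mono_neutral_left)
    show "prime_factors k \<subseteq> prime_factors (m * n)"
      using that assms by (intro dvd_prime_factors) auto
    show "\<forall>q\<in>prime_factors (m * n) - prime_factors k. \<omega> q ^ multiplicity q k = 1"
    proof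
      fix q assume "q \<in> prime_factors (m * n) - prime_factors k"
      moreover have "k \<noteq> 0" using that assms by (metis dvd_0_left mult_is_0 neq0_conv)
      ultimately have "\<not> q dvd k"
        by (auto simp: in_prime_factors_iff)
      then show "\<omega> q ^ multiplicity q k = 1"
        by (simp add: not_dvd_imp_multiplicity_0)
    qed
  qed simp
  show ?thesis
    using assms
    by (simp add: ext prime_elem_multiplicity_mult_distrib power_add in_prime_factors_iff
        flip: prod.distrib)
qed

lemma prob_space_circle_measure: "prob_space circle_measure"
proof -
  have "cis \<in> borel_measurable borel"
    by (simp add: cis_conv_exp borel_measurable_continuous_onI continuous_intros)
  then have "cis \<in> borel_measurable (uniform_measure lborel {0..2 * pi})"
    by (simp cong: measurable_cong_sets)
  moreover have "prob_space (uniform_measure lborel {0..2 * pi})"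
    by (rule prob_space_uniform_measure) (auto simp: ennreal_mult_eq_top_iff)
  ultimately show ?thesis
    unfolding circle_measure_def by (intro prob_space.prob_space_distr)
qed

lemma prob_space_torus_measure: "prob_space torus_measure"
  unfolding torus_measure_def by (intro prob_space_PiM prob_space_circle_measure)


section \<open>The norms on Dirichlet polynomials\<close>

definition Hp_norm :: "real \<Rightarrow> dseries \<Rightarrow> real" where
  "Hp_norm p a =
     (\<integral>\<omega>. cmod (\<Sum>n | a n \<noteq> 0. a n * torus_char \<omega> n) powr p \<partial>torus_measure) powr (1 / p)"

definition mu :: "real \<Rightarrow> real measure" where
  "mu \<alpha> = density lborel (\<lambda>\<sigma>. ennreal
     (2 powr (\<alpha> + 1) / Gamma (\<alpha> + 1) * \<sigma> powr \<alpha> * exp (- 2 * \<sigma>) * indicator {0<..} \<sigma>))"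

lemma prob_space_mu:
  assumes "\<alpha> > - 1"
  shows "prob_space (mu \<alpha>)"
proof
  define C where "C = 2 powr (\<alpha> + 1) / Gamma (\<alpha> + 1)"
  have G: "Gamma (\<alpha> + 1) > 0" using assms by (intro Gamma_real_pos) simp
  have C: "C \<ge> 0" using G by (simp add: C_def)
  have [measurable]: "(\<lambda>t::real. ennreal (indicator {0..} t * t powr (\<alpha> + 1 - 1) / exp t))
      \<in> borel_measurable borel" by measurable
  have "emeasure (mu \<alpha>) (space (mu \<alpha>)) = (\<integral>\<^sup>+\<sigma>. ennreal
     (C * \<sigma> powr \<alpha> * exp (- 2 * \<sigma>) * indicator {0<..} \<sigma>) \<partial>lborel)"
    by (simp add: mu_def emeasure_density C_def)
  also have "\<dots> = (\<integral>\<^sup>+\<sigma>. ennreal (2 / Gamma (\<alpha> + 1)) *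
      ennreal (indicator {0..} (0 + 2 * \<sigma>) * (0 + 2 * \<sigma>) powr (\<alpha> + 1 - 1) / exp (0 + 2 * \<sigma>)) \<partial>lborel)"
    using G by (intro nn_integral_cong)
      (auto simp: C_def indicator_def powr_mult powr_add exp_minus field_simps
        simp flip: ennreal_mult')
  also have "\<dots> = ennreal (1 / Gamma (\<alpha> + 1)) * (ennreal 2 * (\<integral>\<^sup>+\<sigma>.
      ennreal (indicator {0..} (0 + 2 * \<sigma>) * (0 + 2 * \<sigma>) powr (\<alpha> + 1 - 1) / exp (0 + 2 * \<sigma>)) \<partial>lborel))"
    using G ennreal_mult'[of 2 "1 / Gamma (\<alpha> + 1)"]
    by (subst nn_integral_cmult) (auto simp: mult_ac)
  also have "\<dots> = ennreal (1 / Gamma (\<alpha> + 1)) * ennreal (Gamma (\<alpha> + 1))"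
    using assms nn_integral_real_affine[of "\<lambda>t::real. ennreal (indicator {0..} t * t powr (\<alpha> + 1 - 1) / exp t)" 2 0]
    by (simp add: Gamma_conv_nn_integral_real)
  also have "\<dots> = 1"
    using G by (simp flip: ennreal_mult')
  finally show "emeasure (mu \<alpha>) (space (mu \<alpha>)) = 1" .
qed

definition Ap_poly_norm :: "real \<Rightarrow> real \<Rightarrow> dseries \<Rightarrow> real" where
  "Ap_poly_norm p \<alpha> a = (\<integral>\<sigma>. Hp_norm p (dseries_shift \<sigma> a) powr p \<partial>mu \<alpha>) powr (1 / p)"


section \<open>The completion and its point evaluations\<close>

definition Ap_represents :: "real \<Rightarrow> real \<Rightarrow> (nat \<Rightarrow> dseries) \<Rightarrow> dseries \<Rightarrow> bool" where
  "Ap_represents p \<alpha> P f \<longleftrightarrow>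
     (\<forall>k. P k \<in> dirichlet_polys) \<and>
     (\<forall>e>0. \<exists>N. \<forall>j\<ge>N. \<forall>k\<ge>N. Ap_poly_norm p \<alpha> (\<lambda>n. P j n - P k n) < e) \<and>
     (\<forall>n. (\<lambda>k. P k n) \<longlonglongrightarrow> f n)"

definition Ap :: "real \<Rightarrow> real \<Rightarrow> dseries set" where
  "Ap p \<alpha> = {f. \<exists>P. Ap_represents p \<alpha> P f}"

text \<open>For \<open>1 \<le> p\<close> and \<open>- 1 < \<alpha>\<close>, a Cauchy sequence of Dirichlet polynomials
  whose coefficients all tend to \<open>0\<close> is a null sequence, so the limit below does not depend on
  the representing sequence.\<close>

definition Ap_norm :: "real \<Rightarrow> real \<Rightarrow> dseries \<Rightarrow> real" where
  "Ap_norm p \<alpha> f =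
     (THE L. \<exists>P. Ap_represents p \<alpha> P f \<and> (\<lambda>k. Ap_poly_norm p \<alpha> (P k)) \<longlonglongrightarrow> L)"

definition Ap_infty :: "real \<Rightarrow> real \<Rightarrow> dseries set" where
  "Ap_infty p \<alpha> = {f \<in> Ap p \<alpha>. f 1 = 0}"

text \<open>The norm of the evaluation at \<open>s\<close> as a functional on a subspace \<open>X\<close> of
  \<open>Ap p \<alpha>\<close>, taken in the extended reals so that an upper bound includes boundedness.\<close>

definition delta_norm :: "real \<Rightarrow> real \<Rightarrow> dseries set \<Rightarrow> complex \<Rightarrow> ennreal" where
  "delta_norm p \<alpha> X s = (SUP f\<in>{f \<in> X. Ap_norm p \<alpha> f \<le> 1}. ennreal (cmod (dseries_eval f s)))"

end

theory Submission
  imports Defs "HOL-Complex_Analysis.Complex_Analysis"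
begin

text \<open>Upper bounds: the disc estimate \<open>\<bar>Q w\<bar>\<^sup>p \<le> (1 - \<bar>w\<bar>\<^sup>2)\<^sup>-\<^sup>1 \<parallel>Q\<parallel>\<^sup>p\<close>, applied one prime at a
  time, bounds \<open>\<bar>P(s)\<bar>\<^sup>p\<close> by \<open>\<zeta>(2 Re s - 2 \<eta>)\<close> times the \<open>p\<close>-th power of the Hardy norm of
  \<open>P\<^sub>\<eta>\<close>; averaging over \<open>0 < \<eta> < (Re s - 1/2) / 2\<close> gives the exponent \<open>\<alpha> + 2\<close>.

  Lower bounds: with \<open>\<delta> = Re s - 1/2\<close> and \<open>m > \<alpha>\<close>, the test function is (a polynomial close to)
  the \<open>m\<close>-th derivative of \<open>\<zeta>(z + cnj s) powr (2 / p)\<close>, whose first coefficient vanishes.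
  Cauchy's estimate on a circle of radius \<open>(\<delta> + \<eta>) / 2\<close> bounds the \<open>p\<close>-th power of the Hardy norm
  of its shift by \<open>\<eta>\<close> by a multiple of \<open>(\<delta> + \<eta>) powr (- m p - 1)\<close>, so the Bergman norm is
  \<open>O(\<delta> powr (\<alpha> / p - m))\<close>, while its value at \<open>s\<close> is of order \<open>\<delta> powr (- m - 2 / p)\<close>.

  Passing to the completion needs two facts. Polynomials converge absolutely to the right of \<open>1/2\<close>
  uniformly on norm-bounded sets, because for every \<open>h > 0\<close> the weights \<open>n powr (- h)\<close> map
  \<open>\<H>\<^sup>1\<close> to \<open>\<H>\<^sup>2\<close>; and the norm on the completion does not depend on the approximating sequence.\<close>

section \<open>Integration over the circle\<close>

text \<open>The obstacle in infinitely many variables is that constants multiply over the primes. In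
  the point estimate the product is a zeta value. For the passage from \<open>\<H>\<^sup>1\<close>
  to \<open>\<H>\<^sup>2\<close> no such product is available, so the one-variable map has to be an
  exact contraction for all but finitely many primes. A coefficient estimate with constant 1 at
  \<open>c 0\<close> provides this. In the lower bound the exponent 2/p turns the p-th power of the
  modulus into the squared modulus of an Euler product, whose mean over the torus is explicit for
  every p. Differentiation steepens the singularity: the integral of \<eta> powr \<alpha> times
  (\<delta> + \<eta>) powr (- m p - 1) is governed by \<eta> of size \<delta> only if m p >
  \<alpha>. Zeta itself never appears, only its Euler products over finite sets of primes. Such a
  set may depend on s because every bound is uniform in it. Away from Re s = 1/2 no extremal
  function is required; the monomials for n = 1 and n = 2 suffice.\<close>

lemma sets_circle_measure [simp, measurable_cong]: "sets circle_measure = sets borel"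
  by (simp add: circle_measure_def)

lemma space_circle_measure [simp]: "space circle_measure = UNIV"
  by (simp add: circle_measure_def)

lemma cis_borel_measurable [measurable]: "cis \<in> borel_measurable borel"
  by (simp add: cis_conv_exp borel_measurable_continuous_onI continuous_intros)

interpretation circle: prob_space circle_measure
  by (rule prob_space_circle_measure)

lemma AE_circle_measure: "AE z in circle_measure. cmod z = 1"
  unfolding circle_measure_def by (subst AE_distr_iff) auto

lemma integral_circle_measure:
  fixes f :: "complex \<Rightarrow> 'a::{banach, second_countable_topology}"
  assumes [measurable]: "f \<in> borel_measurable borel"
  shows "integral\<^sup>L circle_measure f = (1 / (2 * pi)) *\<^sub>R (LBINT t:{0..2*pi}. f (cis t))"
proof -
  have "integral\<^sup>L circle_measure f = integral\<^sup>L (uniform_measure lborel {0..2 * pi}) (\<lambda>t. f (cis t))"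
    unfolding circle_measure_def by (subst integral_distr) auto
  also have "uniform_measure lborel {0..2 * pi} = density lborel (\<lambda>t. ennreal (indicator {0..2*pi} t / (2 * pi)))"
  proof -
    have "1 / ennreal (2 * pi) = ennreal (1 / (2 * pi))"
      by (simp add: divide_ennreal flip: ennreal_1)
    then show ?thesis
      unfolding uniform_measure_def by (intro density_cong) (auto simp: indicator_def)
  qed
  also have "integral\<^sup>L \<dots> (\<lambda>t. f (cis t)) = (LBINT t. (indicator {0..2*pi} t / (2 * pi)) *\<^sub>R f (cis t))"
    by (subst integral_density) auto
  also have "(\<lambda>t. (indicator {0..2*pi} t / (2 * pi)) *\<^sub>R f (cis t)) =
      (\<lambda>t. (1 / (2 * pi)) *\<^sub>R (indicator {0..2*pi} t *\<^sub>R f (cis t)))"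
    by auto
  finally show ?thesis
    by (simp only: set_lebesgue_integral_def integral_scaleR_right)
qed

text \<open>The circle measure is a measure on the Borel sets of the plane. Functions controlled
  only on the circle are therefore cut off by the indicator, which gives measurability and changes
  no integral.\<close>

lemma continuous_on_sphere_measurable:
  fixes f :: "complex \<Rightarrow> complex"
  assumes "continuous_on (sphere 0 1) f"
  shows "(\<lambda>z. indicator (sphere 0 1) z *\<^sub>R f z) \<in> borel_measurable borel"
  by (rule borel_measurable_continuous_on_indicator) (use assms in auto)

text \<open>On the unit circle dz = i z dt. This is the origin of the factor \<open>z\<close> in the
  integrand and of the division by 2 pi i.\<close>

lemma circle_integral_eq_contour_integral:
  assumes I: "(f has_contour_integral I) (circlepath 0 1)"
    and cont: "continuous_on (sphere 0 1) f"
  shows "(LINT z|circle_measure. indicator (sphere 0 1) z *\<^sub>R (z * f z)) = I / (2 * pi * \<i>)"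
proof -
  have "((\<lambda>t. f (cis t) * \<i> * cis t) has_integral I) {0..2*pi}"
    using I has_contour_integral_part_circlepath_iff[of 0 "2*pi" f I 0 1] by (simp add: circlepath_def)
  then have "((\<lambda>t. (1/\<i>) * (f (cis t) * \<i> * cis t)) has_integral (1/\<i>) * I) {0..2*pi}"
    by (rule has_integral_mult_right)
  then have h: "((\<lambda>t. cis t * f (cis t)) has_integral (I/\<i>)) {0..2*pi}"
    by (simp add: field_simps)
  have c: "continuous_on {0..2*pi} (\<lambda>t. cis t * f (cis t))"
    by (intro continuous_intros continuous_on_compose2[OF cont]) (auto intro!: continuous_intros)
  have "set_integrable lborel {0..2*pi} (\<lambda>t. cis t * f (cis t))"
    unfolding set_integrable_def using borel_integrable_compact[OF compact_Icc c]
    by (simp add: indicator_scaleR_eq_if)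
  then have "(LBINT t:{0..2*pi}. cis t * f (cis t)) = I/\<i>"
    using set_borel_integral_eq_integral(2) integral_unique[OF h] by metis
  moreover have "continuous_on (sphere 0 1) (\<lambda>z. z * f z)"
    by (intro continuous_intros cont)
  ultimately show ?thesis
    by (subst integral_circle_measure[OF continuous_on_sphere_measurable])
      (auto simp: scaleR_conv_of_real field_simps)
qed

lemma circle_integrable_continuous:
  fixes f :: "complex \<Rightarrow> 'a::{banach, second_countable_topology}"
  assumes "continuous_on UNIV f"
  shows "integrable circle_measure f"
proof -
  have "compact (f ` sphere 0 1)"
    by (intro compact_continuous_image continuous_on_subset[OF assms]) auto
  then obtain B where "\<forall>x\<in>f ` sphere 0 1. norm x \<le> B"
    using compact_imp_bounded bounded_iff by metis
  then have "AE z in circle_measure. norm (f z) \<le> B"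
    using AE_circle_measure by (auto elim!: eventually_mono)
  moreover have "f \<in> borel_measurable circle_measure"
    using borel_measurable_continuous_onI[OF assms] by (simp cong: measurable_cong_sets)
  ultimately show ?thesis by (intro circle.integrable_const_bound)
qed

section \<open>The Poisson kernel\<close>

definition poisson :: "complex \<Rightarrow> complex \<Rightarrow> real" where
  "poisson w z = (1 - (cmod w)\<^sup>2) / (cmod (z - w))\<^sup>2"

lemma poisson_measurable [measurable]:
  "(\<lambda>(w, z). poisson w z) \<in> borel_measurable (borel \<Otimes>\<^sub>M borel)"
  unfolding poisson_def by measurable

lemma poisson_nonneg: "cmod w < 1 \<Longrightarrow> 0 \<le> poisson w z"
  by (auto simp: poisson_def power_le_one)

text \<open>Cauchy's formula is applied to \<open>g\<close>, that is, to \<open>h\<close> times a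
  factor equal to 1 at \<open>w\<close>. On the circle 1 - cnj w * z = z * cnj (z - w), and so the
  Cauchy kernel times this factor is the Poisson kernel.\<close>

lemma poisson_integral_formula:
  assumes cont: "continuous_on (cball 0 1) h" and hol: "h holomorphic_on ball 0 1"
    and w: "cmod w < 1"
  shows "(LINT z|circle_measure. indicator (sphere 0 1) z *\<^sub>R (of_real (poisson w z) * h z)) = h w"
proof -
  define g where "g u = h u * of_real (1 - (cmod w)\<^sup>2) / (1 - cnj w * u)" for u
  have nz: "1 - cnj w * u \<noteq> 0" if "cmod u \<le> 1" for u
  proof
    assume "1 - cnj w * u = 0"
    then have "cmod w * cmod u = 1"
      by (metis eq_iff_diff_eq_0 complex_mod_cnj norm_mult norm_one)
    with that w show False
      by (metis less_le_not_le mult_left_le norm_ge_zero)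
  qed
  have sq: "(complex_of_real (cmod x))\<^sup>2 = x * cnj x" for x
    using complex_norm_square[of x] by simp
  have nw: "1 - w * cnj w \<noteq> 0"
    using nz[of w] w by (simp add: mult.commute)
  have "((\<lambda>u. g u / (u - w)) has_contour_integral (2 * of_real pi * \<i> * g w)) (circlepath 0 1)"
    by (rule Cauchy_integral_circlepath)
      (use w nz in \<open>auto simp: g_def intro!: continuous_intros holomorphic_intros cont hol\<close>)
  moreover have "continuous_on (sphere 0 1) (\<lambda>u. g u / (u - w))"
    unfolding g_def
    by (intro continuous_intros continuous_on_subset[OF cont]) (use nz w in auto)
  ultimately have "(LINT z|circle_measure. indicator (sphere 0 1) z *\<^sub>R (z * (g z / (z - w)))) = g w"
    by (subst circle_integral_eq_contour_integral) auto
  then have main: "(LINT z|circle_measure. indicator (sphere 0 1) z *\<^sub>R (z * (g z / (z - w)))) = h w"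
    using nw by (simp add: g_def sq mult.commute)
  have "z * (g z / (z - w)) = of_real (poisson w z) * h z" if z: "cmod z = 1" for z
  proof -
    have "z * cnj z = 1" using z by (simp flip: sq)
    then have "1 - cnj w * z = z * cnj (z - w)" by (simp add: algebra_simps)
    then have *: "z * (g z / (z - w)) = h z * of_real (1 - (cmod w)\<^sup>2) / (cnj (z - w) * (z - w))"
      using z by (auto simp: g_def)
    show ?thesis
      unfolding * poisson_def by (simp add: sq mult.commute)
  qed
  then have "(\<lambda>z. indicator (sphere 0 1) z *\<^sub>R (of_real (poisson w z) * h z)) =
      (\<lambda>z. indicator (sphere 0 1) z *\<^sub>R (z * (g z / (z - w))))"
    by (intro ext) (simp split: split_indicator)
  then show ?thesis using main by simp
qed

text \<open>The case h = 1 of the integral formula. It makes the Poisson kernel a probability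
  density, as Jensen's inequality requires.\<close>

lemma nn_integral_poisson:
  assumes "cmod w < 1"
  shows "(\<integral>\<^sup>+z. ennreal (poisson w z) \<partial>circle_measure) = 1"
proof -
  define P where "P z = indicator (sphere 0 1) z * poisson w z" for z
  have [measurable]: "P \<in> borel_measurable borel"
    unfolding P_def by (intro borel_measurable_times borel_measurable_indicator borel_closed) simp_all
  have nz: "z \<noteq> w" if "cmod z = 1" for z using that assms by auto
  have "compact (poisson w ` sphere 0 1)"
    unfolding poisson_def
    by (intro compact_continuous_image continuous_intros) (use nz in auto)
  then obtain B where B: "\<And>x. x \<in> poisson w ` sphere 0 1 \<Longrightarrow> norm x \<le> B"
    using compact_imp_bounded bounded_iff by metis
  have int: "integrable circle_measure P"
  proof (rule circle.integrable_const_bound[where B="\<bar>B\<bar>"])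
    show "AE x in circle_measure. norm (P x) \<le> \<bar>B\<bar>"
      using B by (intro AE_I2) (force simp: P_def indicator_def)
  qed simp
  have "of_real (LINT z|circle_measure. P z) = (1::complex)"
    using poisson_integral_formula[of "\<lambda>_. 1" w] assms
    by (simp add: P_def scaleR_conv_of_real flip: integral_complex_of_real)
  then have P1: "(LINT z|circle_measure. P z) = 1"
    by (metis of_real_eq_1_iff)
  have "0 \<le> P z" for z
    using poisson_nonneg[OF assms] by (simp add: P_def)
  then have "(\<integral>\<^sup>+z. ennreal (P z) \<partial>circle_measure) = 1"
    by (subst nn_integral_eq_integral[OF int]) (simp_all add: P1)
  also have "(\<integral>\<^sup>+z. ennreal (P z) \<partial>circle_measure) = (\<integral>\<^sup>+z. ennreal (poisson w z) \<partial>circle_measure)"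
    using AE_circle_measure by (intro nn_integral_cong_AE) (auto simp: P_def elim!: eventually_mono)
  finally show ?thesis .
qed

section \<open>Convexity of powers, Jensen's inequality and its consequences on the disc\<close>

lemma powr_tangent_le:
  fixes x y p :: real
  assumes "1 \<le> p" "0 < y" "0 \<le> x"
  shows "y powr p + p * y powr (p - 1) * (x - y) \<le> x powr p"
proof (cases "x = 0")
  \<comment> \<open>The value x = 0 is treated apart: the tangent argument takes place in the open
    half-line, where the derivative is available.\<close>
  case True
  have "y powr (p - 1) * y = y powr p"
    using assms by (simp add: powr_mult_base mult.commute)
  then have "y powr p + p * y powr (p - 1) * (0 - y) = (1 - p) * y powr p"
    by (simp add: algebra_simps)
  also have "\<dots> \<le> 0" using assms by (simp add: mult_nonpos_nonneg)
  finally show ?thesis using True by simp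
next
  case False
  have "x powr p - y powr p \<ge> p * y powr (p - 1) * (x - y)"
    by (rule convex_on_imp_above_tangent[OF powr_convex[OF assms(1)]])
      (use assms False in \<open>auto intro!: derivative_eq_intros simp: interior_open\<close>)
  then show ?thesis by simp
qed

text \<open>Integrate the tangent inequality at the mean of cmod X; its linear term has mean zero.
  If the p-th power is not integrable, the right side is infinite.\<close>

lemma (in prob_space) nn_jensen_powr:
  fixes X :: "'a \<Rightarrow> complex"
  assumes X: "integrable M X" and p: "1 \<le> p"
  shows "ennreal (cmod (integral\<^sup>L M X) powr p) \<le> (\<integral>\<^sup>+x. ennreal (cmod (X x) powr p) \<partial>M)"
proof (cases "integrable M (\<lambda>x. cmod (X x) powr p)")
  case False
  have "(\<integral>\<^sup>+x. ennreal (cmod (X x) powr p) \<partial>M) = \<infinity>"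
    using False X by (subst (asm) integrable_iff_bounded) (auto simp: less_top[symmetric])
  then show ?thesis by simp
next
  case True
  define y where "y = (\<integral>x. cmod (X x) \<partial>M)"
  have le: "cmod (integral\<^sup>L M X) \<le> y" by (simp add: y_def)
  have "y powr p \<le> (\<integral>x. cmod (X x) powr p \<partial>M)"
  proof (cases "y = 0")
    case False
    then have y: "0 < y" using le norm_ge_zero by (smt (verit))
    have "y powr p = (\<integral>x. y powr p + p * y powr (p - 1) * (cmod (X x) - y) \<partial>M)"
      using X by (simp add: prob_space y_def[symmetric])
    also have "\<dots> \<le> (\<integral>x. cmod (X x) powr p \<partial>M)"
      by (intro integral_mono powr_tangent_le) (use X True y p in auto)
    finally show ?thesis .
  qed (use p in auto)
  then have "cmod (integral\<^sup>L M X) powr p \<le> (\<integral>x. cmod (X x) powr p \<partial>M)"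
    using le p by (smt (verit) norm_ge_zero powr_mono2)
  then show ?thesis
    using True by (subst nn_integral_eq_integral) (auto intro!: ennreal_leI)
qed

text \<open>The value h w is the mean of the boundary values for the probability measure with the
  Poisson kernel as density. The boundary modulus enters as a separate Borel function
  \<open>g\<close>, because \<open>h\<close> is controlled only on the closed disc.\<close>

lemma poisson_jensen:
  assumes cont: "continuous_on (cball 0 1) h" and hol: "h holomorphic_on ball 0 1"
    and w: "cmod w < 1" and p: "1 \<le> p" and [measurable]: "g \<in> borel_measurable borel"
    and g: "\<And>z. cmod z = 1 \<Longrightarrow> ennreal (cmod (h z) powr p) = g z"
  shows "ennreal (cmod (h w) powr p) \<le> (\<integral>\<^sup>+z. ennreal (poisson w z) * g z \<partial>circle_measure)"
proof -
  define H where "H z = indicator (sphere 0 1) z *\<^sub>R h z" for z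
  have [measurable]: "H \<in> borel_measurable borel"
    unfolding H_def
    by (rule continuous_on_sphere_measurable) (rule continuous_on_subset[OF cont], auto)
  define M where "M = density circle_measure (\<lambda>z. ennreal (poisson w z))"
  interpret M: prob_space M
    by (rule prob_spaceI) (simp add: M_def emeasure_density nn_integral_poisson[OF w])
  have "compact (h ` cball 0 1)"
    by (intro compact_continuous_image cont) auto
  then obtain B where B: "\<And>x. x \<in> h ` cball 0 1 \<Longrightarrow> norm x \<le> B"
    using compact_imp_bounded bounded_iff by metis
  have int: "integrable M H"
  proof (rule M.integrable_const_bound[where B="\<bar>B\<bar>"])
    show "AE x in M. norm (H x) \<le> \<bar>B\<bar>"
    proof (rule AE_I2)
      fix z show "norm (H z) \<le> \<bar>B\<bar>"
        using B[of "h z"] by (cases "z \<in> sphere 0 1") (auto simp: H_def)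
    qed
  qed (simp add: M_def)
  have "integral\<^sup>L M H = (LINT z|circle_measure. poisson w z *\<^sub>R H z)"
    unfolding M_def by (rule integral_density) (auto simp: poisson_nonneg[OF w])
  also have "\<dots> = h w"
    using poisson_integral_formula[OF cont hol w]
    by (simp add: H_def scaleR_conv_of_real mult_ac)
  finally have "ennreal (cmod (h w) powr p) \<le> (\<integral>\<^sup>+z. ennreal (cmod (H z) powr p) \<partial>M)"
    using M.nn_jensen_powr[OF int p] by simp
  also have "\<dots> = (\<integral>\<^sup>+z. ennreal (poisson w z) * ennreal (cmod (H z) powr p) \<partial>circle_measure)"
    unfolding M_def by (rule nn_integral_density) auto
  also have "\<dots> = (\<integral>\<^sup>+z. ennreal (poisson w z) * g z \<partial>circle_measure)"
    using AE_circle_measure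
    by (intro nn_integral_cong_AE) (auto simp: H_def g elim!: eventually_mono)
  finally show ?thesis .
qed

text \<open>Jensen's inequality is applied to \<open>Q\<close> times (1 - cnj w * z) powr (2 / p).
  The p-th power of this factor has modulus cmod (1 - cnj w * z) squared. On the circle it cancels
  the denominator of the Poisson kernel and leaves 1 - (cmod w)^2; at z = w it is (1 - (cmod
  w)^2)^2. The quotient is the stated constant.\<close>

lemma disc_point_evaluation:
  assumes hol: "Q holomorphic_on UNIV" and w: "cmod w < 1" and p: "1 \<le> p"
  shows "ennreal (cmod (Q w) powr p) \<le>
    ennreal (1 / (1 - (cmod w)\<^sup>2)) * (\<integral>\<^sup>+z. ennreal (cmod (Q z) powr p) \<partial>circle_measure)"
proof -
  define h where "h z = Q z * (1 - cnj w * z) powr of_real (2 / p)" for z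
  have Qc: "continuous_on UNIV Q" using hol holomorphic_on_imp_continuous_on by blast
  have [measurable]: "Q \<in> borel_measurable borel"
    by (rule borel_measurable_continuous_onI[OF Qc])
  have w1: "(cmod w)\<^sup>2 < 1" using w by (simp add: power_less_one_iff)
  have re: "Re (1 - cnj w * z) > 0" if "cmod z \<le> 1" for z
  proof -
    have "Re (cnj w * z) \<le> cmod (cnj w * z)" by (rule complex_Re_le_cmod)
    also have "\<dots> \<le> cmod w" using that by (simp add: norm_mult mult_left_le)
    finally show ?thesis using w by simp
  qed
  have slit: "1 - cnj w * z \<notin> \<real>\<^sub>\<le>\<^sub>0" if "cmod z \<le> 1" for z
    using re[OF that] complex_nonpos_Reals_iff by force
  have norm_h: "cmod (h z) powr p = cmod (Q z) powr p * (cmod (1 - cnj w * z))\<^sup>2" for z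
    using p by (cases "1 - cnj w * z = 0")
      (simp_all add: h_def norm_mult norm_powr_real_powr' powr_mult powr_powr)
  have "ennreal (cmod (h w) powr p) \<le> (\<integral>\<^sup>+z. ennreal (poisson w z) *
      ennreal (cmod (Q z) powr p * (cmod (1 - cnj w * z))\<^sup>2) \<partial>circle_measure)"
  proof (rule poisson_jensen[OF _ _ w p])
    show "continuous_on (cball 0 1) h"
      unfolding h_def by (intro continuous_intros continuous_on_subset[OF Qc])
        (use re p in \<open>auto simp: less_imp_le\<close>)
    show "h holomorphic_on ball 0 1"
      unfolding h_def by (intro holomorphic_intros holomorphic_on_subset[OF hol]) (use slit in auto)
  qed (simp_all add: norm_h)
  also have "\<dots> = (\<integral>\<^sup>+z. ennreal (1 - (cmod w)\<^sup>2) * ennreal (cmod (Q z) powr p) \<partial>circle_measure)"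
  proof (intro nn_integral_cong_AE, use AE_circle_measure in eventually_elim)
    fix z :: complex assume z: "cmod z = 1"
    then have zz: "z * cnj z = 1" by (simp add: complex_norm_square[symmetric])
    have "1 - cnj w * z = z * cnj (z - w)" using zz by (simp add: algebra_simps)
    then have "cmod (1 - cnj w * z) = cmod (z - w)" using z
      by (simp add: norm_mult flip: complex_cnj_diff)
    moreover have "cmod (z - w) \<noteq> 0" using z w by auto
    ultimately show "ennreal (poisson w z) * ennreal (cmod (Q z) powr p * (cmod (1 - cnj w * z))\<^sup>2) =
        ennreal (1 - (cmod w)\<^sup>2) * ennreal (cmod (Q z) powr p)"
      using poisson_nonneg[OF w, of z] w1 by (simp add: poisson_def flip: ennreal_mult')
  qed
  also have "\<dots> = ennreal (1 - (cmod w)\<^sup>2) * (\<integral>\<^sup>+z. ennreal (cmod (Q z) powr p) \<partial>circle_measure)"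
    by (rule nn_integral_cmult) simp
  finally have le: "ennreal (cmod (h w) powr p) \<le> \<dots>" .
  have "cmod (1 - cnj w * w) = 1 - (cmod w)\<^sup>2"
  proof -
    have "1 - cnj w * w = of_real (1 - (cmod w)\<^sup>2)"
      using complex_norm_square[of w] by (simp add: mult.commute)
    then show ?thesis using w1 by (metis abs_of_pos diff_gt_0_iff_gt norm_of_real)
  qed
  then have hw: "cmod (h w) powr p = (1 - (cmod w)\<^sup>2)\<^sup>2 * cmod (Q w) powr p"
    by (simp add: norm_h)
  have "ennreal (cmod (Q w) powr p) = ennreal (1 / (1 - (cmod w)\<^sup>2)\<^sup>2) * ennreal (cmod (h w) powr p)"
    using w1 by (simp add: hw flip: ennreal_mult')
  also have "\<dots> \<le> ennreal (1 / (1 - (cmod w)\<^sup>2)\<^sup>2) *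
     (ennreal (1 - (cmod w)\<^sup>2) * (\<integral>\<^sup>+z. ennreal (cmod (Q z) powr p) \<partial>circle_measure))"
    by (intro mult_left_mono le) auto
  also have "\<dots> = ennreal (1 / (1 - (cmod w)\<^sup>2)) * (\<integral>\<^sup>+z. ennreal (cmod (Q z) powr p) \<partial>circle_measure)"
    using w1 by (simp add: mult.assoc[symmetric] power2_eq_square flip: ennreal_mult')
  finally show ?thesis .
qed

text \<open>For r < 1, bound the value at r * z by the Poisson mean, integrate over z and exchange
  the integrals. The Poisson kernel is symmetric in the two boundary points, so the inner integral
  is 1.\<close>

lemma circle_norm_dilation_le:
  assumes hol: "Q holomorphic_on UNIV" and r: "0 \<le> r" "r \<le> 1" and p: "1 \<le> p"
  shows "(\<integral>\<^sup>+z. ennreal (cmod (Q (of_real r * z)) powr p) \<partial>circle_measure) \<le>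
    (\<integral>\<^sup>+z. ennreal (cmod (Q z) powr p) \<partial>circle_measure)"
proof (cases "r = 1")
  case False
  with r have r1: "r < 1" by simp
  have Qc: "continuous_on UNIV Q" using hol holomorphic_on_imp_continuous_on by blast
  have [measurable]: "Q \<in> borel_measurable borel"
    by (rule borel_measurable_continuous_onI[OF Qc])
  interpret pair_prob_space circle_measure circle_measure ..
  have "(\<integral>\<^sup>+z. ennreal (cmod (Q (of_real r * z)) powr p) \<partial>circle_measure) \<le>
    (\<integral>\<^sup>+z. \<integral>\<^sup>+u. ennreal (poisson (of_real r * z) u) * ennreal (cmod (Q u) powr p) \<partial>circle_measure \<partial>circle_measure)"
  proof (intro nn_integral_mono_AE, use AE_circle_measure in eventually_elim)
    fix z :: complex assume z: "cmod z = 1"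
    show "ennreal (cmod (Q (of_real r * z)) powr p) \<le>
      (\<integral>\<^sup>+u. ennreal (poisson (of_real r * z) u) * ennreal (cmod (Q u) powr p) \<partial>circle_measure)"
      by (rule poisson_jensen)
        (use z r r1 p hol in \<open>auto simp: norm_mult intro: continuous_on_subset[OF Qc] holomorphic_on_subset\<close>)
  qed
  also have "\<dots> = (\<integral>\<^sup>+u. \<integral>\<^sup>+z. ennreal (poisson (of_real r * z) u) * ennreal (cmod (Q u) powr p) \<partial>circle_measure \<partial>circle_measure)"
    by (rule Fubini') simp
  also have "\<dots> = (\<integral>\<^sup>+u. ennreal (cmod (Q u) powr p) \<partial>circle_measure)"
  proof (intro nn_integral_cong_AE, use AE_circle_measure in eventually_elim)
    fix u :: complex assume u: "cmod u = 1"
    have sym: "poisson (of_real r * z) u = poisson (of_real r * u) z" if z: "cmod z = 1" for z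
    proof -
      have "z * cnj z = 1" "u * cnj u = 1"
        using z u by (simp_all add: complex_norm_square[symmetric])
      then have "u - of_real r * z = u * z * cnj (z - of_real r * u)"
        by (simp add: algebra_simps)
      then have "cmod (u - of_real r * z) = cmod (z - of_real r * u)"
        using z u by (metis complex_mod_cnj mult.left_neutral norm_mult)
      then show ?thesis using z u by (simp add: poisson_def norm_mult)
    qed
    have "(\<integral>\<^sup>+z. ennreal (poisson (of_real r * z) u) * ennreal (cmod (Q u) powr p) \<partial>circle_measure) =
      (\<integral>\<^sup>+z. ennreal (poisson (of_real r * u) z) * ennreal (cmod (Q u) powr p) \<partial>circle_measure)"
      using AE_circle_measure by (intro nn_integral_cong_AE) (auto simp: sym elim!: eventually_mono)
    also have "\<dots> = ennreal (cmod (Q u) powr p)"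
      using u r r1 by (subst nn_integral_multc) (auto simp: nn_integral_poisson norm_mult)
    finally show "(\<integral>\<^sup>+z. ennreal (poisson (of_real r * z) u) * ennreal (cmod (Q u) powr p) \<partial>circle_measure) =
      ennreal (cmod (Q u) powr p)" .
  qed
  finally show ?thesis .
qed simp

section \<open>A contraction from \<open>H\<^sup>1\<close> to \<open>H\<^sup>2\<close> of the disc\<close>

lemma circle_integral_holomorphic:
  assumes "h holomorphic_on UNIV"
  shows "(LINT z|circle_measure. h z) = h 0"
proof -
  have hc: "continuous_on UNIV h" using assms holomorphic_on_imp_continuous_on by blast
  have [measurable]: "h \<in> borel_measurable borel"
    by (rule borel_measurable_continuous_onI[OF hc])
  have "h 0 = (LINT z|circle_measure. indicator (sphere 0 1) z *\<^sub>R (of_real (poisson 0 z) * h z))"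
    by (rule poisson_integral_formula[symmetric])
      (auto intro: continuous_on_subset[OF hc] holomorphic_on_subset[OF assms])
  also have "\<dots> = (LINT z|circle_measure. h z)"
  proof (rule integral_cong_AE)
    show "AE z in circle_measure. indicator (sphere 0 1) z *\<^sub>R (of_real (poisson 0 z) * h z) = h z"
      using AE_circle_measure by eventually_elim (simp add: poisson_def)
    show "(\<lambda>z. indicator (sphere 0 1) z *\<^sub>R (of_real (poisson 0 z) * h z)) \<in> borel_measurable circle_measure"
      by (intro borel_measurable_scaleR borel_measurable_times borel_measurable_indicator
        borel_measurable_of_real) simp_all
  qed simp
  finally show ?thesis ..
qed

lemma circle_integral_monomials:
  "(LINT z|circle_measure. z ^ j * cnj z ^ k) = (if j = k then 1 else 0)"
proof -
  have int: "integrable circle_measure (\<lambda>z::complex. z ^ j * cnj z ^ k)" for j k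
    by (rule circle_integrable_continuous) (intro continuous_intros)
  have le: "(LINT z|circle_measure. z ^ j * cnj z ^ k) = (if j = k then 1 else 0)" if "k \<le> j" for j k
  proof -
    have "(LINT z|circle_measure. z ^ j * cnj z ^ k) = (LINT z|circle_measure. z ^ (j - k))"
    proof (rule integral_cong_AE)
      show "AE z in circle_measure. z ^ j * cnj z ^ k = z ^ (j - k)"
        using AE_circle_measure
      proof eventually_elim
        fix z :: complex assume "cmod z = 1"
        then have "z * cnj z = 1" using complex_norm_square[of z] by simp
        then have "z ^ k * cnj z ^ k = 1" by (metis power_mult_distrib power_one)
        moreover have "z ^ j = z ^ (j - k) * z ^ k" using that by (metis le_add_diff_inverse2 power_add)
        ultimately show "z ^ j * cnj z ^ k = z ^ (j - k)" by (simp add: mult.assoc)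
      qed
    qed (use int[of "j - k" 0] int[of j k] in auto)
    also have "\<dots> = 0 ^ (j - k)"
      by (rule circle_integral_holomorphic) (intro holomorphic_intros)
    finally show ?thesis using that by simp
  qed
  show ?thesis
  proof (cases "k \<le> j")
    case False
    have "(LINT z|circle_measure. z ^ j * cnj z ^ k) = (LINT z|circle_measure. cnj (z ^ k * cnj z ^ j))"
      by (intro Bochner_Integration.integral_cong) auto
    also have "\<dots> = cnj (LINT z|circle_measure. z ^ k * cnj z ^ j)" by (rule integral_bounded_linear'[OF bounded_linear_cnj bounded_linear_cnj]) simp
    finally show ?thesis using False le[of j k] by simp
  qed (rule le)
qed

text \<open>Analyticity makes \<open>cnj Q\<close> orthogonal to \<open>cnj z ^ k\<close>, so the coefficient \<open>c k\<close> sees only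
  the imaginary part of \<open>Q\<close> rotated such that \<open>c 0\<close> is nonnegative, and the imaginary part is
  small in mean when \<open>cmod (c 0)\<close> is close to the norm of \<open>Q\<close>.\<close>

lemma H1_coefficient_le:
  fixes c :: "nat \<Rightarrow> complex" and d :: nat
  defines "Q \<equiv> \<lambda>z. \<Sum>k\<le>d. c k * z ^ k"
  defines "M \<equiv> LINT z|circle_measure. cmod (Q z)"
  shows "k \<le> d \<Longrightarrow> cmod (c k) \<le> M"
    and "1 \<le> k \<Longrightarrow> k \<le> d \<Longrightarrow> (cmod (c k))\<^sup>2 \<le> 4 * (M\<^sup>2 - (cmod (c 0))\<^sup>2)"
proof -
  have Qc: "continuous_on UNIV Q" unfolding Q_def by (intro continuous_intros)
  note int = circle_integrable_continuous
  have coeff: "(LINT z|circle_measure. Q z * cnj z ^ k) = c k" if "k \<le> d" for k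
  proof -
    have "(LINT z|circle_measure. Q z * cnj z ^ k) =
        (LINT z|circle_measure. (\<Sum>j\<le>d. c j * (z ^ j * cnj z ^ k)))"
      by (simp add: Q_def sum_distrib_right mult.assoc)
    also have "\<dots> = (\<Sum>j\<le>d. LINT z|circle_measure. c j * (z ^ j * cnj z ^ k))"
      by (intro Bochner_Integration.integral_sum int continuous_intros)
    also have "\<dots> = (\<Sum>j\<le>d. if j = k then c j else 0)"
      by (intro sum.cong) (auto simp: circle_integral_monomials)
    finally show ?thesis using that by simp
  qed
  have AE1: "AE z in circle_measure. cmod (cnj z ^ k) = 1" for k
    using AE_circle_measure by eventually_elim (simp add: norm_power)
  have bd: "cmod (LINT z|circle_measure. f z * cnj z ^ k) \<le> (LINT z|circle_measure. cmod (f z))"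
    if f: "continuous_on UNIV f" for f k
  proof -
    have "cmod (LINT z|circle_measure. f z * cnj z ^ k) \<le> (LINT z|circle_measure. cmod (f z * cnj z ^ k))"
      by (rule integral_norm_bound)
    also have "\<dots> = (LINT z|circle_measure. cmod (f z))"
      by (intro integral_cong_AE borel_measurable_integrable int continuous_intros f)
        (use AE1[of k] in eventually_elim, simp add: norm_mult)
    finally show ?thesis .
  qed
  show le: "cmod (c k) \<le> M" if "k \<le> d" for k
    using bd[OF Qc, of k] coeff[OF that] by (simp add: M_def)
  show "(cmod (c k))\<^sup>2 \<le> 4 * (M\<^sup>2 - (cmod (c 0))\<^sup>2)" if k: "1 \<le> k" "k \<le> d"
  proof -
    define a where "a = cmod (c 0)"
    obtain u where u: "cmod u = 1" "u * c 0 = of_real a"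
    proof (cases "c 0 = 0")
      case True then show ?thesis using that[of 1] by (simp add: a_def)
    next
      case False
      have "c 0 * cnj (c 0) = of_real a * of_real a"
        using complex_norm_square[of "c 0"] by (simp add: a_def power2_eq_square)
      then show ?thesis using False that[of "cnj (c 0) / of_real a"]
        by (simp add: a_def norm_divide field_simps)
    qed
    define R where "R z = u * Q z" for z
    have Rc: "continuous_on UNIV R" unfolding R_def by (intro continuous_intros Qc)
    have nR: "cmod (R z) = cmod (Q z)" for z using u by (simp add: R_def norm_mult)
    define X where "X = (LINT z|circle_measure. \<bar>Im (R z)\<bar>)"
    have "(LINT z|circle_measure. R z * cnj z ^ k) = u * c k"
      using coeff[OF k(2)] by (simp add: R_def mult.assoc)
    moreover have "(LINT z|circle_measure. cnj (R z) * cnj z ^ k) = 0"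
    proof -
      have "(LINT z|circle_measure. R z * z ^ k) = R 0 * 0 ^ k"
        unfolding R_def Q_def
        by (rule circle_integral_holomorphic) (intro holomorphic_intros)
      then have "cnj (LINT z|circle_measure. R z * z ^ k) = 0" using k by simp
      also have "cnj (LINT z|circle_measure. R z * z ^ k) = (LINT z|circle_measure. cnj (R z * z ^ k))"
        by (rule integral_bounded_linear'[OF bounded_linear_cnj bounded_linear_cnj, symmetric]) simp
      finally show ?thesis by simp
    qed
    ultimately have "u * c k = (LINT z|circle_measure. R z * cnj z ^ k - cnj (R z) * cnj z ^ k)"
      by (subst Bochner_Integration.integral_diff)
        (auto intro!: int continuous_intros Rc)
    also have "\<dots> = (LINT z|circle_measure. (2 * \<i> * of_real (Im (R z))) * cnj z ^ k)"
      by (intro Bochner_Integration.integral_cong)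
        (auto simp: complex_diff_cnj simp flip: left_diff_distrib)
    finally have uck: "u * c k = \<dots>" .
    have "cmod (c k) = cmod (u * c k)" using u by (simp add: norm_mult)
    also have "\<dots> \<le> (LINT z|circle_measure. cmod (2 * \<i> * of_real (Im (R z))))"
      unfolding uck by (intro bd continuous_intros Rc)
    also have "\<dots> = 2 * X" by (simp add: X_def norm_mult)
    finally have cX: "cmod (c k) \<le> 2 * X" .
    have intRe: "(LINT z|circle_measure. Re (R z)) = a"
    proof -
      have "(LINT z|circle_measure. R z) = u * c 0"
        using coeff[of 0] by (simp add: R_def)
      then have "Re (LINT z|circle_measure. R z) = a" using u by simp
      then show ?thesis by (simp add: int Rc)
    qed
    have intM: "(LINT z|circle_measure. cmod (R z)) = M"
      by (simp add: M_def nR)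
    have iR: "integrable circle_measure (\<lambda>z. cmod (R z))" "integrable circle_measure (\<lambda>z. Re (R z))"
      by (intro int continuous_intros Rc)+
    \<comment> \<open>The square of Im (R z) is the product of cmod (R z) - Re (R z) and cmod (R z)
      + Re (R z), whose means are M - a and M + a. A weighted arithmetic-geometric mean with free
      \<open>t\<close> takes the place of the Cauchy-Schwarz inequality.\<close>
    have amgm: "2 * X \<le> t * (M - a) + (M + a) / t" if t: "t > 0" for t
    proof -
      have "2 * X = (LINT z|circle_measure. 2 * \<bar>Im (R z)\<bar>)" by (simp add: X_def)
      also have "\<dots> \<le> (LINT z|circle_measure. t * (cmod (R z) - Re (R z)) + (cmod (R z) + Re (R z)) / t)"
      proof (intro integral_mono)
        fix z
        define A where "A = cmod (R z) - Re (R z)"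
        define B where "B = cmod (R z) + Re (R z)"
        have AB: "A \<ge> 0" "B \<ge> 0"
          using abs_Re_le_cmod[of "R z"] by (auto simp: A_def B_def)
        have "A * B = (Im (R z))\<^sup>2"
          using cmod_power2[of "R z"] by (simp add: A_def B_def algebra_simps power2_eq_square)
        then have "\<bar>Im (R z)\<bar> = sqrt ((t * A) * (B / t))" using t by simp
        also have "\<dots> \<le> (t * A + B / t) / 2"
          by (rule arith_geo_mean_sqrt) (use AB t in auto)
        finally show "2 * \<bar>Im (R z)\<bar> \<le> t * (cmod (R z) - Re (R z)) + (cmod (R z) + Re (R z)) / t"
          by (simp add: A_def B_def)
      qed (use t in \<open>auto intro!: int continuous_intros Rc\<close>)
      also have "\<dots> = t * (M - a) + (M + a) / t"
        using iR by (simp add: intM intRe)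
      finally show ?thesis .
    qed
    have aM: "a \<le> M" using le[of 0] by (simp add: a_def)
    have a0: "0 \<le> a" by (simp add: a_def)
    have X0: "0 \<le> X" by (simp add: X_def)
    have "X\<^sup>2 \<le> (M - a) * (M + a)"
    proof (cases "X = 0")
      case False
      then have X: "X > 0" using X0 by simp
      \<comment> \<open>The optimal weight is t = X / (M - a). If M = a, the weight (M + a) / X, or
        1 when a = 0, contradicts X > 0.\<close>
      show ?thesis
      proof (cases "M = a")
        case True
        then show ?thesis using amgm[of "(M + a) / X"] X aM a0
          by (cases "a = 0") (use amgm[of 1] True X in \<open>auto simp: field_simps\<close>)
      next
        case False
        then have "M - a > 0" using aM by simp
        then have "2 * X \<le> X + (M + a) * (M - a) / X"
          using amgm[of "X / (M - a)"] X by simp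
        then show ?thesis using X by (simp add: field_simps power2_eq_square)
      qed
    qed (use aM a0 in auto)
    also have "\<dots> = M\<^sup>2 - (cmod (c 0))\<^sup>2" by (simp add: a_def power2_eq_square algebra_simps)
    finally have "4 * X\<^sup>2 \<le> 4 * (M\<^sup>2 - (cmod (c 0))\<^sup>2)" by simp
    moreover have "(cmod (c k))\<^sup>2 \<le> (2 * X)\<^sup>2" using cX by (intro power_mono) auto
    ultimately show ?thesis by (simp add: power2_eq_square)
  qed
qed

text \<open>The threshold 1/5 is where 4 * r^2 / (1 - r^2) reaches 1: below it the squares of the
  terms with k >= 1 add up to at most M^2 - (cmod (c 0))^2, which gives constant exactly 1. Above
  it, the bound cmod (c k) <= M and a geometric series give the second value.\<close>

definition H1_H2_const :: "real \<Rightarrow> real" where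
  "H1_H2_const r = (if r\<^sup>2 \<le> 1/5 then 1 else 1 / sqrt (1 - r\<^sup>2))"

lemma H1_H2_const_ge_1: "0 \<le> r \<Longrightarrow> r < 1 \<Longrightarrow> 1 \<le> H1_H2_const r"
  by (auto simp: H1_H2_const_def power_le_one power_less_one_iff)

lemma H1_H2_dilation_le:
  fixes c :: "nat \<Rightarrow> complex"
  assumes r: "0 \<le> r" "r < 1"
  shows "L2_set (\<lambda>k. cmod (c k) * r ^ k) {..d} \<le>
    H1_H2_const r * (LINT z|circle_measure. cmod (\<Sum>k\<le>d. c k * z ^ k))"
proof -
  define M where "M = (LINT z|circle_measure. cmod (\<Sum>k\<le>d. c k * z ^ k))"
  have M0: "0 \<le> M" by (simp add: M_def)
  note le = H1_coefficient_le[of _ d c, folded M_def]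
  have r2: "r\<^sup>2 < 1" "0 \<le> r\<^sup>2" using r by (auto simp: power_less_one_iff)
  have geo: "(\<Sum>k\<in>A. (r\<^sup>2) ^ k) \<le> 1 / (1 - r\<^sup>2)" if "finite A" for A
    using sum_le_suminf[of "\<lambda>k. (r\<^sup>2) ^ k" A] suminf_geometric[of "r\<^sup>2"] summable_geometric[of "r\<^sup>2"] r2 that
    by auto
  have sq: "(L2_set (\<lambda>k. cmod (c k) * r ^ k) {..d})\<^sup>2 = (\<Sum>k\<le>d. (cmod (c k))\<^sup>2 * (r\<^sup>2) ^ k)"
    by (subst L2_set_def, subst real_sqrt_pow2)
      (use r in \<open>auto intro!: sum_nonneg sum.cong mult_nonneg_nonneg simp: power_mult_distrib power_mult[symmetric] mult.commute[of 2]\<close>)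
  have "(L2_set (\<lambda>k. cmod (c k) * r ^ k) {..d})\<^sup>2 \<le> (H1_H2_const r * M)\<^sup>2"
  proof (cases "r\<^sup>2 \<le> 1/5")
    case True
    have "(\<Sum>k\<le>d. (cmod (c k))\<^sup>2 * (r\<^sup>2) ^ k) = (cmod (c 0))\<^sup>2 + (\<Sum>k\<in>{1..d}. (cmod (c k))\<^sup>2 * (r\<^sup>2) ^ k)"
      by (simp add: atMost_atLeast0 sum.atLeast_Suc_atMost)
    also have "(\<Sum>k\<in>{1..d}. (cmod (c k))\<^sup>2 * (r\<^sup>2) ^ k) \<le> (\<Sum>k\<in>{1..d}. 4 * (M\<^sup>2 - (cmod (c 0))\<^sup>2) * (r\<^sup>2) ^ k)"
      by (intro sum_mono mult_right_mono le(2)) (use r in auto)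
    also have "\<dots> = 4 * (M\<^sup>2 - (cmod (c 0))\<^sup>2) * (r\<^sup>2 * (\<Sum>k<d. (r\<^sup>2) ^ k))"
      by (simp add: sum_distrib_left sum_distrib_right sum.atLeast1_atMost_eq mult_ac)
    also have "\<dots> \<le> 4 * (M\<^sup>2 - (cmod (c 0))\<^sup>2) * (1/4)"
    proof (rule mult_left_mono)
      have "r\<^sup>2 * (\<Sum>k<d. (r\<^sup>2) ^ k) \<le> r\<^sup>2 * (1 / (1 - r\<^sup>2))"
        by (intro mult_left_mono geo) auto
      also have "\<dots> \<le> 1/4" using True r2 by (simp add: field_simps)
      finally show "r\<^sup>2 * (\<Sum>k<d. (r\<^sup>2) ^ k) \<le> 1/4" .
      show "0 \<le> 4 * (M\<^sup>2 - (cmod (c 0))\<^sup>2)"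
        using le(1)[of 0] power_mono[of "cmod (c 0)" M 2] by simp
    qed
    finally have "(\<Sum>k\<le>d. (cmod (c k))\<^sup>2 * (r\<^sup>2) ^ k) \<le>
        (cmod (c 0))\<^sup>2 + 4 * (M\<^sup>2 - (cmod (c 0))\<^sup>2) * (1/4)" by simp
    also have "(cmod (c 0))\<^sup>2 + 4 * (M\<^sup>2 - (cmod (c 0))\<^sup>2) * (1/4) = M\<^sup>2"
      by (simp add: diff_divide_distrib)
    finally have "(\<Sum>k\<le>d. (cmod (c k))\<^sup>2 * (r\<^sup>2) ^ k) \<le> M\<^sup>2" .
    then show ?thesis using True by (simp add: sq H1_H2_const_def)
  next
    case False
    have "(\<Sum>k\<le>d. (cmod (c k))\<^sup>2 * (r\<^sup>2) ^ k) \<le> (\<Sum>k\<le>d. M\<^sup>2 * (r\<^sup>2) ^ k)"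
      by (intro sum_mono mult_right_mono power_mono le(1)) (use r in auto)
    also have "\<dots> \<le> M\<^sup>2 * (1 / (1 - r\<^sup>2))"
      by (simp only: sum_distrib_left[symmetric]) (intro mult_left_mono geo, auto)
    finally show ?thesis using False r2 by (simp add: sq H1_H2_const_def power_divide)
  qed
  then show ?thesis
    unfolding M_def[symmetric]
    by (rule power2_le_imp_le) (use M0 H1_H2_const_ge_1[OF r] in auto)
qed

section \<open>Dirichlet polynomials on the torus\<close>

lemma torus_char_cong: "(\<And>q. q \<in> prime_factors n \<Longrightarrow> \<xi> q = \<xi>' q) \<Longrightarrow> torus_char \<xi> n = torus_char \<xi>' n"
  by (auto simp: torus_char_def intro!: prod.cong)

lemma torus_char_times: "torus_char (\<lambda>q. \<xi> q * \<xi>' q) n = torus_char \<xi> n * torus_char \<xi>' n"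
  by (simp add: torus_char_def power_mult_distrib prod.distrib)

lemma torus_char_1 [simp]: "torus_char \<xi> 1 = 1" "torus_char \<xi> (Suc 0) = 1"
  by (simp_all add: torus_char_def)

lemma torus_char_prime_power: "prime q \<Longrightarrow> torus_char \<xi> (q ^ k) = \<xi> q ^ k"
  by (induction k) (auto simp: torus_char_mult torus_char_prime prime_gt_0_nat)

lemma norm_torus_char_eq_1:
  "(\<And>q. prime q \<Longrightarrow> cmod (\<xi> q) = 1) \<Longrightarrow> cmod (torus_char \<xi> n) = 1"
  by (auto simp: torus_char_def prod_norm[symmetric] norm_power in_prime_factors_iff intro!: prod.neutral)

text \<open>Through this identity, evaluation of a Dirichlet polynomial at -s is evaluation of its
  torus polynomial at the point with coordinates q powr s. For negative Re s that point lies in the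
  open polydisc.\<close>

lemma torus_char_powr:
  assumes "n > 0"
  shows "torus_char (\<lambda>q. of_nat q powr s) n = of_nat n powr s"
  using assms
proof (induction n rule: prime_divisors_induct)
  case (factor p x)
  then have "p > 0" "x > 0" by (auto simp: prime_gt_0_nat)
  moreover have "of_nat (p * x) powr s = of_nat p powr s * of_nat x powr s"
    using powr_times_real[of "of_nat p" "of_nat x" s] by simp
  ultimately show ?case using factor by (simp add: torus_char_mult torus_char_prime)
qed auto

lemma torus_char_measurable:
  assumes "\<And>q. prime q \<Longrightarrow> (\<lambda>x. f x q) \<in> borel_measurable M"
  shows "(\<lambda>x. torus_char (f x) n) \<in> borel_measurable M"
  unfolding torus_char_def
  by (intro borel_measurable_prod borel_measurable_power assms) (simp add: in_prime_factors_iff)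

lemma torus_component_measurable:
  "prime q \<Longrightarrow> (\<lambda>\<xi>. \<xi> q) \<in> borel_measurable torus_measure"
  using measurable_component_singleton[of q "{q. prime q}" "\<lambda>_. circle_measure"]
  by (simp add: torus_measure_def cong: measurable_cong_sets)

lemma torus_char_holomorphic: "(\<lambda>z. torus_char (\<xi>(q := z)) n) holomorphic_on A"
proof -
  have "(\<lambda>z. (\<xi>(q := z)) r) holomorphic_on A" for r
    by (cases "r = q") (auto intro!: holomorphic_intros)
  then show ?thesis
    unfolding torus_char_def by (intro holomorphic_intros)
qed

lemma torus_update_measurable:
  assumes "prime q" "f \<in> N \<rightarrow>\<^sub>M torus_measure" "g \<in> borel_measurable N"
  shows "(\<lambda>x. (f x)(q := g x)) \<in> N \<rightarrow>\<^sub>M torus_measure"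
  unfolding torus_measure_def
  by (rule measurable_fun_upd[where J = "{q. prime q}"])
    (use assms in \<open>auto simp: torus_measure_def cong: measurable_cong_sets\<close>)

section \<open>Integrating out one coordinate of the torus\<close>

interpretation torus: prob_space torus_measure
  by (rule prob_space_torus_measure)

text \<open>Haar measure does not change when coordinate \<open>q\<close> is overwritten by an
  independent uniform value. This is Fubini without splitting the torus: every function stays on the
  full product, so inductions over the primes need no change of space.\<close>

lemma nn_integral_torus_resample:
  assumes q: "prime q" and [measurable]: "G \<in> borel_measurable torus_measure"
  shows "(\<integral>\<^sup>+\<xi>. G \<xi> \<partial>torus_measure) =
    (\<integral>\<^sup>+\<xi>. \<integral>\<^sup>+z. G (\<xi>(q := z)) \<partial>circle_measure \<partial>torus_measure)"
proof -
  interpret pair_prob_space circle_measure torus_measure ..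
  have ins: "insert q {q. prime q} = {q. prime q}" using q by auto
  have eq: "torus_measure = distr (circle_measure \<Otimes>\<^sub>M torus_measure) torus_measure (\<lambda>(x, X). X(q := x))"
    using distr_pair_PiM_eq_PiM[of "{q. prime q}" "\<lambda>_. circle_measure" q] prob_space_circle_measure
    unfolding ins torus_measure_def by simp
  have [measurable]: "(\<lambda>(x, X). X(q := x)) \<in> circle_measure \<Otimes>\<^sub>M torus_measure \<rightarrow>\<^sub>M torus_measure"
    unfolding case_prod_beta by (rule torus_update_measurable) (use q in auto)
  have "(\<integral>\<^sup>+\<xi>. G \<xi> \<partial>torus_measure) =
      (\<integral>\<^sup>+x. G ((\<lambda>(x, X). X(q := x)) x) \<partial>(circle_measure \<Otimes>\<^sub>M torus_measure))"
    by (subst eq, subst nn_integral_distr) auto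
  also have "\<dots> = (\<integral>\<^sup>+\<xi>. \<integral>\<^sup>+z. G (\<xi>(q := z)) \<partial>circle_measure \<partial>torus_measure)"
    by (subst nn_integral_snd[symmetric]) auto
  finally show ?thesis .
qed

lemma resampled_measurable:
  fixes H :: "_ \<Rightarrow> ennreal"
  assumes q: "prime q" and H: "H \<in> borel_measurable torus_measure"
  shows "(\<lambda>\<xi>. \<integral>\<^sup>+z. H (\<xi>(q := z)) \<partial>circle_measure) \<in> borel_measurable torus_measure"
proof -
  have "(\<lambda>x. (fst x)(q := snd x)) \<in> torus_measure \<Otimes>\<^sub>M circle_measure \<rightarrow>\<^sub>M torus_measure"
    by (rule torus_update_measurable) (use q in auto)
  then have "(\<lambda>(\<xi>, z). H (\<xi>(q := z))) \<in> borel_measurable (torus_measure \<Otimes>\<^sub>M circle_measure)"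
    unfolding case_prod_beta by (rule measurable_compose) (rule H)
  then show ?thesis by (rule circle.borel_measurable_nn_integral)
qed

lemma AE_torus: "AE \<xi> in torus_measure. \<forall>q. prime q \<longrightarrow> cmod (\<xi> q) = 1"
proof -
  have "AE \<xi> in torus_measure. prime q \<longrightarrow> cmod (\<xi> q) = 1" for q :: nat
    unfolding torus_measure_def
    by (cases "prime q")
      (auto intro!: AE_PiM_component prob_space_circle_measure AE_circle_measure)
  then show ?thesis by (simp add: AE_all_countable)
qed

section \<open>Moments of torus polynomials, point evaluation and dilation\<close>

definition torus_poly :: "dseries \<Rightarrow> (nat \<Rightarrow> complex) \<Rightarrow> complex" where
  "torus_poly a \<xi> = (\<Sum>n | a n \<noteq> 0. a n * torus_char \<xi> n)"

lemma torus_poly_eq_sum: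
  assumes "finite A" "{n. a n \<noteq> 0} \<subseteq> A"
  shows "torus_poly a \<xi> = (\<Sum>n\<in>A. a n * torus_char \<xi> n)"
  unfolding torus_poly_def by (rule sum.mono_neutral_left) (use assms in auto)

lemma torus_poly_measurable:
  assumes "\<And>q. prime q \<Longrightarrow> (\<lambda>x. f x q) \<in> borel_measurable M"
  shows "(\<lambda>x. torus_poly a (f x)) \<in> borel_measurable M"
  unfolding torus_poly_def
  by (intro borel_measurable_sum borel_measurable_times borel_measurable_const torus_char_measurable assms)

lemma torus_poly_measurable' [measurable]: "torus_poly a \<in> borel_measurable torus_measure"
  using torus_poly_measurable[of "\<lambda>\<xi>. \<xi>" torus_measure a] torus_component_measurable by simp

lemma torus_poly_holomorphic: "(\<lambda>z. torus_poly a (\<xi>(q := z))) holomorphic_on A"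
  unfolding torus_poly_def by (intro holomorphic_intros torus_char_holomorphic)

lemma AE_norm_torus_poly_le:
  assumes "finite A" "{n. a n \<noteq> 0} \<subseteq> A"
  shows "AE \<xi> in torus_measure. cmod (torus_poly a \<xi>) \<le> (\<Sum>n\<in>A. cmod (a n))"
  using AE_torus
proof eventually_elim
  fix \<xi> :: "nat \<Rightarrow> complex" assume *: "\<forall>q. prime q \<longrightarrow> cmod (\<xi> q) = 1"
  have "cmod (torus_poly a \<xi>) \<le> (\<Sum>n\<in>A. cmod (a n * torus_char \<xi> n))"
    unfolding torus_poly_eq_sum[OF assms] by (rule norm_sum)
  also have "\<dots> = (\<Sum>n\<in>A. cmod (a n))"
    using * by (simp add: norm_mult norm_torus_char_eq_1)
  finally show "cmod (torus_poly a \<xi>) \<le> (\<Sum>n\<in>A. cmod (a n))" .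
qed

text \<open>The p-th power of the Hardy norm as a nonnegative extended integral, which frees the
  Fubini and monotonicity arguments from integrability conditions.\<close>

definition torus_moment :: "real \<Rightarrow> dseries \<Rightarrow> ennreal" where
  "torus_moment p a = (\<integral>\<^sup>+\<xi>. ennreal (cmod (torus_poly a \<xi>) powr p) \<partial>torus_measure)"

text \<open>Induction over S. The polynomial is entire in coordinate \<open>q\<close>, so freezing
  that coordinate at \<open>w q\<close> costs one disc factor and an average over the circle;
  resampling absorbs the average into the torus integral.\<close>

lemma torus_point_evaluation_aux:
  assumes "finite S" "\<And>q. q \<in> S \<Longrightarrow> prime q" "\<And>q. q \<in> S \<Longrightarrow> cmod (w q) < 1" and p: "1 \<le> p"
  shows "(\<integral>\<^sup>+\<xi>. ennreal (cmod (torus_poly a (override_on \<xi> w S)) powr p) \<partial>torus_measure) \<le>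
    ennreal (\<Prod>q\<in>S. 1 / (1 - (cmod (w q))\<^sup>2)) * torus_moment p a"
  using assms(1-3)
proof (induction S rule: finite_induct)
  case empty
  then show ?case by (simp add: torus_moment_def)
next
  case (insert q S)
  define H where "H \<xi> = ennreal (cmod (torus_poly a (override_on \<xi> w S)) powr p)" for \<xi>
  have [measurable]: "(\<lambda>\<xi>. torus_poly a (override_on \<xi> w S)) \<in> borel_measurable torus_measure"
  proof (rule torus_poly_measurable)
    fix r :: nat assume "prime r"
    then show "(\<lambda>\<xi>. override_on \<xi> w S r) \<in> borel_measurable torus_measure"
      by (cases "r \<in> S") (simp_all add: override_on_def torus_component_measurable)
  qed
  have [measurable]: "H \<in> borel_measurable torus_measure" unfolding H_def by measurable
  have q: "prime q" "cmod (w q) < 1" using insert by auto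
  have upd: "override_on \<xi> w (insert q S) = (override_on \<xi> w S)(q := w q)" for \<xi>
    by (auto simp: override_on_def)
  have upd': "(override_on \<xi> w S)(q := z) = override_on (\<xi>(q := z)) w S" for \<xi> z
    using insert by (auto simp: override_on_def)
  have nn: "0 \<le> 1 / (1 - (cmod (w r))\<^sup>2)" if "r \<in> insert q S" for r
    using insert.prems(2)[OF that] by (simp add: power_le_one)
  have "(\<integral>\<^sup>+\<xi>. ennreal (cmod (torus_poly a (override_on \<xi> w (insert q S))) powr p) \<partial>torus_measure) \<le>
    (\<integral>\<^sup>+\<xi>. ennreal (1 / (1 - (cmod (w q))\<^sup>2)) *
       (\<integral>\<^sup>+z. ennreal (cmod (torus_poly a ((override_on \<xi> w S)(q := z))) powr p) \<partial>circle_measure) \<partial>torus_measure)"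
    unfolding upd
    by (intro nn_integral_mono disc_point_evaluation torus_poly_holomorphic q p)
  also have "\<dots> = (\<integral>\<^sup>+\<xi>. ennreal (1 / (1 - (cmod (w q))\<^sup>2)) *
       (\<integral>\<^sup>+z. H (\<xi>(q := z)) \<partial>circle_measure) \<partial>torus_measure)"
    unfolding upd' H_def ..
  also have "\<dots> = ennreal (1 / (1 - (cmod (w q))\<^sup>2)) *
       (\<integral>\<^sup>+\<xi>. \<integral>\<^sup>+z. H (\<xi>(q := z)) \<partial>circle_measure \<partial>torus_measure)"
    by (rule nn_integral_cmult) (rule resampled_measurable[OF q(1)], simp)
  also have "\<dots> = ennreal (1 / (1 - (cmod (w q))\<^sup>2)) * (\<integral>\<^sup>+\<xi>. H \<xi> \<partial>torus_measure)"
    by (subst nn_integral_torus_resample[of q H]) (use q in auto)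
  also have "\<dots> \<le> ennreal (1 / (1 - (cmod (w q))\<^sup>2)) *
      (ennreal (\<Prod>q\<in>S. 1 / (1 - (cmod (w q))\<^sup>2)) * torus_moment p a)"
    unfolding H_def by (intro mult_left_mono insert.IH) (use insert in auto)
  also have "\<dots> = ennreal (\<Prod>q\<in>insert q S. 1 / (1 - (cmod (w q))\<^sup>2)) * torus_moment p a"
    using insert(1,2) nn by (subst prod.insert) (auto simp: mult.assoc[symmetric] ennreal_mult'[symmetric])
  finally show ?case .
qed

text \<open>Once S contains all primes of the support, the polynomial with frozen coordinates is
  constant in \<open>\<xi>\<close>, and the integral of a constant over a probability space is that
  constant.\<close>

lemma torus_point_evaluation:
  assumes "finite {n. a n \<noteq> 0}" "finite S" "\<And>q. q \<in> S \<Longrightarrow> prime q" "\<And>q. q \<in> S \<Longrightarrow> cmod (w q) < 1"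
    and p: "1 \<le> p" and S: "\<And>n. a n \<noteq> 0 \<Longrightarrow> prime_factors n \<subseteq> S"
  shows "ennreal (cmod (torus_poly a w) powr p) \<le> ennreal (\<Prod>q\<in>S. 1 / (1 - (cmod (w q))\<^sup>2)) * torus_moment p a"
proof -
  have "torus_poly a (override_on \<xi> w S) = torus_poly a w" for \<xi>
    unfolding torus_poly_def
  proof (intro sum.cong arg_cong2[where f = "(*)"] refl torus_char_cong)
    fix n q assume "n \<in> {n. a n \<noteq> 0}" "q \<in># prime_factorization n"
    then have "q \<in> S" using S by auto
    then show "override_on \<xi> w S q = w q" by simp
  qed
  then show ?thesis
    using torus_point_evaluation_aux[of S w p a] assms(2-4) p
    by (simp add: torus.emeasure_space_1)
qed

text \<open>The same induction, with the dilation inequality on the circle in place of the disc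
  estimate. Each coordinate contributes the constant 1.\<close>

lemma torus_dilation_le_aux:
  assumes "finite S" "\<And>q. q \<in> S \<Longrightarrow> prime q" and r: "\<And>q. 0 \<le> r q" "\<And>q. r q \<le> 1" and p: "1 \<le> p"
  shows "(\<integral>\<^sup>+\<xi>. ennreal (cmod (torus_poly a (\<lambda>q. if q \<in> S then of_real (r q) * \<xi> q else \<xi> q)) powr p)
      \<partial>torus_measure) \<le> torus_moment p a"
  using assms(1,2)
proof (induction S rule: finite_induct)
  case empty
  then show ?case by (simp add: torus_moment_def)
next
  case (insert q S)
  define D where "D S \<xi> = (\<lambda>q. if q \<in> S then of_real (r q) * \<xi> q else \<xi> q)"
    for S and \<xi> :: "nat \<Rightarrow> complex"
  define H where "H S \<xi> = ennreal (cmod (torus_poly a (D S \<xi>)) powr p)" for S \<xi>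
  have "(\<lambda>\<xi>. torus_poly a (D S \<xi>)) \<in> borel_measurable torus_measure" for S
  proof (rule torus_poly_measurable)
    fix s :: nat assume "prime s"
    from torus_component_measurable[OF this]
    have "(\<lambda>\<xi>. of_real (r s) * \<xi> s) \<in> borel_measurable torus_measure" by measurable
    with \<open>prime s\<close> show "(\<lambda>\<xi>. D S \<xi> s) \<in> borel_measurable torus_measure"
      by (cases "s \<in> S") (simp_all add: D_def torus_component_measurable)
  qed
  then have [measurable]: "H S \<in> borel_measurable torus_measure" for S
    unfolding H_def by measurable
  have q: "prime q" using insert by auto
  have upd: "D (insert q S) (\<xi>(q := z)) = (D S \<xi>)(q := of_real (r q) * z)"
    and upd': "(D S \<xi>)(q := z) = D S (\<xi>(q := z))" for \<xi> z
    using insert by (auto simp: D_def)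
  have "(\<integral>\<^sup>+\<xi>. H (insert q S) \<xi> \<partial>torus_measure) =
      (\<integral>\<^sup>+\<xi>. \<integral>\<^sup>+z. H (insert q S) (\<xi>(q := z)) \<partial>circle_measure \<partial>torus_measure)"
    by (rule nn_integral_torus_resample) (use q in auto)
  also have "\<dots> \<le> (\<integral>\<^sup>+\<xi>. \<integral>\<^sup>+z. H S (\<xi>(q := z)) \<partial>circle_measure \<partial>torus_measure)"
    unfolding H_def upd upd'[symmetric]
    by (intro nn_integral_mono circle_norm_dilation_le torus_poly_holomorphic r p)
  also have "\<dots> = (\<integral>\<^sup>+\<xi>. H S \<xi> \<partial>torus_measure)"
    by (rule nn_integral_torus_resample[symmetric]) (use q in auto)
  also have "\<dots> \<le> torus_moment p a"
    unfolding H_def D_def by (rule insert.IH) (use insert in auto)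
  finally show ?case by (simp add: H_def D_def)
qed

text \<open>Multiplying coefficient n by the completely multiplicative function with values
  \<open>r q\<close> amounts to dilating coordinate \<open>q\<close> by \<open>r q\<close>. The
  value 0 is allowed and deletes all n divisible by \<open>q\<close>.\<close>

lemma torus_moment_multiplier_le:
  assumes fin: "finite {n. a n \<noteq> 0}" and r: "\<And>q. 0 \<le> r q" "\<And>q. r q \<le> 1" and p: "1 \<le> p"
  shows "torus_moment p (\<lambda>n. a n * torus_char (\<lambda>q. of_real (r q)) n) \<le> torus_moment p a"
proof -
  define S where "S = (\<Union>n\<in>{n. a n \<noteq> 0}. prime_factors n)"
  have eq: "torus_poly (\<lambda>n. a n * torus_char (\<lambda>q. of_real (r q)) n) \<xi> =
      torus_poly a (\<lambda>q. if q \<in> S then of_real (r q) * \<xi> q else \<xi> q)" for \<xi>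
  proof -
    have "torus_poly (\<lambda>n. a n * torus_char (\<lambda>q. of_real (r q)) n) \<xi> =
       (\<Sum>n | a n \<noteq> 0. a n * torus_char (\<lambda>q. of_real (r q) * \<xi> q) n)"
      by (subst torus_poly_eq_sum[OF fin]) (auto simp: torus_char_times mult.assoc)
    also have "\<dots> = torus_poly a (\<lambda>q. if q \<in> S then of_real (r q) * \<xi> q else \<xi> q)"
      unfolding torus_poly_def
      by (intro sum.cong arg_cong2[where f = "(*)"] refl torus_char_cong) (auto simp: S_def)
    finally show ?thesis .
  qed
  show ?thesis
    unfolding torus_moment_def[of p "\<lambda>n. a n * _ n"] eq
    by (rule torus_dilation_le_aux) (use fin r p in \<open>auto simp: S_def in_prime_factors_iff\<close>)
qed

section \<open>Weighted square summability of the coefficients\<close>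

text \<open>Minkowski's integral inequality by duality: pair the integrands with the vector
  \<open>b\<close> of their integrals, apply Cauchy-Schwarz pointwise, and cancel one factor
  \<open>B\<close>.\<close>

lemma L2_set_integral_le:
  fixes f :: "'i \<Rightarrow> 'a \<Rightarrow> real"
  assumes f: "\<And>i. i \<in> I \<Longrightarrow> integrable M (f i)" and L: "integrable M (\<lambda>x. L2_set (\<lambda>i. f i x) I)"
  shows "L2_set (\<lambda>i. integral\<^sup>L M (f i)) I \<le> (\<integral>x. L2_set (\<lambda>i. f i x) I \<partial>M)"
proof -
  define b where "b i = integral\<^sup>L M (f i)" for i
  define B where "B = L2_set b I"
  have "B * B = (\<Sum>i\<in>I. b i * b i)"
    unfolding B_def L2_set_def by (subst real_sqrt_mult_self) (simp add: sum_nonneg power2_eq_square)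
  also have "\<dots> = (\<integral>x. (\<Sum>i\<in>I. b i * f i x) \<partial>M)"
    using f by (subst Bochner_Integration.integral_sum) (auto simp: b_def)
  also have "\<dots> \<le> (\<integral>x. B * L2_set (\<lambda>i. f i x) I \<partial>M)"
  proof (rule integral_mono)
    fix x
    have "(\<Sum>i\<in>I. b i * f i x) \<le> (\<Sum>i\<in>I. \<bar>b i\<bar> * \<bar>f i x\<bar>)"
      by (intro sum_mono) (metis abs_ge_self abs_mult)
    also have "\<dots> \<le> B * L2_set (\<lambda>i. f i x) I"
      unfolding B_def by (rule L2_set_mult_ineq)
    finally show "(\<Sum>i\<in>I. b i * f i x) \<le> B * L2_set (\<lambda>i. f i x) I" .
  qed (use f L in auto)
  finally have "B * B \<le> B * (\<integral>x. L2_set (\<lambda>i. f i x) I \<partial>M)" by simp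
  moreover have "0 \<le> B" "0 \<le> (\<integral>x. L2_set (\<lambda>i. f i x) I \<partial>M)"
    by (auto simp: B_def)
  ultimately have "B \<le> (\<integral>x. L2_set (\<lambda>i. f i x) I \<partial>M)"
    by (cases "B = 0") auto
  then show ?thesis unfolding B_def b_def[abs_def] .
qed

lemma L2_set_cartesian_product:
  assumes "finite I" "finite J"
  shows "L2_set (\<lambda>(i, j). f i j) (I \<times> J) = L2_set (\<lambda>i. L2_set (f i) J) I"
  by (simp add: L2_set_def sum_nonneg sum.cartesian_product case_prod_unfold)

text \<open>The scalar bound in each component, followed by Minkowski's inequality. The constant
  does not depend on the number of components, and this allows the induction over primes.\<close>

lemma vector_H1_H2_dilation_le:
  fixes c :: "'i \<Rightarrow> nat \<Rightarrow> complex"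
  assumes r: "0 \<le> r" "r < 1" and I: "finite I"
  shows "ennreal (L2_set (\<lambda>(i, k). cmod (c i k) * r ^ k) (I \<times> {..d})) \<le>
    ennreal (H1_H2_const r) *
      (\<integral>\<^sup>+z. ennreal (L2_set (\<lambda>i. cmod (\<Sum>k\<le>d. c i k * z ^ k)) I) \<partial>circle_measure)"
proof -
  define Q where "Q i z = (\<Sum>k\<le>d. c i k * z ^ k)" for i z
  have K: "0 \<le> H1_H2_const r" using H1_H2_const_ge_1[OF r] by simp
  have int: "integrable circle_measure (\<lambda>z. cmod (Q i z))" for i
    unfolding Q_def by (intro circle_integrable_continuous continuous_intros)
  have intL: "integrable circle_measure (\<lambda>z. L2_set (\<lambda>i. cmod (Q i z)) I)"
    unfolding Q_def L2_set_def by (intro circle_integrable_continuous continuous_intros)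
  have "L2_set (\<lambda>(i, k). cmod (c i k) * r ^ k) (I \<times> {..d}) =
      L2_set (\<lambda>i. L2_set (\<lambda>k. cmod (c i k) * r ^ k) {..d}) I"
    using I by (rule L2_set_cartesian_product) simp
  also have "\<dots> \<le> L2_set (\<lambda>i. H1_H2_const r * (LINT z|circle_measure. cmod (Q i z))) I"
    unfolding Q_def by (intro L2_set_mono H1_H2_dilation_le r) auto
  also have "\<dots> = H1_H2_const r * L2_set (\<lambda>i. LINT z|circle_measure. cmod (Q i z)) I"
    by (rule L2_set_right_distrib[OF K, symmetric])
  also have "\<dots> \<le> H1_H2_const r * (LINT z|circle_measure. L2_set (\<lambda>i. cmod (Q i z)) I)"
    by (intro mult_left_mono L2_set_integral_le int intL K)
  finally have "ennreal (L2_set (\<lambda>(i, k). cmod (c i k) * r ^ k) (I \<times> {..d})) \<le> ennreal \<dots>"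
    by (rule ennreal_leI)
  also have "\<dots> = ennreal (H1_H2_const r) * (\<integral>\<^sup>+z. ennreal (L2_set (\<lambda>i. cmod (Q i z)) I) \<partial>circle_measure)"
    using K intL by (subst nn_integral_eq_integral) (auto simp: ennreal_mult')
  finally show ?thesis by (simp add: Q_def)
qed

text \<open>Every n in A is q^k * m for exactly one k and one m not divisible by \<open>q\<close>;
  \<open>B\<close> collects these m. The rectangle of pairs may contain products outside A, hence
  the zero branch.\<close>

lemma sum_by_prime_part:
  fixes g :: "nat \<Rightarrow> 'a::comm_monoid_add"
  assumes A: "finite A" "\<And>n. n \<in> A \<Longrightarrow> n > 0" and q: "prime q"
    and d: "\<And>n. n \<in> A \<Longrightarrow> multiplicity q n \<le> d"
  defines "B \<equiv> (\<lambda>n. n div q ^ multiplicity q n) ` A"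
  shows "(\<Sum>n\<in>A. g n) = (\<Sum>k\<le>d. \<Sum>m\<in>B. if q ^ k * m \<in> A then g (q ^ k * m) else 0)"
proof -
  have q0: "q \<noteq> 0" "\<not> is_unit q" using q by auto
  have B: "m > 0" "\<not> q dvd m" if "m \<in> B" for m
  proof -
    obtain n where n: "n \<in> A" "m = n div q ^ multiplicity q n" using \<open>m \<in> B\<close> by (auto simp: B_def)
    then have "n \<noteq> 0" using A(2)[of n] by simp
    then show "\<not> q dvd m" using multiplicity_decompose[of n q] q0 n by auto
    then show "m > 0" by (metis dvd_0_right gr0I)
  qed
  have mult: "multiplicity q (q ^ k * m) = k" if "m \<in> B" for k m
    using B[OF that] q by (simp add: prime_elem_multiplicity_mult_distrib not_dvd_imp_multiplicity_0 q0)
  define X where "X = {x \<in> {..d} \<times> B. q ^ fst x * snd x \<in> A}"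
  have "inj_on (\<lambda>x. q ^ fst x * snd x) X"
  proof (rule inj_onI)
    fix x y assume xy: "x \<in> X" "y \<in> X" "q ^ fst x * snd x = q ^ fst y * snd y"
    then have "fst x = fst y"
      using mult[of "snd x" "fst x"] mult[of "snd y" "fst y"] by (auto simp: X_def)
    then show "x = y" using xy(3) q0 by (simp add: prod_eq_iff)
  qed
  moreover have "A = (\<lambda>x. q ^ fst x * snd x) ` X"
  proof (intro equalityI subsetI)
    fix n assume n: "n \<in> A"
    have "(multiplicity q n, n div q ^ multiplicity q n) \<in> X"
      using n d by (auto simp: X_def B_def multiplicity_dvd)
    moreover have "n = q ^ multiplicity q n * (n div q ^ multiplicity q n)"
      by (simp add: multiplicity_dvd)
    ultimately show "n \<in> (\<lambda>x. q ^ fst x * snd x) ` X" by force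
  qed (auto simp: X_def)
  ultimately have "(\<Sum>n\<in>A. g n) = (\<Sum>x\<in>X. g (q ^ fst x * snd x))"
    by (metis (no_types, lifting) sum.reindex_cong)
  also have "\<dots> = (\<Sum>x\<in>{..d} \<times> B. if q ^ fst x * snd x \<in> A then g (q ^ fst x * snd x) else 0)"
    unfolding X_def by (rule sum.inter_filter) (use A in \<open>auto simp: B_def\<close>)
  finally have "(\<Sum>n\<in>A. g n) = (\<Sum>(k, m)\<in>{..d} \<times> B. if q ^ k * m \<in> A then g (q ^ k * m) else 0)"
    by (simp add: case_prod_unfold)
  then show ?thesis by (simp add: sum.cartesian_product)
qed

text \<open>The coefficients have to be vectors for the induction to work: the expansion in powers of a
  prime \<open>q\<close> turns each polynomial into a vector of polynomials in the other primes.\<close>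

lemma torus_vector_H1_H2_le:
  fixes a :: "nat \<Rightarrow> dseries"
  assumes "finite S" "\<And>q. q \<in> S \<Longrightarrow> prime q"
    and r: "\<And>q. q \<in> S \<Longrightarrow> 0 \<le> r q" "\<And>q. q \<in> S \<Longrightarrow> r q < 1"
    and "finite I" "finite A" "\<And>n. n \<in> A \<Longrightarrow> n > 0" "\<And>n. n \<in> A \<Longrightarrow> prime_factors n \<subseteq> S"
  shows "ennreal (L2_set (\<lambda>(i, n). cmod (a i n * torus_char (\<lambda>q. of_real (r q)) n)) (I \<times> A)) \<le>
    ennreal (\<Prod>q\<in>S. H1_H2_const (r q)) *
      (\<integral>\<^sup>+\<xi>. ennreal (L2_set (\<lambda>i. cmod (\<Sum>n\<in>A. a i n * torus_char \<xi> n)) I) \<partial>torus_measure)"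
  using assms
proof (induction S arbitrary: I A a rule: finite_induct)
  case empty
  have "n = 1" if "n \<in> A" for n
    using empty.prems(6)[OF that] empty.prems(7)[OF that] by (auto simp: prime_factorization_empty_iff)
  then consider "A = {}" | "A = {1}" using subset_singletonD[of A 1] by blast
  then show ?case
  proof cases
    case 1 then show ?thesis by (simp add: L2_set_def)
  next
    case 2
    have "L2_set (\<lambda>(i, n). cmod (a i n * torus_char (\<lambda>q. of_real (r q)) n)) (I \<times> {1}) =
        L2_set (\<lambda>i. cmod (a i 1)) I"
      using empty.prems(4) by (subst L2_set_cartesian_product) auto
    then show ?thesis using 2 by (simp add: torus.emeasure_space_1)
  qed
next
  case (insert q S)
  define W where "W = torus_char (\<lambda>q. complex_of_real (r q))"
  define d where "d = Max (insert 0 (multiplicity q ` A))"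
  define B where "B = (\<lambda>n. n div q ^ multiplicity q n) ` A"
  have q: "prime q" and rq: "0 \<le> r q" "r q < 1" using insert by auto
  have q0: "q > 0" using q by (rule prime_gt_0_nat)
  have d: "multiplicity q n \<le> d" if "n \<in> A" for n
    unfolding d_def using insert that by (intro Max_ge) auto
  have Bfin: "finite B" using insert by (simp add: B_def)
  have B: "m > 0" "\<not> q dvd m" "prime_factors m \<subseteq> S" if "m \<in> B" for m
  proof -
    obtain n where n: "n \<in> A" "m = n div q ^ multiplicity q n" using \<open>m \<in> B\<close> by (auto simp: B_def)
    then have n0: "n \<noteq> 0" using insert.prems(6)[of n] by simp
    moreover have "\<not> is_unit q" using q not_prime_unit by blast
    ultimately show ndvd: "\<not> q dvd m" using multiplicity_decompose[of n q] n by auto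
    then show "m > 0" by (metis dvd_0_right gr0I)
    have "m dvd n" unfolding n(2) by (metis dvd_div_mult_self dvd_triv_left multiplicity_dvd mult.commute)
    then have "prime_factors m \<subseteq> insert q S"
      using insert.prems(7)[OF n(1)] n0 dvd_prime_factors by blast
    then show "prime_factors m \<subseteq> S" using ndvd by (auto simp: in_prime_factors_iff)
  qed
  define c where "c i k m = (if q ^ k * m \<in> A then a i (q ^ k * m) else 0)" for i k m
  \<comment> \<open>The families in the induction are indexed by \<open>nat\<close>, so the pair (i,
    k) of old index and exponent is encoded as a number.\<close>
  define J where "J = prod_encode ` (I \<times> {..d})"
  \<comment> \<open>The weight of the power of \<open>q\<close> is put into the new coefficients.
    What remains is the weight of m, which has only primes in S.\<close>
  define b where "b j m = (case prod_decode j of (i, k) \<Rightarrow> of_real (r q ^ k) * c i k m)" for j m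
  define P where "P \<xi> i k = (\<Sum>m\<in>B. c i k m * torus_char \<xi> m)" for \<xi> i k
  define G where "G \<xi> = ennreal (L2_set (\<lambda>i. cmod (\<Sum>n\<in>A. a i n * torus_char \<xi> n)) I)" for \<xi>
  have inj: "inj_on prod_encode X" for X by (rule inj_prod_encode)
  have W: "W (q ^ k * m) = of_real (r q ^ k) * W m" if "m > 0" for k m
    using that q q0 by (simp add: W_def torus_char_mult torus_char_prime_power)
  have upd: "torus_char (\<xi>(q := z)) (q ^ k * m) = z ^ k * torus_char \<xi> m" if "m \<in> B" for \<xi> z k m
  proof -
    have "torus_char (\<xi>(q := z)) m = torus_char \<xi> m"
      using B(2)[OF that] by (intro torus_char_cong) auto
    then show ?thesis using B(1)[OF that] q q0 by (simp add: torus_char_mult torus_char_prime_power)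
  qed
  have lhs: "L2_set (\<lambda>(i, n). cmod (a i n * W n)) (I \<times> A) = L2_set (\<lambda>(j, m). cmod (b j m * W m)) (J \<times> B)"
  proof -
    have "(\<Sum>n\<in>A. (cmod (a i n * W n))\<^sup>2) = (\<Sum>k\<le>d. \<Sum>m\<in>B. (cmod (b (prod_encode (i, k)) m * W m))\<^sup>2)" for i
      unfolding sum_by_prime_part[OF \<open>finite A\<close> insert.prems(6) q d, folded B_def, of "\<lambda>n. (cmod (a i n * W n))\<^sup>2", simplified]
      by (intro sum.cong refl) (use B in \<open>auto simp: b_def c_def W norm_mult norm_power mult.assoc mult.left_commute\<close>)
    moreover have "(\<Sum>j\<in>J. F j) = (\<Sum>i\<in>I. \<Sum>k\<le>d. F (prod_encode (i, k)))" for F :: "nat \<Rightarrow> real"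
      unfolding J_def sum.reindex[OF inj] sum.cartesian_product by (simp add: case_prod_unfold)
    ultimately have "(\<Sum>i\<in>I. \<Sum>n\<in>A. (cmod (a i n * W n))\<^sup>2) = (\<Sum>j\<in>J. \<Sum>m\<in>B. (cmod (b j m * W m))\<^sup>2)"
      by presburger
    then show ?thesis by (simp add: L2_set_def case_prod_unfold sum.cartesian_product)
  qed
  have rhs: "L2_set (\<lambda>j. cmod (\<Sum>m\<in>B. b j m * torus_char \<xi> m)) J =
      L2_set (\<lambda>(i, k). cmod (P \<xi> i k) * r q ^ k) (I \<times> {..d})" for \<xi>
  proof -
    have "cmod (\<Sum>m\<in>B. b (prod_encode (i, k)) m * torus_char \<xi> m) = cmod (P \<xi> i k) * r q ^ k" for i k
    proof -
      have "(\<Sum>m\<in>B. b (prod_encode (i, k)) m * torus_char \<xi> m) = of_real (r q ^ k) * P \<xi> i k"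
        by (simp add: b_def P_def sum_distrib_left mult.assoc)
      then show ?thesis using rq by (simp add: norm_mult norm_power)
    qed
    then have "cmod (\<Sum>m\<in>B. b (prod_encode x) m * torus_char \<xi> m) =
        cmod (P \<xi> (fst x) (snd x)) * r q ^ snd x" for x
      by (metis prod.collapse)
    then show ?thesis
      unfolding L2_set_def J_def by (simp add: sum.reindex[OF inj] case_prod_unfold)
  qed
  have P: "(\<Sum>k\<le>d. P \<xi> i k * z ^ k) = (\<Sum>n\<in>A. a i n * torus_char (\<xi>(q := z)) n)" for \<xi> i z
  proof -
    have "(\<Sum>n\<in>A. a i n * torus_char (\<xi>(q := z)) n) =
        (\<Sum>k\<le>d. \<Sum>m\<in>B. c i k m * torus_char \<xi> m * z ^ k)"
      unfolding sum_by_prime_part[OF \<open>finite A\<close> insert.prems(6) q d, folded B_def, of "\<lambda>n. a i n * torus_char (\<xi>(q := z)) n", simplified]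
      by (intro sum.cong refl) (auto simp: c_def upd)
    then show ?thesis by (simp add: P_def sum_distrib_right)
  qed
  have "(\<lambda>\<xi>. torus_char \<xi> n) \<in> borel_measurable torus_measure" for n
    by (rule torus_char_measurable) (rule torus_component_measurable)
  then have [measurable]: "G \<in> borel_measurable torus_measure"
    unfolding G_def L2_set_def by measurable
  have K: "1 \<le> H1_H2_const (r s)" if "s \<in> insert q S" for s
    using H1_H2_const_ge_1 insert.prems(2,3)[OF that] by simp
  have "ennreal (L2_set (\<lambda>(i, n). cmod (a i n * W n)) (I \<times> A)) \<le>
      ennreal (\<Prod>q\<in>S. H1_H2_const (r q)) *
      (\<integral>\<^sup>+\<xi>. ennreal (L2_set (\<lambda>j. cmod (\<Sum>m\<in>B. b j m * torus_char \<xi> m)) J) \<partial>torus_measure)"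
    unfolding lhs unfolding W_def
    by (rule insert.IH) (use insert B Bfin in \<open>auto simp: J_def\<close>)
  also have "\<dots> \<le> ennreal (\<Prod>q\<in>S. H1_H2_const (r q)) *
      (\<integral>\<^sup>+\<xi>. ennreal (H1_H2_const (r q)) * (\<integral>\<^sup>+z. G (\<xi>(q := z)) \<partial>circle_measure) \<partial>torus_measure)"
    unfolding rhs G_def P[symmetric]
    by (intro mult_left_mono nn_integral_mono vector_H1_H2_dilation_le rq insert) auto
  also have "(\<integral>\<^sup>+\<xi>. ennreal (H1_H2_const (r q)) * (\<integral>\<^sup>+z. G (\<xi>(q := z)) \<partial>circle_measure) \<partial>torus_measure) =
      ennreal (H1_H2_const (r q)) * (\<integral>\<^sup>+\<xi>. (\<integral>\<^sup>+z. G (\<xi>(q := z)) \<partial>circle_measure) \<partial>torus_measure)"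
    by (rule nn_integral_cmult) (rule resampled_measurable[OF q], simp)
  also have "(\<integral>\<^sup>+\<xi>. (\<integral>\<^sup>+z. G (\<xi>(q := z)) \<partial>circle_measure) \<partial>torus_measure) = (\<integral>\<^sup>+\<xi>. G \<xi> \<partial>torus_measure)"
    by (rule nn_integral_torus_resample[symmetric, OF q]) simp
  also have "ennreal (\<Prod>q\<in>S. H1_H2_const (r q)) * (ennreal (H1_H2_const (r q)) * (\<integral>\<^sup>+\<xi>. G \<xi> \<partial>torus_measure)) =
      ennreal (\<Prod>q\<in>insert q S. H1_H2_const (r q)) * (\<integral>\<^sup>+\<xi>. G \<xi> \<partial>torus_measure)"
  proof -
    have "0 \<le> H1_H2_const (r q)" using K[of q] by simp
    then have "ennreal (\<Prod>q\<in>insert q S. H1_H2_const (r q)) =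
        ennreal (H1_H2_const (r q)) * ennreal (\<Prod>q\<in>S. H1_H2_const (r q))"
      using insert(1,2) by (simp add: ennreal_mult')
    then show ?thesis by (simp add: mult.assoc mult.left_commute)
  qed
  finally show ?case by (simp add: G_def W_def)
qed

text \<open>Since q powr (- h) tends to 0, the primes whose one-variable constant exceeds 1 form a
  finite set determined by \<open>h\<close>. The product over the primes of the support is therefore
  bounded by a number that does not see the polynomial. The scalar statement is the vector
  inequality with a single index.\<close>

lemma torus_H1_H2_powr_le:
  assumes a: "a \<in> dirichlet_polys" and h: "h > 0"
  defines "S\<^sub>0 \<equiv> {q::nat. prime q \<and> (real q powr (- h))\<^sup>2 > 1/5}"
  shows "ennreal (L2_set (\<lambda>n. cmod (a n) * real n powr (- h)) {n. a n \<noteq> 0}) \<le>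
    ennreal (\<Prod>q\<in>S\<^sub>0. H1_H2_const (real q powr (- h))) *
      (\<integral>\<^sup>+\<xi>. ennreal (cmod (torus_poly a \<xi>)) \<partial>torus_measure)"
proof -
  define A where "A = {n. a n \<noteq> 0}"
  have A: "finite A" "\<And>n. n \<in> A \<Longrightarrow> n > 0"
    using a by (auto simp: A_def dirichlet_polys_def intro: gr0I)
  define r where "r = (\<lambda>q::nat. real q powr (- h))"
  define S where "S = (\<Union>n\<in>A. prime_factors n)"
  have S: "finite S" "\<And>q. q \<in> S \<Longrightarrow> prime q" using A by (auto simp: S_def in_prime_factors_iff)
  have r1: "r q < 1" if "prime q" for q
  proof -
    have "real q powr (-h) < real q powr 0"
      using prime_gt_1_nat[OF that] h by (intro powr_less_mono) auto
    then show ?thesis using prime_gt_0_nat[OF that] by (simp add: r_def)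
  qed
  have r0: "0 \<le> r q" for q by (simp add: r_def)
  have r1': "r q < 1" if "q \<in> S" for q using r1 S that by auto
  have S0: "finite S\<^sub>0"
  proof -
    have "real q \<le> 5 powr (1 / (2 * h))" if "q \<in> S\<^sub>0" for q
    proof -
      have q: "real q > 0" using that by (simp add: S\<^sub>0_def prime_gt_0_nat)
      have "(real q powr (- h))\<^sup>2 = 1 / real q powr (2 * h)"
        using q by (simp add: powr_minus power2_eq_square field_simps flip: powr_add)
      moreover have "1/5 < (real q powr (- h))\<^sup>2" using that by (simp add: S\<^sub>0_def)
      ultimately have "1/5 < 1 / real q powr (2 * h)" by simp
      then have "real q powr (2 * h) \<le> 5"
        using q by (simp add: divide_less_eq)
      then have "(real q powr (2 * h)) powr (1 / (2 * h)) \<le> 5 powr (1 / (2 * h))"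
        using h by (intro powr_mono2) auto
      then show ?thesis using h q by (simp add: powr_powr)
    qed
    then have "S\<^sub>0 \<subseteq> {..nat \<lceil>5 powr (1 / (2 * h))\<rceil>}" by (fastforce simp: le_nat_iff le_ceiling_iff)
    then show ?thesis by (rule finite_subset) simp
  qed
  have pow: "cmod (torus_char (\<lambda>q. of_real (r q)) n) = real n powr (- h)" if "n > 0" for n
  proof -
    have "(\<lambda>q. complex_of_real (r q)) = (\<lambda>q. of_nat q powr of_real (- h))"
      unfolding r_def by (simp flip: powr_of_real)
    then show ?thesis using that torus_char_powr[of n "of_real (-h)"] by (simp add: norm_powr_real_powr)
  qed
  have AS: "prime_factors n \<subseteq> S" if "n \<in> A" for n using that by (auto simp: S_def)
  have "ennreal (L2_set (\<lambda>(i, n). cmod (a n * torus_char (\<lambda>q. of_real (r q)) n)) ({0::nat} \<times> A)) \<le>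
    ennreal (\<Prod>q\<in>S. H1_H2_const (r q)) *
      (\<integral>\<^sup>+\<xi>. ennreal (L2_set (\<lambda>i. cmod (\<Sum>n\<in>A. a n * torus_char \<xi> n)) {0::nat}) \<partial>torus_measure)"
    using torus_vector_H1_H2_le[of S r "{0}" A "\<lambda>_. a"] S r0 r1' A AS by simp
  also have "L2_set (\<lambda>(i, n). cmod (a n * torus_char (\<lambda>q. of_real (r q)) n)) ({0::nat} \<times> A) =
      L2_set (\<lambda>n. cmod (a n) * real n powr (- h)) A"
    using A by (subst L2_set_cartesian_product) (auto simp: norm_mult pow intro!: L2_set_cong)
  also have "(\<Prod>q\<in>S. H1_H2_const (r q)) \<le> (\<Prod>q\<in>S\<^sub>0. H1_H2_const (r q))"
  proof -
    have "(\<Prod>q\<in>S. H1_H2_const (r q)) = (\<Prod>q\<in>S \<inter> S\<^sub>0. H1_H2_const (r q))"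
      by (rule prod.mono_neutral_right) (use S in \<open>auto simp: S\<^sub>0_def r_def H1_H2_const_def\<close>)
    also have "\<dots> \<le> (\<Prod>q\<in>S\<^sub>0. H1_H2_const (r q))"
      by (rule prod_mono2)
        (use S0 r0 r1 in \<open>auto simp: S\<^sub>0_def intro: H1_H2_const_ge_1 order_trans[OF zero_le_one H1_H2_const_ge_1]\<close>)
    finally show ?thesis .
  qed
  finally show ?thesis
    unfolding A_def torus_poly_def r_def by (simp add: ennreal_leI mult_right_mono)
qed

text \<open>On a probability space the first moment is controlled by the p-th one. Jensen's
  inequality is applied to the modulus, regarded as a complex function.\<close>

lemma torus_H2_weighted_le_moment:
  assumes h: "h > 0" and p: "1 \<le> p"
  obtains C where "C > 0" "\<And>a. a \<in> dirichlet_polys \<Longrightarrow>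
    ennreal (L2_set (\<lambda>n. cmod (a n) * real n powr (- h)) {n. a n \<noteq> 0} powr p) \<le> ennreal C * torus_moment p a"
proof
  define C where "C = (\<Prod>q\<in>{q::nat. prime q \<and> (real q powr (- h))\<^sup>2 > 1/5}. H1_H2_const (real q powr (- h)))"
  have "C > 0"
  proof (unfold C_def, rule prod_pos)
    fix q :: nat assume "q \<in> {q. prime q \<and> (real q powr (- h))\<^sup>2 > 1/5}"
    then have q: "prime q" by simp
    have "real q powr (-h) < real q powr 0"
      using prime_gt_1_nat[OF q] h by (intro powr_less_mono) auto
    then have "1 \<le> H1_H2_const (real q powr (- h))"
      using prime_gt_0_nat[OF q] by (intro H1_H2_const_ge_1) auto
    then show "0 < H1_H2_const (real q powr (- h))" by simp
  qed
  then show "C powr p > 0" by simp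
  fix a assume a: "a \<in> dirichlet_polys"
  have fin: "finite {n. a n \<noteq> 0}" using a by (simp add: dirichlet_polys_def)
  define X where "X \<xi> = complex_of_real (cmod (torus_poly a \<xi>))" for \<xi>
  have X: "integrable torus_measure X"
    unfolding X_def using AE_norm_torus_poly_le[OF fin order_refl]
    by (intro torus.integrable_const_bound[where B = "\<Sum>n | a n \<noteq> 0. cmod (a n)"]) auto
  define Y where "Y = (\<integral>\<xi>. cmod (torus_poly a \<xi>) \<partial>torus_measure)"
  have Y0: "0 \<le> Y" by (simp add: Y_def)
  have XY: "integral\<^sup>L torus_measure X = of_real Y"
    unfolding X_def Y_def by (rule integral_complex_of_real)
  have "integrable torus_measure (\<lambda>\<xi>. cmod (torus_poly a \<xi>))"
    using X integrable_norm[OF X] by (simp add: X_def)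
  then have "(\<integral>\<^sup>+\<xi>. ennreal (cmod (torus_poly a \<xi>)) \<partial>torus_measure) = ennreal Y"
    unfolding Y_def by (rule nn_integral_eq_integral) simp
  then have "ennreal (L2_set (\<lambda>n. cmod (a n) * real n powr (- h)) {n. a n \<noteq> 0}) \<le> ennreal (C * Y)"
    using torus_H1_H2_powr_le[OF a h, folded C_def] \<open>C > 0\<close> by (simp add: ennreal_mult')
  then have "L2_set (\<lambda>n. cmod (a n) * real n powr (- h)) {n. a n \<noteq> 0} \<le> C * Y"
    using \<open>C > 0\<close> Y0 by (simp add: ennreal_le_iff)
  then have "ennreal (L2_set (\<lambda>n. cmod (a n) * real n powr (- h)) {n. a n \<noteq> 0} powr p) \<le> ennreal ((C * Y) powr p)"
    using p by (intro ennreal_leI powr_mono2) auto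
  also have "\<dots> = ennreal (C powr p) * ennreal (Y powr p)"
    using \<open>C > 0\<close> Y0 by (simp add: powr_mult ennreal_mult')
  also have "\<dots> \<le> ennreal (C powr p) * torus_moment p a"
    using torus.nn_jensen_powr[OF X p] Y0 unfolding XY torus_moment_def
    by (intro mult_left_mono) (auto simp: X_def)
  finally show "ennreal (L2_set (\<lambda>n. cmod (a n) * real n powr (- h)) {n. a n \<noteq> 0} powr p) \<le>
    ennreal (C powr p) * torus_moment p a" .
qed

section \<open>Sums over smooth numbers\<close>

text \<open>The condition \<open>n > 0\<close> excludes 0, whose set of prime factors is
  empty.\<close>

definition smooth_numbers :: "nat set \<Rightarrow> nat set" where
  "smooth_numbers S = {n. n > 0 \<and> prime_factors n \<subseteq> S}"

lemma multiplicity_prime_power_times: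
  fixes q :: nat
  assumes "prime q" "prime r" "m > 0"
  shows "multiplicity r (q ^ k * m) = (if r = q then k else 0) + multiplicity r m"
  using assms
  by (auto simp: prime_elem_multiplicity_mult_distrib multiplicity_same_power' prime_multiplicity_other
      prime_gt_0_nat prime_elem_multiplicity_power_distrib)

lemma bij_betw_smooth_numbers_insert:
  assumes q: "prime q" "q \<notin> S" and S: "\<And>r. r \<in> S \<Longrightarrow> prime r"
  shows "bij_betw (\<lambda>(k, m). q ^ k * m) (UNIV \<times> smooth_numbers S) (smooth_numbers (insert q S))"
proof -
  have q0: "q > 0" "\<not> is_unit q" using q prime_gt_0_nat not_prime_unit by auto
  have ndvd: "multiplicity q m = 0" if "m \<in> smooth_numbers S" for m
    using that q by (auto simp: smooth_numbers_def in_prime_factors_iff intro!: not_dvd_imp_multiplicity_0)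
  have mult: "multiplicity q (q ^ k * m) = k" if "m \<in> smooth_numbers S" for k m
    using that ndvd[OF that] q by (simp add: multiplicity_prime_power_times smooth_numbers_def)
  have "inj_on (\<lambda>(k, m). q ^ k * m) (UNIV \<times> smooth_numbers S)"
  proof (rule inj_onI, clarify)
    fix k m k' m' assume *: "m \<in> smooth_numbers S" "m' \<in> smooth_numbers S" "q ^ k * m = q ^ k' * m'"
    then have "k = k'" by (metis mult)
    then show "k = k' \<and> m = m'" using * q0 by simp
  qed
  moreover have "(\<lambda>(k, m). q ^ k * m) ` (UNIV \<times> smooth_numbers S) = smooth_numbers (insert q S)"
  proof (intro equalityI subsetI)
    fix n assume "n \<in> (\<lambda>(k, m). q ^ k * m) ` (UNIV \<times> smooth_numbers S)"
    then obtain k m where n: "n = q ^ k * m" and m: "m \<in> smooth_numbers S" by auto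
    have "r \<in> insert q S" if "prime r" "r dvd n" for r
    proof (cases "r dvd m")
      case True then show ?thesis using m that by (auto simp: smooth_numbers_def in_prime_factors_iff)
    next
      case False
      then have "r dvd q ^ k" using that n prime_dvd_mult_iff by blast
      then show ?thesis using that q prime_dvd_power primes_dvd_imp_eq by blast
    qed
    then show "n \<in> smooth_numbers (insert q S)"
      using m q0 by (auto simp: smooth_numbers_def in_prime_factors_iff n)
  next
    fix n assume n: "n \<in> smooth_numbers (insert q S)"
    then have n0: "n \<noteq> 0" by (simp add: smooth_numbers_def)
    obtain m where m: "n = q ^ multiplicity q n * m" "\<not> q dvd m"
      using multiplicity_decompose'[of n q] n0 q0 by metis
    have "m \<noteq> 0" using m n0 by (metis mult_0_right)
    moreover have "prime_factors m \<subseteq> S"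
    proof
      fix r assume r: "r \<in> prime_factors m"
      then have "r dvd n" by (subst m(1)) (auto simp: in_prime_factors_iff)
      with r n n0 have "r \<in> insert q S" by (auto simp: smooth_numbers_def in_prime_factors_iff)
      with r m(2) show "r \<in> S" by (auto simp: in_prime_factors_iff)
    qed
    ultimately have "m \<in> smooth_numbers S" by (simp add: smooth_numbers_def)
    then show "n \<in> (\<lambda>(k, m). q ^ k * m) ` (UNIV \<times> smooth_numbers S)"
      using m(1) by (intro image_eqI[of _ _ "(multiplicity q n, m)"]) auto
  qed
  ultimately show ?thesis by (simp add: bij_betw_def)
qed

text \<open>A finite Euler product. The bijection from (k, m) to q^k * m turns the sum for
  \<open>insert q S\<close> into a double sum that factors. Absolute summability is carried along in
  the induction because it justifies the iterated summation.\<close>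

lemma smooth_numbers_has_sum:
  fixes c :: "nat \<Rightarrow> nat \<Rightarrow> 'a::{real_normed_field, banach, second_countable_topology}"
  assumes "finite S" "\<And>q. q \<in> S \<Longrightarrow> prime q" "\<And>q. q \<in> S \<Longrightarrow> (\<lambda>k. norm (c q k)) summable_on UNIV"
  shows "(\<lambda>n. norm (\<Prod>q\<in>S. c q (multiplicity q n))) summable_on smooth_numbers S \<and>
    ((\<lambda>n. \<Prod>q\<in>S. c q (multiplicity q n)) has_sum (\<Prod>q\<in>S. infsum (c q) UNIV)) (smooth_numbers S)"
  using assms
proof (induction S rule: finite_induct)
  case empty
  have "smooth_numbers {} = {1}"
    by (auto simp: smooth_numbers_def prime_factorization_empty_iff)
  then show ?case using has_sum_finite[of "{1::nat}" "\<lambda>_. 1::'a"] by simp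
next
  case (insert q S)
  define g where "g n = (\<Prod>q\<in>S. c q (multiplicity q n))" for n
  have q: "prime q" and S: "\<And>r. r \<in> S \<Longrightarrow> prime r" using insert by auto
  have cq: "(\<lambda>k. norm (c q k)) summable_on UNIV" using insert by simp
  have g: "(\<lambda>n. norm (g n)) summable_on smooth_numbers S" "(g has_sum (\<Prod>q\<in>S. infsum (c q) UNIV)) (smooth_numbers S)"
    using insert by (auto simp: g_def[abs_def])
  have bij: "bij_betw (\<lambda>(k, m). q ^ k * m) (UNIV \<times> smooth_numbers S) (smooth_numbers (insert q S))"
    by (rule bij_betw_smooth_numbers_insert) (use q S insert(2) in auto)
  define G where "G n = (\<Prod>r\<in>insert q S. c r (multiplicity r n))" for n
  have f: "G (case x of (k, m) \<Rightarrow> q ^ k * m) =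
      (case x of (k, m) \<Rightarrow> c q k * g m)" if xS: "x \<in> UNIV \<times> smooth_numbers S" for x
  proof -
    obtain k m where x: "x = (k, m)" "m \<in> smooth_numbers S" using xS by (cases x) auto
    have m: "m > 0" "multiplicity q m = 0"
      using x insert(2) q
      by (auto simp: smooth_numbers_def in_prime_factors_iff intro!: not_dvd_imp_multiplicity_0)
    have "multiplicity r (q ^ k * m) = multiplicity r m" if "r \<in> S" for r
      using that insert(2) S[OF that] q m by (auto simp: multiplicity_prime_power_times)
    then show ?thesis using x m q insert(1,2) by (simp add: multiplicity_prime_power_times g_def G_def)
  qed
  have abs: "(\<lambda>x. norm (case x of (k, m) \<Rightarrow> c q k * g m)) summable_on UNIV \<times> smooth_numbers S"
    unfolding Infinite_Sum.abs_summable_on_Sigma_iff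
  proof (intro conjI ballI)
    show "(\<lambda>m. norm (case (k, m) of (k, m) \<Rightarrow> c q k * g m)) summable_on smooth_numbers S" for k
      using summable_on_cmult_right[OF g(1), of "norm (c q k)"] by (simp add: norm_mult)
    have "(\<lambda>k. norm (c q k) * infsum (\<lambda>m. norm (g m)) (smooth_numbers S)) summable_on UNIV"
      by (rule summable_on_cmult_left[OF cq])
    then show "(\<lambda>k. norm (infsum (\<lambda>m. norm (case (k, m) of (k, m) \<Rightarrow> c q k * g m)) (smooth_numbers S))) summable_on UNIV"
      by (simp add: norm_mult infsum_cmult_right' abs_mult infsum_nonneg)
  qed
  have "((\<lambda>(k, m). c q k * g m) has_sum (infsum (c q) UNIV * (\<Prod>q\<in>S. infsum (c q) UNIV))) (UNIV \<times> smooth_numbers S)"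
  proof (rule has_sum_SigmaI)
    show "((\<lambda>m. case (k, m) of (k, m) \<Rightarrow> c q k * g m) has_sum (c q k * (\<Prod>q\<in>S. infsum (c q) UNIV))) (smooth_numbers S)" for k
      using has_sum_cmult_right[OF g(2), of "c q k"] by simp
    show "((\<lambda>k. c q k * (\<Prod>q\<in>S. infsum (c q) UNIV)) has_sum (infsum (c q) UNIV * (\<Prod>q\<in>S. infsum (c q) UNIV))) UNIV"
      by (rule has_sum_cmult_left[OF has_sum_infsum[OF Infinite_Sum.abs_summable_summable[OF cq]]])
    show "(\<lambda>(k, m). c q k * g m) summable_on UNIV \<times> smooth_numbers S"
      by (rule Infinite_Sum.abs_summable_summable[OF abs])
  qed
  moreover have "((\<lambda>x. G (case x of (k, m) \<Rightarrow> q ^ k * m)) has_sum V) (UNIV \<times> smooth_numbers S) \<longleftrightarrow>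
      ((\<lambda>(k, m). c q k * g m) has_sum V) (UNIV \<times> smooth_numbers S)" for V
    by (rule has_sum_cong[OF f])
  ultimately have "(G has_sum (infsum (c q) UNIV * (\<Prod>q\<in>S. infsum (c q) UNIV))) (smooth_numbers (insert q S))"
    using has_sum_reindex_bij_betw[OF bij, of G] by simp
  moreover have "(\<lambda>x. norm (G (case x of (k, m) \<Rightarrow> q ^ k * m))) summable_on UNIV \<times> smooth_numbers S"
    by (rule iffD2[OF summable_on_cong abs]) (simp only: f)
  then have "(\<lambda>n. norm (G n)) summable_on smooth_numbers (insert q S)"
    by (rule iffD1[OF summable_on_reindex_bij_betw[OF bij, of "\<lambda>n. norm (G n)"]])
  ultimately show ?case using insert(1,2) by (simp add: G_def[abs_def])
qed

lemma smooth_numbers_sums: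
  fixes c :: "nat \<Rightarrow> nat \<Rightarrow> 'a::{real_normed_field, banach, second_countable_topology}"
  assumes S: "finite S" "\<And>q. q \<in> S \<Longrightarrow> prime q"
    and c: "\<And>q. q \<in> S \<Longrightarrow> summable (\<lambda>k. norm (c q k))"
  defines "e \<equiv> \<lambda>n. if n \<in> smooth_numbers S then \<Prod>q\<in>S. c q (multiplicity q n) else 0"
  shows "summable (\<lambda>n. norm (e n))" and "e sums (\<Prod>q\<in>S. \<Sum>k. c q k)"
proof -
  have c': "(\<lambda>k. norm (c q k)) summable_on UNIV" if "q \<in> S" for q
    using c[OF that] by (simp add: summable_on_UNIV_nonneg_real_iff)
  have c'': "infsum (c q) UNIV = (\<Sum>k. c q k)" if "q \<in> S" for q
    using sums_unique[OF has_sum_imp_sums[OF has_sum_infsum[OF Infinite_Sum.abs_summable_summable[OF c'[OF that]]]]] .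
  note * = smooth_numbers_has_sum[OF S c']
  have "(\<lambda>n. norm (e n)) summable_on UNIV"
    using conjunct1[OF *] unfolding e_def
    by (subst summable_on_cong_neutral[of "smooth_numbers S"]) auto
  then show "summable (\<lambda>n. norm (e n))" by (simp add: summable_on_UNIV_nonneg_real_iff)
  have "(e has_sum (\<Prod>q\<in>S. infsum (c q) UNIV)) UNIV"
    using conjunct2[OF *] unfolding e_def
    by (subst has_sum_cong_neutral[of "smooth_numbers S"]) auto
  then show "e sums (\<Prod>q\<in>S. \<Sum>k. c q k)"
    using c'' by (auto dest!: has_sum_imp_sums)
qed

lemma prod_multiplicity_smooth:
  fixes w :: "nat \<Rightarrow> complex"
  assumes S: "finite S" "\<And>q. q \<in> S \<Longrightarrow> prime q" and n: "n \<in> smooth_numbers S"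
  shows "(\<Prod>q\<in>S. w q ^ multiplicity q n) = torus_char w n"
  unfolding torus_char_def
  by (rule prod.mono_neutral_right)
    (use S n in \<open>auto simp: smooth_numbers_def in_prime_factors_iff not_dvd_imp_multiplicity_0\<close>)

lemma prod_multiplicity_smooth_powr:
  fixes y :: real
  assumes S: "finite S" "\<And>q. q \<in> S \<Longrightarrow> prime q" and n: "n \<in> smooth_numbers S"
  shows "(\<Prod>q\<in>S. (real q powr y) ^ multiplicity q n) = real n powr y"
proof -
  have "complex_of_real (\<Prod>q\<in>S. (real q powr y) ^ multiplicity q n) =
      (\<Prod>q\<in>S. (of_nat q powr of_real y) ^ multiplicity q n)"
    by (simp flip: powr_of_real)
  also have "\<dots> = of_nat n powr of_real y"
    using prod_multiplicity_smooth[OF S n] torus_char_powr n by (simp add: smooth_numbers_def)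
  also have "\<dots> = complex_of_real (real n powr y)" by (simp flip: powr_of_real)
  finally show ?thesis by (simp only: of_real_eq_iff)
qed

lemma powr_minus_lt_1: "prime q \<Longrightarrow> y > 0 \<Longrightarrow> real q powr (- y) < 1"
  using powr_less_mono[of "-y" 0 "real q"] prime_gt_1_nat[of q] by simp

text \<open>Only finitely many primes are involved, so the series converges for all y > 0, not
  merely for y > 1.\<close>

lemma smooth_zeta_sums:
  assumes S: "finite S" "\<And>q. q \<in> S \<Longrightarrow> prime q" and y: "y > 0"
  shows "(\<lambda>n. if n \<in> smooth_numbers S then real n powr (- y) else 0) sums (\<Prod>q\<in>S. 1 / (1 - real q powr (- y)))"
proof -
  have lt: "real q powr (- y) < 1" if "q \<in> S" for q
    using powr_minus_lt_1 S(2)[OF that] y by auto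
  have "(\<lambda>n. if n \<in> smooth_numbers S then \<Prod>q\<in>S. (real q powr (- y)) ^ multiplicity q n else 0) sums
      (\<Prod>q\<in>S. \<Sum>k. (real q powr (- y)) ^ k)"
    by (rule smooth_numbers_sums[OF S]) (use lt in \<open>auto simp: norm_power intro!: summable_geometric\<close>)
  moreover have "(\<Prod>q\<in>S. \<Sum>k. (real q powr (- y)) ^ k) = (\<Prod>q\<in>S. 1 / (1 - real q powr (- y)))"
    using lt by (intro prod.cong refl suminf_geometric) auto
  ultimately show ?thesis
    by (simp add: prod_multiplicity_smooth_powr[OF S] cong: if_cong)
qed

section \<open>Elementary bounds for the zeta function\<close>

text \<open>The mean value theorem for t powr (1 - x). Summed over integers t the middle terms
  telescope, which replaces the integral test for the zeta series.\<close>

lemma powr_diff_bounds: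
  fixes x t :: real
  assumes x: "x > 1" and t: "t > 0"
  shows "(x - 1) * (t + 1) powr (- x) \<le> t powr (1 - x) - (t + 1) powr (1 - x)"
    and "t powr (1 - x) - (t + 1) powr (1 - x) \<le> (x - 1) * t powr (- x)"
proof -
  have "\<exists>z>t. z < t + 1 \<and> (t + 1) powr (1 - x) - t powr (1 - x) = (t + 1 - t) * ((1 - x) * z powr (1 - x - 1))"
    by (rule MVT2) (use t in \<open>auto intro!: derivative_eq_intros\<close>)
  then obtain z where z: "t < z" "z < t + 1"
    "t powr (1 - x) - (t + 1) powr (1 - x) = (x - 1) * z powr (- x)"
    by (auto simp: algebra_simps)
  have "(t + 1) powr (- x) \<le> z powr (- x)" "z powr (- x) \<le> t powr (- x)"
    using z t x by (auto intro!: powr_mono2')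
  with x z show "(x - 1) * (t + 1) powr (- x) \<le> t powr (1 - x) - (t + 1) powr (1 - x)"
    "t powr (1 - x) - (t + 1) powr (1 - x) \<le> (x - 1) * t powr (- x)" by auto
qed

lemma zeta_partial_le:
  assumes x: "x > 1"
  shows "(\<Sum>n=1..N. real n powr (- x)) \<le> 1 + 1 / (x - 1)"
proof -
  have "(x - 1) * (\<Sum>n=1..Suc N. real n powr (- x)) \<le> (x - 1) + (1 - real (Suc N) powr (1 - x))" for N
  proof (induction N)
    case (Suc N)
    then show ?case using powr_diff_bounds(1)[OF x, of "real (Suc N)"] by (simp add: algebra_simps)
  qed simp
  from this[of N] have "(x - 1) * (\<Sum>n=1..Suc N. real n powr (- x)) \<le> x"
    using powr_ge_zero[of "real (Suc N)" "1 - x"] by linarith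
  moreover have "(\<Sum>n=1..N. real n powr (- x)) \<le> (\<Sum>n=1..Suc N. real n powr (- x))" by simp
  ultimately have "(x - 1) * (\<Sum>n=1..N. real n powr (- x)) \<le> x"
    using x by (smt (verit) mult_left_mono)
  then show ?thesis using x by (simp add: field_simps)
qed

lemma zeta_partial_ge:
  assumes x: "x > 1"
  shows "(\<Sum>n=1..N. real n powr (- x)) \<ge> (1 - real (Suc N) powr (1 - x)) / (x - 1)"
proof -
  have "(x - 1) * (\<Sum>n=1..N. real n powr (- x)) \<ge> 1 - real (Suc N) powr (1 - x)"
  proof (induction N)
    case (Suc N)
    then show ?case using powr_diff_bounds(2)[OF x, of "real (Suc N)"] by (simp add: algebra_simps)
  qed simp
  then show ?thesis using x by (simp add: field_simps)
qed

text \<open>The product is the part of the zeta series carried by smooth n, so the bound for the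
  full series holds for every S.\<close>

lemma zeta_smooth_le:
  assumes S: "finite S" "\<And>q. q \<in> S \<Longrightarrow> prime q" and x: "x > 1"
  shows "(\<Prod>q\<in>S. 1 / (1 - real q powr (- x))) \<le> 1 + 1 / (x - 1)"
proof -
  define f where "f = (\<lambda>n. if n \<in> smooth_numbers S then real n powr (- x) else 0)"
  have f: "f sums (\<Prod>q\<in>S. 1 / (1 - real q powr (- x)))"
    unfolding f_def using x by (intro smooth_zeta_sums S) auto
  have "suminf f \<le> 1 + 1 / (x - 1)"
  proof (rule suminf_le_const)
    fix N
    have "(\<Sum>n<N. f n) \<le> (\<Sum>n\<in>{1..N}. real n powr (- x))"
    proof -
      have "(\<Sum>n<N. f n) = (\<Sum>n\<in>{1..<N}. f n)"
        by (rule sum.mono_neutral_right) (auto simp: f_def smooth_numbers_def)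
      also have "\<dots> \<le> (\<Sum>n\<in>{1..<N}. real n powr (- x))"
        by (rule sum_mono) (simp add: f_def)
      also have "\<dots> \<le> (\<Sum>n\<in>{1..N}. real n powr (- x))"
        by (rule sum_mono2) auto
      finally show ?thesis .
    qed
    also have "\<dots> \<le> 1 + 1 / (x - 1)" by (rule zeta_partial_le[OF x])
    finally show "(\<Sum>n<N. f n) \<le> 1 + 1 / (x - 1)" .
  qed (use f sums_summable in auto)
  then show ?thesis using f sums_unique by metis
qed

text \<open>All n <= N are smooth for the primes up to N, so the product dominates the N-th partial
  sum. N is taken so large that the defect N powr (1 - x) of that sum is below 1/2.\<close>

lemma zeta_smooth_ge:
  assumes x: "x > 1"
  obtains N where "(\<Prod>q | prime q \<and> q \<le> N. 1 / (1 - real q powr (- x))) \<ge> 1 / (2 * (x - 1))"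
proof -
  have "(\<lambda>N. real (Suc N) powr (1 - x)) \<longlonglongrightarrow> 0"
    by (rule tendsto_neg_powr)
      (use x filterlim_compose[OF filterlim_real_sequentially filterlim_Suc] in auto)
  then have "eventually (\<lambda>N. real (Suc N) powr (1 - x) < 1/2) sequentially"
    by (rule order_tendstoD) simp
  then obtain N where N: "real (Suc N) powr (1 - x) < 1/2"
    by (auto simp: eventually_sequentially)
  define S where "S = {q. prime q \<and> q \<le> N}"
  have S: "finite S" "\<And>q. q \<in> S \<Longrightarrow> prime q"
    by (auto simp: S_def intro: finite_subset[of _ "{..N}"])
  define f where "f = (\<lambda>n. if n \<in> smooth_numbers S then real n powr (- x) else 0)"
  have f: "f sums (\<Prod>q\<in>S. 1 / (1 - real q powr (- x)))"
    unfolding f_def using x by (intro smooth_zeta_sums S) auto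
  have "1 / (2 * (x - 1)) = (1/2) / (x - 1)" by simp
  also have "\<dots> \<le> (1 - real (Suc N) powr (1 - x)) / (x - 1)"
    by (rule divide_right_mono) (use N x in auto)
  also have "\<dots> \<le> (\<Sum>n=1..N. real n powr (- x))" by (rule zeta_partial_ge[OF x])
  also have "\<dots> = (\<Sum>n=1..N. f n)"
  proof (rule sum.cong[OF refl])
    fix n assume n: "n \<in> {1..N}"
    have "n \<in> smooth_numbers S"
      using n by (auto simp: smooth_numbers_def S_def in_prime_factors_iff dest!: dvd_imp_le)
    then show "real n powr (- x) = f n" by (simp add: f_def)
  qed
  also have "\<dots> \<le> suminf f"
    by (rule sum_le_suminf) (use f sums_summable in \<open>auto simp: f_def\<close>)
  also have "\<dots> = (\<Prod>q\<in>S. 1 / (1 - real q powr (- x)))" using f sums_unique by metis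
  finally show ?thesis using that by (simp add: S_def)
qed

section \<open>The Bergman norm of Dirichlet polynomials\<close>

lemma torus_moment_le:
  assumes "finite A" "{n. a n \<noteq> 0} \<subseteq> A" and p: "1 \<le> p"
  shows "torus_moment p a \<le> ennreal ((\<Sum>n\<in>A. cmod (a n)) powr p)"
proof -
  have "torus_moment p a \<le> (\<integral>\<^sup>+\<xi>. ennreal ((\<Sum>n\<in>A. cmod (a n)) powr p) \<partial>torus_measure)"
    unfolding torus_moment_def using AE_norm_torus_poly_le[OF assms(1,2)]
    by (intro nn_integral_mono_AE) (auto elim!: eventually_mono intro!: ennreal_leI powr_mono2 simp: p order_trans[OF zero_le_one p])
  then show ?thesis by (simp add: torus.emeasure_space_1)
qed

text \<open>Finiteness is the point: the real-valued integral of a function with infinite mean would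
  be read as 0. On the torus a polynomial is bounded.\<close>

lemma ennreal_Hp_norm_powr:
  assumes a: "finite {n. a n \<noteq> 0}" and p: "1 \<le> p"
  shows "ennreal (Hp_norm p a powr p) = torus_moment p a"
proof -
  have fin: "torus_moment p a < \<infinity>"
    using torus_moment_le[OF a order_refl p] by (rule order.strict_trans1) simp
  have "(\<integral>\<xi>. cmod (torus_poly a \<xi>) powr p \<partial>torus_measure) = enn2real (torus_moment p a)"
    unfolding torus_moment_def by (rule integral_eq_nn_integral) auto
  then have "Hp_norm p a = enn2real (torus_moment p a) powr (1 / p)"
    by (simp add: Hp_norm_def torus_poly_def)
  then show ?thesis using fin p by (simp add: powr_powr)
qed

lemma dseries_shift_support: "a \<in> dirichlet_polys \<Longrightarrow> {n. dseries_shift \<sigma> a n \<noteq> 0} = {n. a n \<noteq> 0}"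
  by (auto simp: dseries_shift_def dirichlet_polys_def intro: gr0I)

lemma dseries_shift_polys: "a \<in> dirichlet_polys \<Longrightarrow> dseries_shift \<sigma> a \<in> dirichlet_polys"
  using dseries_shift_support[of a \<sigma>] by (simp add: dirichlet_polys_def dseries_shift_def)

lemma norm_dseries_shift_le: "0 \<le> \<sigma> \<Longrightarrow> cmod (dseries_shift \<sigma> a n) \<le> cmod (a n)"
proof (cases "n = 0")
  case False
  assume "0 \<le> \<sigma>"
  then have "real n powr (- \<sigma>) \<le> 1" using False powr_mono[of "-\<sigma>" 0 "real n"] by simp
  then show ?thesis by (simp add: dseries_shift_def norm_mult mult_left_le)
qed (simp add: dseries_shift_def)

lemma torus_poly_shift:
  assumes "a \<in> dirichlet_polys"
  shows "torus_poly (dseries_shift \<sigma> a) \<xi> = (\<Sum>n | a n \<noteq> 0. a n * of_real (real n powr (- \<sigma>)) * torus_char \<xi> n)"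
  unfolding torus_poly_def dseries_shift_support[OF assms] by (simp add: dseries_shift_def)

lemma sets_mu [simp, measurable_cong]: "sets (mu \<alpha>) = sets borel"
  by (simp add: mu_def)

lemma space_mu [simp]: "space (mu \<alpha>) = UNIV"
  by (simp add: mu_def)

lemma AE_mu: "AE \<sigma> in mu \<alpha>. \<sigma> > 0"
  unfolding mu_def by (subst AE_density) (auto simp: indicator_def)

lemma torus_moment_shift_measurable [measurable]:
  assumes a: "a \<in> dirichlet_polys"
  shows "(\<lambda>\<sigma>. torus_moment p (dseries_shift \<sigma> a)) \<in> borel_measurable borel"
proof -
  have [measurable]: "(\<lambda>x. torus_char (snd x) n) \<in> borel_measurable (borel \<Otimes>\<^sub>M torus_measure)" for n
    by (rule torus_char_measurable)
      (rule measurable_compose[OF measurable_snd torus_component_measurable])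
  have [measurable]: "(\<lambda>(\<sigma>, \<xi>). torus_poly (dseries_shift \<sigma> a) \<xi>) \<in> borel_measurable (borel \<Otimes>\<^sub>M torus_measure)"
    unfolding torus_poly_shift[OF a] case_prod_beta by measurable
  show ?thesis unfolding torus_moment_def by measurable
qed

definition Ap_moment :: "real \<Rightarrow> real \<Rightarrow> dseries \<Rightarrow> ennreal" where
  "Ap_moment p \<alpha> a = (\<integral>\<^sup>+\<sigma>. torus_moment p (dseries_shift \<sigma> a) \<partial>mu \<alpha>)"

lemma dirichlet_polys_finite: "a \<in> dirichlet_polys \<Longrightarrow> finite {n. a n \<noteq> 0}"
  by (simp add: dirichlet_polys_def)

lemma dirichlet_polys_diff: "a \<in> dirichlet_polys \<Longrightarrow> b \<in> dirichlet_polys \<Longrightarrow> (\<lambda>n. a n - b n) \<in> dirichlet_polys"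
  unfolding dirichlet_polys_def by (auto intro: finite_subset[of _ "{n. a n \<noteq> 0} \<union> {n. b n \<noteq> 0}"])

lemma dirichlet_polys_add: "a \<in> dirichlet_polys \<Longrightarrow> b \<in> dirichlet_polys \<Longrightarrow> (\<lambda>n. a n + b n) \<in> dirichlet_polys"
  unfolding dirichlet_polys_def by (auto intro: finite_subset[of _ "{n. a n \<noteq> 0} \<union> {n. b n \<noteq> 0}"])

lemma dirichlet_polys_mult: "a \<in> dirichlet_polys \<Longrightarrow> (\<lambda>n. a n * w n) \<in> dirichlet_polys"
  unfolding dirichlet_polys_def by (auto intro: finite_subset[of _ "{n. a n \<noteq> 0}"])

locale bergman =
  fixes p \<alpha> :: real
  assumes p: "1 \<le> p" and \<alpha>: "- 1 < \<alpha>"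
begin

sublocale mu: prob_space "mu \<alpha>"
  by (rule prob_space_mu[OF \<alpha>])

abbreviation nrm :: "dseries \<Rightarrow> real" where "nrm \<equiv> Ap_poly_norm p \<alpha>"

lemma Ap_moment_le:
  assumes a: "a \<in> dirichlet_polys" and A: "finite A" "{n. a n \<noteq> 0} \<subseteq> A"
  shows "Ap_moment p \<alpha> a \<le> ennreal ((\<Sum>n\<in>A. cmod (a n)) powr p)"
proof -
  have "Ap_moment p \<alpha> a \<le> (\<integral>\<^sup>+\<sigma>. ennreal ((\<Sum>n\<in>A. cmod (a n)) powr p) \<partial>mu \<alpha>)"
    unfolding Ap_moment_def
  proof (intro nn_integral_mono_AE, use AE_mu in eventually_elim)
    fix \<sigma> :: real assume "\<sigma> > 0"
    have "torus_moment p (dseries_shift \<sigma> a) \<le> ennreal ((\<Sum>n\<in>A. cmod (dseries_shift \<sigma> a n)) powr p)"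
      by (rule torus_moment_le) (use A dseries_shift_support[OF a] p in auto)
    also have "\<dots> \<le> ennreal ((\<Sum>n\<in>A. cmod (a n)) powr p)"
      using p \<open>\<sigma> > 0\<close> by (intro ennreal_leI powr_mono2 sum_mono norm_dseries_shift_le sum_nonneg) auto
    finally show "torus_moment p (dseries_shift \<sigma> a) \<le> ennreal ((\<Sum>n\<in>A. cmod (a n)) powr p)" .
  qed
  then show ?thesis using mu.emeasure_space_1 by simp
qed

text \<open>From here on the norm is handled through \<open>Ap_moment\<close>. As for the Hardy
  norm, finiteness and measurability have to be secured before the two kinds of integral
  agree.\<close>

lemma ennreal_nrm_powr:
  assumes a: "a \<in> dirichlet_polys"
  shows "ennreal (nrm a powr p) = Ap_moment p \<alpha> a"
proof -
  have fin: "Ap_moment p \<alpha> a < \<infinity>"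
    using Ap_moment_le[OF a dirichlet_polys_finite[OF a] order_refl] by (rule order.strict_trans1) simp
  have H: "ennreal (Hp_norm p (dseries_shift \<sigma> a) powr p) = torus_moment p (dseries_shift \<sigma> a)" for \<sigma>
    by (rule ennreal_Hp_norm_powr[OF dirichlet_polys_finite[OF dseries_shift_polys[OF a]] p])
  then have "Hp_norm p (dseries_shift \<sigma> a) powr p = enn2real (torus_moment p (dseries_shift \<sigma> a))" for \<sigma>
    by (metis enn2real_ennreal powr_ge_zero)
  then have meas: "(\<lambda>\<sigma>. Hp_norm p (dseries_shift \<sigma> a) powr p) \<in> borel_measurable (mu \<alpha>)"
    using a by simp
  have "(\<integral>\<sigma>. Hp_norm p (dseries_shift \<sigma> a) powr p \<partial>mu \<alpha>) = enn2real (Ap_moment p \<alpha> a)"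
    unfolding Ap_moment_def H[symmetric] by (rule integral_eq_nn_integral) (use meas in auto)
  then have "nrm a = enn2real (Ap_moment p \<alpha> a) powr (1 / p)"
    by (simp add: Ap_poly_norm_def)
  then show ?thesis using fin p by (simp add: powr_powr)
qed

lemma nrm_nonneg: "0 \<le> nrm a"
  by (simp add: Ap_poly_norm_def)

lemma powr_le_powr_iff: "0 \<le> x \<Longrightarrow> 0 \<le> y \<Longrightarrow> x powr p \<le> y powr p \<longleftrightarrow> x \<le> (y::real)"
  using p by (smt (verit) powr_less_mono2 powr_mono2)

lemma le_nrm_iff:
  assumes "a \<in> dirichlet_polys" "0 \<le> x"
  shows "x \<le> nrm a \<longleftrightarrow> ennreal (x powr p) \<le> Ap_moment p \<alpha> a"
  using assms by (simp add: ennreal_nrm_powr[symmetric] powr_le_powr_iff nrm_nonneg)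

lemma nrm_le_iff:
  assumes "a \<in> dirichlet_polys" "0 \<le> x"
  shows "nrm a \<le> x \<longleftrightarrow> Ap_moment p \<alpha> a \<le> ennreal (x powr p)"
  using assms by (simp add: ennreal_nrm_powr[symmetric] powr_le_powr_iff nrm_nonneg)

lemma nrm_le_sum:
  assumes "a \<in> dirichlet_polys" "finite A" "{n. a n \<noteq> 0} \<subseteq> A"
  shows "nrm a \<le> (\<Sum>n\<in>A. cmod (a n))"
  using assms by (simp add: nrm_le_iff sum_nonneg Ap_moment_le)

section \<open>Minkowski's inequality, scaling and contractive multipliers for the Bergman
  norm\<close>

lemma convex_powr_le:
  fixes A B x y :: real
  assumes "A > 0" "B > 0" "0 \<le> x" "0 \<le> y"
  shows "(x + y) powr p \<le> (A + B) powr (p - 1) * (A powr (1 - p) * x powr p + B powr (1 - p) * y powr p)"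
proof (cases "x + y = 0")
  case False
  \<comment> \<open>\<open>c\<close> is the mean of \<open>u\<close> and \<open>v\<close> with
    weights A and B. Adding the tangent inequalities at \<open>c\<close> with these weights cancels
    the linear terms.\<close>
  define u v c where "u = x / A" and "v = y / B" and "c = (x + y) / (A + B)"
  have pos: "c > 0" "u \<ge> 0" "v \<ge> 0" using assms False by (auto simp: u_def v_def c_def)
  have xy: "x = A * u" "y = B * v" using assms by (auto simp: u_def v_def)
  have c: "c * (A + B) = A * u + B * v" using assms by (simp add: c_def xy)
  have "A * (c powr p + p * c powr (p - 1) * (u - c)) + B * (c powr p + p * c powr (p - 1) * (v - c))
      \<le> A * u powr p + B * v powr p"
    by (intro add_mono mult_left_mono powr_tangent_le p pos) (use assms in auto)
  also have "A * (c powr p + p * c powr (p - 1) * (u - c)) + B * (c powr p + p * c powr (p - 1) * (v - c))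
      = (A + B) * c powr p + p * c powr (p - 1) * (A * u + B * v - c * (A + B))"
    by (simp add: algebra_simps)
  finally have "(A + B) * c powr p \<le> A * u powr p + B * v powr p" using c by simp
  then have "(A + B) powr (p - 1) * ((A + B) * c powr p) \<le> (A + B) powr (p - 1) * (A * u powr p + B * v powr p)"
    by (rule mult_left_mono) simp
  moreover have "(A + B) powr (p - 1) * ((A + B) * c powr p) = (x + y) powr p"
  proof -
    have "(A + B) powr (p - 1) * (A + B) = (A + B) powr p"
      using assms by (simp add: powr_mult_base[of "A + B" "p - 1"] mult.commute)
    then have "(A + B) powr (p - 1) * ((A + B) * c powr p) = (A + B) powr p * c powr p"
      by (metis mult.assoc)
    also have "\<dots> = ((A + B) * c) powr p" using assms pos by (simp add: powr_mult)
    also have "(A + B) * c = x + y" using assms by (simp add: c_def)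
    finally show ?thesis .
  qed
  moreover have "Z * (z / Z) powr p = Z powr (1 - p) * z powr p" if "Z > 0" "z \<ge> 0" for Z z :: real
    using that by (simp add: powr_divide powr_diff)
  ultimately show ?thesis using assms by (simp add: u_def v_def)
qed (use p assms in simp)

text \<open>The weighted convexity inequality is applied pointwise with A and B close to the two
  norms and integrated twice; its right side then becomes exactly (A + B) powr p. The summands e / 2
  keep A and B positive when a norm vanishes.\<close>

lemma nrm_triangle:
  assumes a: "a \<in> dirichlet_polys" and b: "b \<in> dirichlet_polys"
  shows "nrm (\<lambda>n. a n + b n) \<le> nrm a + nrm b"
proof (rule field_le_epsilon)
  fix e :: real assume e: "e > 0"
  define A B where "A = nrm a + e / 2" and "B = nrm b + e / 2"
  have AB: "A > 0" "B > 0" "nrm a \<le> A" "nrm b \<le> B" using e nrm_nonneg[of a] nrm_nonneg[of b] by (auto simp: A_def B_def)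
  define k l where "k = (A + B) powr (p - 1) * A powr (1 - p)" and "l = (A + B) powr (p - 1) * B powr (1 - p)"
  have kl: "k \<ge> 0" "l \<ge> 0" by (auto simp: k_def l_def)
  have ab: "(\<lambda>n. a n + b n) \<in> dirichlet_polys" by (rule dirichlet_polys_add[OF a b])
  have tm: "torus_moment p (dseries_shift \<sigma> (\<lambda>n. a n + b n)) \<le>
      ennreal k * torus_moment p (dseries_shift \<sigma> a) + ennreal l * torus_moment p (dseries_shift \<sigma> b)" for \<sigma>
  proof -
    have add: "torus_poly (dseries_shift \<sigma> (\<lambda>n. a n + b n)) \<xi> =
        torus_poly (dseries_shift \<sigma> a) \<xi> + torus_poly (dseries_shift \<sigma> b) \<xi>" for \<xi>
    proof -
      define F where "F = {n. a n \<noteq> 0} \<union> {n. b n \<noteq> 0}"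
      have F: "finite F" using a b by (simp add: F_def dirichlet_polys_def)
      note eq = torus_poly_eq_sum[OF F]
      show ?thesis
        by (subst eq, force simp: F_def dseries_shift_def, subst eq, force simp: F_def dseries_shift_def,
            subst eq, force simp: F_def dseries_shift_def)
          (simp add: dseries_shift_def algebra_simps sum.distrib)
    qed
    have "torus_moment p (dseries_shift \<sigma> (\<lambda>n. a n + b n)) \<le>
        (\<integral>\<^sup>+\<xi>. ennreal k * ennreal (cmod (torus_poly (dseries_shift \<sigma> a) \<xi>) powr p) +
              ennreal l * ennreal (cmod (torus_poly (dseries_shift \<sigma> b) \<xi>) powr p) \<partial>torus_measure)"
      unfolding torus_moment_def
    proof (rule nn_integral_mono)
      fix \<xi>
      define x y where "x = torus_poly (dseries_shift \<sigma> a) \<xi>" and "y = torus_poly (dseries_shift \<sigma> b) \<xi>"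
      have "cmod (x + y) powr p \<le> (cmod x + cmod y) powr p"
        using p by (intro powr_mono2 norm_triangle_ineq) auto
      also have "\<dots> \<le> k * cmod x powr p + l * cmod y powr p"
        using convex_powr_le[OF AB(1,2), of "cmod x" "cmod y"] by (simp add: k_def l_def algebra_simps)
      finally have "ennreal (cmod (x + y) powr p) \<le> ennreal (k * cmod x powr p + l * cmod y powr p)"
        by (rule ennreal_leI)
      then show "ennreal (cmod (torus_poly (dseries_shift \<sigma> (\<lambda>n. a n + b n)) \<xi>) powr p) \<le>
        ennreal k * ennreal (cmod (torus_poly (dseries_shift \<sigma> a) \<xi>) powr p) +
              ennreal l * ennreal (cmod (torus_poly (dseries_shift \<sigma> b) \<xi>) powr p)"
        using kl by (simp add: add x_def y_def ennreal_mult')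
    qed
    also have "\<dots> = ennreal k * torus_moment p (dseries_shift \<sigma> a) + ennreal l * torus_moment p (dseries_shift \<sigma> b)"
      unfolding torus_moment_def by (subst nn_integral_add) (auto simp: nn_integral_cmult)
    finally show ?thesis .
  qed
  have "Ap_moment p \<alpha> (\<lambda>n. a n + b n) \<le>
      (\<integral>\<^sup>+\<sigma>. ennreal k * torus_moment p (dseries_shift \<sigma> a) + ennreal l * torus_moment p (dseries_shift \<sigma> b) \<partial>mu \<alpha>)"
    unfolding Ap_moment_def by (intro nn_integral_mono tm)
  also have "\<dots> = ennreal k * Ap_moment p \<alpha> a + ennreal l * Ap_moment p \<alpha> b"
    unfolding Ap_moment_def using a b by (subst nn_integral_add) (auto simp: nn_integral_cmult)
  also have "\<dots> \<le> ennreal k * ennreal (A powr p) + ennreal l * ennreal (B powr p)"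
    using AB a b by (intro add_mono mult_left_mono) (auto simp: nrm_le_iff[symmetric])
  also have "\<dots> = ennreal (k * A powr p + l * B powr p)"
    using kl by (simp add: ennreal_mult')
  also have "k * A powr p + l * B powr p = (A + B) powr p"
  proof -
    have "Z powr (1 - p) * Z powr p = Z" if "Z > 0" for Z :: real
      using that by (simp flip: powr_add)
    then have "k * A powr p = (A + B) powr (p - 1) * A" "l * B powr p = (A + B) powr (p - 1) * B"
      using AB by (simp_all add: k_def l_def mult.assoc)
    then have "k * A powr p + l * B powr p = (A + B) powr (p - 1) * (A + B)"
      by (simp add: distrib_left)
    also have "\<dots> = (A + B) powr p"
      using AB by (simp add: powr_mult_base[of "A + B" "p - 1"] mult.commute)
    finally show ?thesis .
  qed
  finally have "nrm (\<lambda>n. a n + b n) \<le> A + B"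
    using ab AB by (simp add: nrm_le_iff)
  then show "nrm (\<lambda>n. a n + b n) \<le> nrm a + nrm b + e" by (simp add: A_def B_def)
qed

lemma nrm_scale:
  assumes a: "a \<in> dirichlet_polys"
  shows "nrm (\<lambda>n. a n * c) = cmod c * nrm a"
proof (cases "c = 0")
  case True
  have "nrm (\<lambda>n. 0) \<le> 0" using nrm_le_sum[of "\<lambda>n. 0" "{}"] by (simp add: dirichlet_polys_def)
  then show ?thesis using True nrm_nonneg[of "\<lambda>n. 0"] by simp
next
  case False
  have tm: "torus_moment p (dseries_shift \<sigma> (\<lambda>n. a n * c)) = ennreal (cmod c powr p) * torus_moment p (dseries_shift \<sigma> a)" for \<sigma>
  proof -
    have "torus_poly (dseries_shift \<sigma> (\<lambda>n. a n * c)) \<xi> = c * torus_poly (dseries_shift \<sigma> a) \<xi>" for \<xi>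
      using False by (simp add: torus_poly_def dseries_shift_def sum_distrib_left mult_ac)
    then show ?thesis
      by (simp add: torus_moment_def norm_mult powr_mult ennreal_mult' nn_integral_cmult)
  qed
  have "Ap_moment p \<alpha> (\<lambda>n. a n * c) = ennreal (cmod c powr p) * Ap_moment p \<alpha> a"
    unfolding Ap_moment_def tm using a by (simp add: nn_integral_cmult)
  then have "ennreal (nrm (\<lambda>n. a n * c) powr p) = ennreal ((cmod c * nrm a) powr p)"
    using a by (simp add: ennreal_nrm_powr dirichlet_polys_mult powr_mult nrm_nonneg ennreal_mult' flip: ennreal_nrm_powr)
  then have "nrm (\<lambda>n. a n * c) powr p = (cmod c * nrm a) powr p"
    by (simp add: ennreal_inj)
  then show ?thesis
    using powr_le_powr_iff nrm_nonneg by (metis norm_ge_zero mult_nonneg_nonneg order_antisym order_refl)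
qed

lemma nrm_diff_le:
  assumes a: "a \<in> dirichlet_polys" and b: "b \<in> dirichlet_polys"
  shows "\<bar>nrm a - nrm b\<bar> \<le> nrm (\<lambda>n. a n - b n)"
proof -
  have "nrm x \<le> nrm (\<lambda>n. x n - y n) + nrm y" if "x \<in> dirichlet_polys" "y \<in> dirichlet_polys" for x y
    using nrm_triangle[OF dirichlet_polys_diff[OF that] that(2)] by simp
  from this[OF a b] this[OF b a] have "\<bar>nrm a - nrm b\<bar> \<le> max (nrm (\<lambda>n. a n - b n)) (nrm (\<lambda>n. b n - a n))"
    by linarith
  moreover have "nrm (\<lambda>n. b n - a n) = nrm (\<lambda>n. a n - b n)"
    using nrm_scale[OF dirichlet_polys_diff[OF a b], of "-1"] by simp
  ultimately show ?thesis by simp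
qed

lemma nrm_multiplier_le:
  assumes a: "a \<in> dirichlet_polys" and r: "\<And>q. 0 \<le> r q" "\<And>q. r q \<le> 1"
  shows "nrm (\<lambda>n. a n * torus_char (\<lambda>q. of_real (r q)) n) \<le> nrm a"
proof -
  have "dseries_shift \<sigma> (\<lambda>n. a n * torus_char (\<lambda>q. of_real (r q)) n) =
      (\<lambda>n. dseries_shift \<sigma> a n * torus_char (\<lambda>q. of_real (r q)) n)" for \<sigma>
    by (simp add: dseries_shift_def mult_ac)
  then have "Ap_moment p \<alpha> (\<lambda>n. a n * torus_char (\<lambda>q. of_real (r q)) n) \<le> Ap_moment p \<alpha> a"
    unfolding Ap_moment_def
    by (auto intro!: nn_integral_mono torus_moment_multiplier_le r p dirichlet_polys_finite dseries_shift_polys a)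
  then show ?thesis
    using a by (simp add: nrm_le_iff dirichlet_polys_mult nrm_nonneg ennreal_nrm_powr)
qed

section \<open>Averaging over small shifts\<close>

lemma Ap_moment_ge:
  assumes "a \<in> dirichlet_polys" "\<And>\<eta>. 0 < \<eta> \<Longrightarrow> \<eta> < h \<Longrightarrow> X \<le> torus_moment p (dseries_shift \<eta> a)"
  shows "X * emeasure (mu \<alpha>) {0<..<h} \<le> Ap_moment p \<alpha> a"
proof -
  have "X * emeasure (mu \<alpha>) {0<..<h} = (\<integral>\<^sup>+\<eta>. X * indicator {0<..<h} \<eta> \<partial>mu \<alpha>)"
    by (subst nn_integral_cmult_indicator) auto
  also have "\<dots> \<le> Ap_moment p \<alpha> a"
    unfolding Ap_moment_def using assms by (intro nn_integral_mono) (auto simp: indicator_def)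
  finally show ?thesis .
qed

text \<open>The mass of (0, t) for t <= 1 is at least this number times t powr (\<alpha> + 1): exp
  (-2) bounds the exponential from below there, and integrating \<sigma> powr \<alpha> gives the
  divisor \<alpha> + 1.\<close>

definition mu_const :: real where
  "mu_const = 2 powr (\<alpha> + 1) / Gamma (\<alpha> + 1) * exp (- 2) / (\<alpha> + 1)"

lemma mu_const_pos: "mu_const > 0"
  using \<alpha> Gamma_real_pos[of "\<alpha> + 1"] by (simp add: mu_const_def)

lemma mu_density_nonneg: "0 \<le> 2 powr (\<alpha> + 1) / Gamma (\<alpha> + 1)"
  using \<alpha> Gamma_real_pos[of "\<alpha> + 1"] by simp

lemma emeasure_mu_ge:
  assumes h: "h > 0"
  shows "emeasure (mu \<alpha>) {0<..<h} \<ge> ennreal (mu_const * min 1 h powr (\<alpha> + 1))"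
proof -
  define k where "k = 2 powr (\<alpha> + 1) / Gamma (\<alpha> + 1)"
  define t where "t = min 1 h"
  have k: "k \<ge> 0" using mu_density_nonneg by (simp add: k_def)
  have "(\<lambda>\<sigma>. indicator {0..t} \<sigma> * \<sigma> powr \<alpha>) = (\<lambda>\<sigma>. if \<sigma> \<in> {0..t} then \<sigma> powr \<alpha> else 0)"
    by (auto simp: indicator_def)
  then have "((\<lambda>\<sigma>. indicator {0..t} \<sigma> * \<sigma> powr \<alpha>) has_integral (t powr (\<alpha> + 1) / (\<alpha> + 1))) UNIV"
    using has_integral_powr_from_0[OF \<alpha>, of t] h
    by (simp only: has_integral_restrict_UNIV) (simp add: t_def)
  then have "(\<integral>\<^sup>+\<sigma>. ennreal (indicator {0..t} \<sigma> * \<sigma> powr \<alpha>) \<partial>lborel) = ennreal (t powr (\<alpha> + 1) / (\<alpha> + 1))"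
    by (rule nn_integral_has_integral_lborel[rotated 2]) auto
  then have "ennreal (mu_const * t powr (\<alpha> + 1)) =
      ennreal (k * exp (-2)) * (\<integral>\<^sup>+\<sigma>. ennreal (indicator {0..t} \<sigma> * \<sigma> powr \<alpha>) \<partial>lborel)"
    using k by (simp add: mu_const_def k_def[symmetric] flip: ennreal_mult')
  also have "\<dots> = (\<integral>\<^sup>+\<sigma>. ennreal (k * exp (-2)) * ennreal (indicator {0..t} \<sigma> * \<sigma> powr \<alpha>) \<partial>lborel)"
    by (rule nn_integral_cmult[symmetric]) simp
  also have "\<dots> \<le> (\<integral>\<^sup>+\<sigma>. ennreal (k * \<sigma> powr \<alpha> * exp (- 2 * \<sigma>) * indicator {0<..} \<sigma>) * indicator {0<..<h} \<sigma> \<partial>lborel)"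
  proof (rule nn_integral_mono_AE)
    have "AE \<sigma> in lborel. \<sigma> \<noteq> t \<and> \<sigma> \<noteq> (0::real)" by (auto simp: AE_lborel_singleton)
    then show "AE \<sigma> in lborel. ennreal (k * exp (-2)) * ennreal (indicator {0..t} \<sigma> * \<sigma> powr \<alpha>) \<le>
      ennreal (k * \<sigma> powr \<alpha> * exp (- 2 * \<sigma>) * indicator {0<..} \<sigma>) * indicator {0<..<h} \<sigma>"
    proof eventually_elim
      fix \<sigma> assume "\<sigma> \<noteq> t \<and> \<sigma> \<noteq> (0::real)"
      then show "ennreal (k * exp (-2)) * ennreal (indicator {0..t} \<sigma> * \<sigma> powr \<alpha>) \<le>
        ennreal (k * \<sigma> powr \<alpha> * exp (- 2 * \<sigma>) * indicator {0<..} \<sigma>) * indicator {0<..<h} \<sigma>"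
        using k by (cases "\<sigma> \<in> {0<..<t}")
          (auto simp: t_def indicator_def mult_ac simp flip: ennreal_mult' intro!: ennreal_leI mult_left_mono)
    qed
  qed
  also have "\<dots> = emeasure (mu \<alpha>) {0<..<h}"
    unfolding mu_def by (subst emeasure_density) (auto simp: k_def)
  finally show ?thesis by (simp add: t_def)
qed

text \<open>The weight is split in two halves. One is spent on the bound on the torus, the other on
  the shift: for \<eta> < h / 2 one has n powr (- h) <= n powr (- \<eta>) * n powr (- (h / 2)). The
  shifts in (0, h / 2) have positive mass.\<close>

lemma nrm_H2_weighted:
  assumes h: "h > 0"
  obtains C where "C > 0" "\<And>a. a \<in> dirichlet_polys \<Longrightarrow>
    L2_set (\<lambda>n. cmod (a n) * real n powr (- h)) {n. a n \<noteq> 0} \<le> C * nrm a"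
proof -
  obtain C where C: "C > 0" "\<And>a. a \<in> dirichlet_polys \<Longrightarrow>
    ennreal (L2_set (\<lambda>n. cmod (a n) * real n powr (- (h / 2))) {n. a n \<noteq> 0} powr p) \<le> ennreal C * torus_moment p a"
    using torus_H2_weighted_le_moment[of "h / 2" p] h p by auto
  define m where "m = mu_const * min 1 (h / 2) powr (\<alpha> + 1)"
  have m: "m > 0" using mu_const_pos h by (simp add: m_def)
  define K where "K = (C / m) powr (1 / p)"
  have K: "K > 0" "K powr p = C / m" using C(1) m p by (auto simp: K_def powr_powr)
  have "L2_set (\<lambda>n. cmod (a n) * real n powr (- h)) {n. a n \<noteq> 0} \<le> K * nrm a" if a: "a \<in> dirichlet_polys" for a
  proof -
    define L where "L = L2_set (\<lambda>n. cmod (a n) * real n powr (- h)) {n. a n \<noteq> 0}"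
    have le_shift: "ennreal (L powr p / C) \<le> torus_moment p (dseries_shift \<eta> a)" if \<eta>: "0 < \<eta>" "\<eta> < h / 2" for \<eta>
    proof -
      have "L \<le> L2_set (\<lambda>n. cmod (dseries_shift \<eta> a n) * real n powr (- (h / 2))) {n. a n \<noteq> 0}"
        unfolding L_def
      proof (rule L2_set_mono)
        fix n assume "n \<in> {n. a n \<noteq> 0}"
        then have n: "real n \<ge> 1" using a by (auto simp: dirichlet_polys_def Suc_le_eq intro: gr0I)
        have "real n powr (- h) \<le> real n powr (- \<eta> - h / 2)"
          using n \<eta> by (intro powr_mono) auto
        also have "\<dots> = real n powr (- \<eta>) * real n powr (- (h / 2))"
          by (simp flip: powr_add)
        finally show "cmod (a n) * real n powr (- h) \<le> cmod (dseries_shift \<eta> a n) * real n powr (- (h / 2))"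
          by (simp add: dseries_shift_def norm_mult mult.assoc mult_left_mono)
      qed auto
      then have "ennreal (L powr p) \<le>
          ennreal (L2_set (\<lambda>n. cmod (dseries_shift \<eta> a n) * real n powr (- (h / 2))) {n. a n \<noteq> 0} powr p)"
        using p by (intro ennreal_leI powr_mono2) (simp_all add: L_def)
      also have "\<dots> \<le> ennreal C * torus_moment p (dseries_shift \<eta> a)"
        using C(2)[OF dseries_shift_polys[OF a, of \<eta>]] by (simp add: dseries_shift_support[OF a])
      finally have "ennreal (L powr p) \<le> ennreal C * torus_moment p (dseries_shift \<eta> a)" .
      then have "ennreal (1 / C) * ennreal (L powr p) \<le> ennreal (1 / C) * (ennreal C * torus_moment p (dseries_shift \<eta> a))"
        by (rule mult_left_mono) simp
      then show ?thesis
        using C(1) by (simp add: mult.assoc[symmetric] flip: ennreal_mult')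
    qed
    have "ennreal (L powr p / C) * emeasure (mu \<alpha>) {0<..<h / 2} \<le> Ap_moment p \<alpha> a"
      by (rule Ap_moment_ge[OF a]) (rule le_shift)
    then have "ennreal (L powr p / C) * ennreal m \<le> Ap_moment p \<alpha> a"
      using emeasure_mu_ge[of "h / 2"] h by (auto simp: m_def intro: order_trans[OF mult_left_mono])
    then have "ennreal ((L / K) powr p) \<le> Ap_moment p \<alpha> a"
      using K C(1) m by (simp add: powr_divide L_def flip: ennreal_mult')
    then have "L / K \<le> nrm a" using a K by (subst le_nrm_iff) (auto simp: L_def)
    then show ?thesis using K by (simp add: L_def field_simps)
  qed
  with K(1) that show ?thesis by blast
qed

lemma nrm_coefficient:
  assumes h: "h > 0"
  obtains C where "C > 0" "\<And>a n. a \<in> dirichlet_polys \<Longrightarrow> cmod (a n) \<le> C * real n powr h * nrm a"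
proof -
  obtain C where C: "C > 0" "\<And>a. a \<in> dirichlet_polys \<Longrightarrow>
    L2_set (\<lambda>n. cmod (a n) * real n powr (- h)) {n. a n \<noteq> 0} \<le> C * nrm a"
    using nrm_H2_weighted[OF h] by auto
  have "cmod (a n) \<le> C * real n powr h * nrm a" if a: "a \<in> dirichlet_polys" for a n
  proof (cases "a n = 0")
    case True
    then show ?thesis using C(1) nrm_nonneg[of a] by simp
  next
    case False
    then have n: "n > 0" using a by (auto simp: dirichlet_polys_def intro: gr0I)
    have "cmod (a n) * real n powr (- h) \<le> C * nrm a"
      using member_le_L2_set[OF dirichlet_polys_finite[OF a], of n "\<lambda>n. cmod (a n) * real n powr (- h)"]
        C(2)[OF a] False by simp
    then show ?thesis using n by (simp add: powr_minus field_simps)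
  qed
  with C(1) that show ?thesis by blast
qed

lemma nrm_abs_convergence:
  assumes \<sigma>: "\<sigma> > 1/2"
  obtains C where "C > 0" "\<And>a. a \<in> dirichlet_polys \<Longrightarrow>
    (\<Sum>n | a n \<noteq> 0. cmod (a n) * real n powr (- \<sigma>)) \<le> C * nrm a"
proof -
  \<comment> \<open>With this choice 2 * (\<sigma> - h) = \<sigma> + 1/2 > 1, so the second factor
    in Cauchy-Schwarz is square summable.\<close>
  define h where "h = (\<sigma> - 1/2) / 2"
  have h: "h > 0" "2 * (\<sigma> - h) > 1" using \<sigma> by (auto simp: h_def field_simps)
  obtain C where C: "C > 0" "\<And>a. a \<in> dirichlet_polys \<Longrightarrow>
    L2_set (\<lambda>n. cmod (a n) * real n powr (- h)) {n. a n \<noteq> 0} \<le> C * nrm a"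
    using nrm_H2_weighted[OF h(1)] by auto
  define Z where "Z = 1 + 1 / (2 * (\<sigma> - h) - 1)"
  have Z: "Z > 0" unfolding Z_def by (intro add_pos_pos divide_pos_pos) (use h in auto)
  have "(\<Sum>n | a n \<noteq> 0. cmod (a n) * real n powr (- \<sigma>)) \<le> (C * sqrt Z) * nrm a" if a: "a \<in> dirichlet_polys" for a
  proof -
    define A where "A = {n. a n \<noteq> 0}"
    have A: "finite A" "\<And>n. n \<in> A \<Longrightarrow> n > 0"
      using a by (auto simp: A_def dirichlet_polys_def intro: gr0I)
    obtain N where N: "A \<subseteq> {..N}" using finite_nat_iff_bounded_le[of A] A by auto
    have "(\<Sum>n\<in>A. cmod (a n) * real n powr (- \<sigma>)) =
        (\<Sum>n\<in>A. \<bar>cmod (a n) * real n powr (- h)\<bar> * \<bar>real n powr (- (\<sigma> - h))\<bar>)"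
      by (intro sum.cong refl) (simp add: abs_mult mult.assoc flip: powr_add)
    also have "\<dots> \<le> L2_set (\<lambda>n. cmod (a n) * real n powr (- h)) A * L2_set (\<lambda>n. real n powr (- (\<sigma> - h))) A"
      by (rule L2_set_mult_ineq)
    also have "\<dots> \<le> (C * nrm a) * sqrt Z"
    proof (rule mult_mono)
      have "(\<Sum>n\<in>A. (real n powr (- (\<sigma> - h)))\<^sup>2) = (\<Sum>n\<in>A. real n powr (- (2 * (\<sigma> - h))))"
        by (intro sum.cong refl) (simp add: power2_eq_square flip: powr_add)
      also have "\<dots> \<le> (\<Sum>n=1..N. real n powr (- (2 * (\<sigma> - h))))"
        by (rule sum_mono2) (use N A in \<open>auto simp: Suc_le_eq\<close>)
      also have "\<dots> \<le> Z" unfolding Z_def by (rule zeta_partial_le[OF h(2)])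
      finally show "L2_set (\<lambda>n. real n powr (- (\<sigma> - h))) A \<le> sqrt Z" by (simp add: L2_set_def)
    qed (use C a Z nrm_nonneg in \<open>auto simp: A_def\<close>)
    finally show ?thesis by (simp add: A_def mult_ac)
  qed
  moreover have "C * sqrt Z > 0" using C Z by simp
  ultimately show ?thesis using that by blast
qed

text \<open>The factor 2 comes from the zeta bound 2 * \<sigma> / \<delta>, with \<delta> = \<sigma>
  - 1/2. The rest comes from the mass of the shifts below \<delta> / 2, estimated through (\<delta>
  / (4 * \<sigma>)) powr (\<alpha> + 1).\<close>

definition point_eval_const :: real where
  "point_eval_const = (2 * 4 powr (\<alpha> + 1) / mu_const) powr (1 / p)"

lemma point_eval_const_pos: "point_eval_const > 0"
  using mu_const_pos by (simp add: point_eval_const_def)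

lemma dseries_eval_poly:
  "a \<in> dirichlet_polys \<Longrightarrow> dseries_eval a s = (\<Sum>n | a n \<noteq> 0. a n * of_nat n powr (- s))"
  unfolding dseries_eval_def by (rule suminf_finite) (auto simp: dirichlet_polys_def)

lemma point_evaluation_poly:
  assumes a: "a \<in> dirichlet_polys" and s: "Re s > 1/2"
  shows "cmod (dseries_eval a s) \<le> point_eval_const * (Re s / (Re s - 1/2)) powr ((\<alpha> + 2) / p) * nrm a"
proof -
  define \<sigma> \<delta> where "\<sigma> = Re s" and "\<delta> = Re s - 1/2"
  have \<delta>: "\<delta> > 0" "\<sigma> = \<delta> + 1/2" and \<sigma>: "\<sigma> > 0" using s by (auto simp: \<sigma>_def \<delta>_def)
  define V where "V = cmod (dseries_eval a s)"
  define S where "S = (\<Union>n\<in>{n. a n \<noteq> 0}. prime_factors n)"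
  have S: "finite S" "\<And>q. q \<in> S \<Longrightarrow> prime q"
    using a by (auto simp: S_def dirichlet_polys_def in_prime_factors_iff)
  have le_shift: "ennreal (V powr p * (\<delta> / (2 * \<sigma>))) \<le> torus_moment p (dseries_shift \<eta> a)" if \<eta>: "0 < \<eta>" "\<eta> < \<delta> / 2" for \<eta>
  proof -
    \<comment> \<open>The polydisc point belonging to s - \<eta>. Evaluating the polynomial shifted
      by \<eta> there gives back its value at s.\<close>
    define w where "w q = of_nat q powr (- (s - of_real \<eta>))" for q :: nat
    have nw: "cmod (w q) = real q powr (- (\<sigma> - \<eta>))" if "q > 0" for q
      using that by (simp add: w_def \<sigma>_def norm_powr_real_powr)
    have e: "\<sigma> - \<eta> > 0" "2 * (\<sigma> - \<eta>) > 1" using \<eta> \<delta> by auto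
    have w: "cmod (w q) < 1" "(cmod (w q))\<^sup>2 = real q powr (- (2 * (\<sigma> - \<eta>)))" if "prime q" for q
      using powr_minus_lt_1[OF that e(1)] prime_gt_0_nat[OF that]
      by (simp_all add: nw power2_eq_square flip: powr_add)
    have "torus_poly (dseries_shift \<eta> a) w = (\<Sum>n | a n \<noteq> 0. a n * of_real (real n powr (- \<eta>)) * torus_char w n)"
      by (rule torus_poly_shift[OF a])
    also have "\<dots> = dseries_eval a s"
      unfolding dseries_eval_poly[OF a]
    proof (rule sum.cong[OF refl])
      fix n assume "n \<in> {n. a n \<noteq> 0}"
      then have n: "n > 0" using a by (auto simp: dirichlet_polys_def intro: gr0I)
      have "torus_char w n = of_nat n powr (- (s - of_real \<eta>))"
        unfolding w_def[abs_def] by (rule torus_char_powr[OF n])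
      moreover have "complex_of_real (real n powr (- \<eta>)) = of_nat n powr (- of_real \<eta>)"
        by (simp flip: powr_of_real)
      ultimately show "a n * of_real (real n powr (- \<eta>)) * torus_char w n = a n * of_nat n powr (- s)"
        by (simp add: mult.assoc flip: powr_add)
    qed
    finally have eval: "torus_poly (dseries_shift \<eta> a) w = dseries_eval a s" .
    have "ennreal (V powr p) \<le> ennreal (\<Prod>q\<in>S. 1 / (1 - (cmod (w q))\<^sup>2)) * torus_moment p (dseries_shift \<eta> a)"
      unfolding V_def eval[symmetric]
      by (rule torus_point_evaluation)
        (use S w p a in \<open>auto simp: dseries_shift_support S_def dirichlet_polys_def dseries_shift_def\<close>)
    also have "(\<Prod>q\<in>S. 1 / (1 - (cmod (w q))\<^sup>2)) = (\<Prod>q\<in>S. 1 / (1 - real q powr (- (2 * (\<sigma> - \<eta>)))))"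
      by (intro prod.cong refl) (use w S in auto)
    also have "\<dots> \<le> 1 + 1 / (2 * (\<sigma> - \<eta>) - 1)" by (rule zeta_smooth_le[OF S e(2)])
    \<comment> \<open>As \<eta> < \<delta> / 2, the denominator 2 * (\<sigma> - \<eta>) - 1 = 2 *
      \<delta> - 2 * \<eta> exceeds \<delta>.\<close>
    also have "\<dots> \<le> 1 + 1 / \<delta>" using \<eta> \<delta> by (intro add_left_mono divide_left_mono) auto
    also have "\<dots> \<le> 2 * \<sigma> / \<delta>" using \<delta> by (simp add: field_simps)
    finally have "ennreal (V powr p) \<le> ennreal (2 * \<sigma> / \<delta>) * torus_moment p (dseries_shift \<eta> a)"
      by (simp add: ennreal_leI mult_right_mono)
    then have "ennreal (\<delta> / (2 * \<sigma>)) * ennreal (V powr p) \<le>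
        (ennreal (\<delta> / (2 * \<sigma>)) * ennreal (2 * \<sigma> / \<delta>)) * torus_moment p (dseries_shift \<eta> a)"
      unfolding mult.assoc by (rule mult_left_mono) simp
    moreover have "ennreal (\<delta> / (2 * \<sigma>)) * ennreal (2 * \<sigma> / \<delta>) = 1"
      using \<delta> by (simp flip: ennreal_mult')
    moreover have "ennreal (V powr p * (\<delta> / (2 * \<sigma>))) = ennreal (\<delta> / (2 * \<sigma>)) * ennreal (V powr p)"
      by (subst mult.commute) (rule ennreal_mult', use \<delta> in simp)
    ultimately show ?thesis by simp
  qed
  have "ennreal (V powr p * (\<delta> / (2 * \<sigma>))) * emeasure (mu \<alpha>) {0<..<\<delta> / 2} \<le> Ap_moment p \<alpha> a"
    by (rule Ap_moment_ge[OF a]) (rule le_shift)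
  moreover have "ennreal (mu_const * (\<delta> / (4 * \<sigma>)) powr (\<alpha> + 1)) \<le> emeasure (mu \<alpha>) {0<..<\<delta> / 2}"
  proof (rule order_trans[OF ennreal_leI emeasure_mu_ge])
    \<comment> \<open>This quantity lies below \<delta> / 2 because \<sigma> > 1/2 and below 1
      because \<delta> < \<sigma>. It covers small and large \<sigma> at once and produces a power
      of \<sigma> / \<delta>.\<close>
    have "\<delta> / (4 * \<sigma>) \<le> min 1 (\<delta> / 2)" using \<delta> by (auto simp: field_simps)
    then show "mu_const * (\<delta> / (4 * \<sigma>)) powr (\<alpha> + 1) \<le> mu_const * min 1 (\<delta> / 2) powr (\<alpha> + 1)"
      using mu_const_pos \<alpha> \<delta> by (intro mult_left_mono powr_mono2) auto
  qed (use \<delta> in simp)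
  ultimately have "ennreal (V powr p * (\<delta> / (2 * \<sigma>))) * ennreal (mu_const * (\<delta> / (4 * \<sigma>)) powr (\<alpha> + 1)) \<le> Ap_moment p \<alpha> a"
    by (meson mult_left_mono order_trans zero_le)
  then have "ennreal (V powr p * (\<delta> / (2 * \<sigma>)) * (mu_const * (\<delta> / (4 * \<sigma>)) powr (\<alpha> + 1))) \<le> ennreal (nrm a powr p)"
    using \<delta> mu_const_pos a by (simp add: ennreal_nrm_powr flip: ennreal_mult')
  then have le: "V powr p * (\<delta> / (2 * \<sigma>)) * (mu_const * (\<delta> / (4 * \<sigma>)) powr (\<alpha> + 1)) \<le> nrm a powr p"
    by simp
  define K where "K = point_eval_const * (\<sigma> / \<delta>) powr ((\<alpha> + 2) / p)"
  have K: "K > 0" using point_eval_const_pos \<delta> by (simp add: K_def)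
  have "K powr p = 2 * 4 powr (\<alpha> + 1) / mu_const * (\<sigma> / \<delta>) powr (\<alpha> + 2)"
    using p \<delta> mu_const_pos by (simp add: K_def powr_mult powr_powr point_eval_const_def)
  also have "(\<sigma> / \<delta>) powr (\<alpha> + 2) = (\<sigma> / \<delta>) * (\<sigma> / \<delta>) powr (\<alpha> + 1)"
    using \<delta> powr_mult_base[of "\<sigma> / \<delta>" "\<alpha> + 1"] by (simp add: add.commute)
  finally have Kp: "K powr p = 2 * 4 powr (\<alpha> + 1) / mu_const * ((\<sigma> / \<delta>) * (\<sigma> / \<delta>) powr (\<alpha> + 1))" .
  have eq: "(\<delta> / (2 * \<sigma>)) * (mu_const * (\<delta> / (4 * \<sigma>)) powr (\<alpha> + 1)) = 1 / K powr p"
  proof -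
    have "(\<delta> / (4 * \<sigma>)) powr (\<alpha> + 1) = 1 / (4 powr (\<alpha> + 1) * (\<sigma> / \<delta>) powr (\<alpha> + 1))"
      using \<delta>(1) \<sigma> by (simp add: powr_divide powr_mult)
    moreover have "\<delta> / (2 * \<sigma>) * (m * (1 / (T * U))) = 1 / (2 * T / m * (\<sigma> / \<delta> * U))"
      if "m > 0" "T > 0" "U > 0" for m T U :: real
      using that \<delta> by (simp add: field_simps)
    ultimately show ?thesis unfolding Kp using \<delta> mu_const_pos by simp
  qed
  have "V powr p * (1 / K powr p) \<le> nrm a powr p" using le unfolding mult.assoc eq .
  then have "(V / K) powr p \<le> nrm a powr p" using K by (simp add: powr_divide V_def)
  then have "V / K \<le> nrm a" using K nrm_nonneg by (subst (asm) powr_le_powr_iff) (auto simp: V_def)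
  then have "V \<le> K * nrm a" using K by (simp add: field_simps)
  then show ?thesis by (simp add: K_def V_def \<sigma>_def \<delta>_def)
qed

end

section \<open>The completion\<close>

context bergman
begin

text \<open>The multiplier \<open>\<rho> ^ \<Omega>(n)\<close>, restricted to smooth \<open>n\<close>, is a contraction that is close to the
  identity on any single polynomial, and it decays fast enough to turn coefficientwise convergence
  into norm convergence.\<close>

lemma multiplier_null:
  fixes R :: "nat \<Rightarrow> dseries"
  assumes R: "\<And>j. R j \<in> dirichlet_polys" and bdd: "\<And>j. nrm (R j) \<le> M"
    and coeff: "\<And>n. (\<lambda>j. R j n) \<longlonglongrightarrow> 0"
    and S: "finite S" "\<And>q. q \<in> S \<Longrightarrow> prime q" and \<rho>: "0 < \<rho>" "\<rho> < 1"
  shows "(\<lambda>j. nrm (\<lambda>n. R j n * torus_char (\<lambda>q. of_real (if q \<in> S then \<rho> else 0)) n)) \<longlonglongrightarrow> 0"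
proof -
  define r where "r = (\<lambda>q::nat. if q \<in> S then \<rho> else 0)"
  define W where "W = torus_char (\<lambda>q. complex_of_real (r q))"
  define K where "K = Max (insert 2 S)"
  have K: "K \<ge> 2" "\<And>q. q \<in> S \<Longrightarrow> q \<le> K" using S by (auto simp: K_def)
  \<comment> \<open>Chosen so that K powr h equals \<rho> powr (- 1/2). Then \<rho> * q powr h < 1
    for all q in S, and the multiplier beats the coefficient growth n powr h. The lower bound K >= 2
    keeps the logarithm positive.\<close>
  define h where "h = - ln \<rho> / (2 * ln (real K))"
  have h: "h > 0" using K \<rho> by (auto simp: h_def field_simps)
  have small: "\<rho> * real q powr h < 1" if "q \<in> S" for q
  proof -
    have "real q powr h \<le> real K powr h" using K(2)[OF that] h by (intro powr_mono2) auto
    also have "\<dots> = exp (- ln \<rho> / 2)" using K by (simp add: powr_def h_def)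
    also have "\<dots> < exp (- ln \<rho>)" using \<rho> by simp
    also have "\<dots> = 1 / \<rho>" using \<rho> by (simp add: exp_minus field_simps)
    finally show ?thesis using \<rho> by (simp add: field_simps)
  qed
  obtain C where C: "C > 0" "\<And>a n. a \<in> dirichlet_polys \<Longrightarrow> cmod (a n) \<le> C * real n powr h * nrm a"
    using nrm_coefficient[OF h] by auto
  have M: "0 \<le> M" using bdd[of 0] nrm_nonneg[of "R 0"] by linarith
  define e where "e n = (if n \<in> smooth_numbers S then \<Prod>q\<in>S. (\<rho> * real q powr h) ^ multiplicity q n else 0)" for n
  have sum_e: "summable e"
    unfolding e_def by (rule sums_summable[OF smooth_numbers_sums(2)[OF S]])
      (use small \<rho> in \<open>auto simp: norm_power abs_mult intro!: summable_geometric\<close>)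
  have We: "real n powr h * cmod (W n) \<le> e n" for n
  proof (cases "n = 0")
    case True
    then show ?thesis by (simp add: e_def smooth_numbers_def)
  next
    case n: False
    show ?thesis
    proof (cases "n \<in> smooth_numbers S")
      case True
      have "cmod (W n) = cmod (\<Prod>q\<in>S. complex_of_real (r q) ^ multiplicity q n)"
        unfolding W_def using prod_multiplicity_smooth[OF S True] by simp
      also have "\<dots> = (\<Prod>q\<in>S. \<rho> ^ multiplicity q n)"
        using \<rho> by (auto simp: prod_norm[symmetric] norm_power r_def intro!: prod.cong)
      finally show ?thesis
        using True prod_multiplicity_smooth_powr[OF S True, of h]
        by (simp add: e_def power_mult_distrib prod.distrib mult.commute)
    next
      case False
      then obtain q where q: "q \<in> prime_factors n" "q \<notin> S" using n by (auto simp: smooth_numbers_def)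
      then have "multiplicity q n > 0" by (simp add: prime_factors_multiplicity)
      then have "W n = 0"
        unfolding W_def torus_char_def using q by (intro prod_zero) (auto simp: r_def)
      then show ?thesis using False by (simp add: e_def)
    qed
  qed
  have bound: "cmod (R j n) * cmod (W n) \<le> C * M * e n" for j n
  proof -
    have "cmod (R j n) * cmod (W n) \<le> (C * real n powr h * nrm (R j)) * cmod (W n)"
      by (intro mult_right_mono C R) simp
    also have "\<dots> = C * nrm (R j) * (real n powr h * cmod (W n))" by simp
    also have "\<dots> \<le> C * M * e n"
      using C(1) M by (intro mult_mono bdd We) (auto simp: nrm_nonneg)
    finally show ?thesis .
  qed
  \<comment> \<open>Dominated convergence for series: the majorant is a constant times
    \<open>e\<close>, the terms of a convergent Euler product over S, and it does not depend on
    j.\<close>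
  have "(\<lambda>j. \<Sum>n. cmod (R j n) * cmod (W n)) \<longlonglongrightarrow> (\<Sum>n. 0)"
  proof (rule conjunct2[OF conjunct2[OF tannerys_theorem]])
    show "(\<lambda>j. cmod (R j n) * cmod (W n)) \<longlonglongrightarrow> 0" for n
      using tendsto_mult_right[OF tendsto_norm[OF coeff[of n]], of "cmod (W n)"] by simp
    show "\<forall>\<^sub>F (n, j) in sequentially \<times>\<^sub>F sequentially. norm (cmod (R j n) * cmod (W n)) \<le> C * M * e n"
      using bound by (intro always_eventually) auto
    show "summable (\<lambda>n. C * M * e n)" by (intro summable_mult sum_e)
  qed simp
  then have lim: "(\<lambda>j. \<Sum>n. cmod (R j n) * cmod (W n)) \<longlonglongrightarrow> 0" by simp
  have "nrm (\<lambda>n. R j n * W n) \<le> (\<Sum>n. cmod (R j n) * cmod (W n))" for j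
  proof -
    have "nrm (\<lambda>n. R j n * W n) \<le> (\<Sum>n | R j n \<noteq> 0. cmod (R j n * W n))"
      by (rule nrm_le_sum) (use R[of j] in \<open>auto simp: dirichlet_polys_mult dirichlet_polys_finite\<close>)
    also have "\<dots> = (\<Sum>n. cmod (R j n) * cmod (W n))"
      using dirichlet_polys_finite[OF R[of j]]
      by (subst suminf_finite[where N = "{n. R j n \<noteq> 0}"]) (auto simp: norm_mult)
    finally show ?thesis .
  qed
  then have "(\<lambda>j. nrm (\<lambda>n. R j n * W n)) \<longlonglongrightarrow> 0"
    by (intro tendsto_sandwich[OF _ _ tendsto_const lim]) (auto simp: nrm_nonneg)
  then show ?thesis by (simp only: W_def r_def)
qed

text \<open>When S contains the primes of the support, each of the finitely many coefficients is
  multiplied by a fixed power of \<rho>, which tends to 1. The norm is bounded by the sum of the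
  coefficients.\<close>

lemma nrm_multiplier_tendsto:
  assumes a: "a \<in> dirichlet_polys" and S: "\<And>n. a n \<noteq> 0 \<Longrightarrow> prime_factors n \<subseteq> S"
  shows "((\<lambda>\<rho>. nrm (\<lambda>n. a n * torus_char (\<lambda>q. of_real (if q \<in> S then \<rho> else 0)) n)) \<longlongrightarrow> nrm a) (at_left 1)"
proof -
  define T where "T \<rho> n = a n * torus_char (\<lambda>q. of_real (if q \<in> S then \<rho> else 0)) n" for \<rho> n
  have T: "T \<rho> \<in> dirichlet_polys" for \<rho>
    unfolding T_def[abs_def] by (rule dirichlet_polys_mult[OF a])
  have "((\<lambda>\<rho>. T \<rho> n) \<longlongrightarrow> a n) (at_left 1)" for n
  proof (cases "a n = 0")
    case False
    have "T \<rho> n = a n * (\<Prod>q\<in>prime_factors n. of_real \<rho> ^ multiplicity q n)" for \<rho>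
      unfolding T_def torus_char_def using S[OF False]
      by (auto intro!: arg_cong2[where f = "(*)"] prod.cong)
    moreover have "((\<lambda>\<rho>. a n * (\<Prod>q\<in>prime_factors n. of_real \<rho> ^ multiplicity q n)) \<longlongrightarrow>
        a n * (\<Prod>q\<in>prime_factors n. of_real 1 ^ multiplicity q n)) (at_left 1)"
      by (intro tendsto_intros)
    ultimately show ?thesis by simp
  qed (simp add: T_def)
  then have "((\<lambda>\<rho>. \<Sum>n | a n \<noteq> 0. cmod (T \<rho> n - a n)) \<longlongrightarrow> (\<Sum>n | a n \<noteq> 0. cmod (a n - a n))) (at_left 1)"
    by (intro tendsto_intros)
  then have lim: "((\<lambda>\<rho>. \<Sum>n | a n \<noteq> 0. cmod (T \<rho> n - a n)) \<longlongrightarrow> 0) (at_left 1)" by simp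
  have "\<bar>nrm (T \<rho>) - nrm a\<bar> \<le> (\<Sum>n | a n \<noteq> 0. cmod (T \<rho> n - a n))" for \<rho>
    using nrm_diff_le[OF T a, of \<rho>] nrm_le_sum[OF dirichlet_polys_diff[OF T a] dirichlet_polys_finite[OF a], of \<rho>]
    by (force simp: T_def)
  then have "((\<lambda>\<rho>. nrm (T \<rho>) - nrm a) \<longlongrightarrow> 0) (at_left 1)"
    by (intro Lim_null_comparison[OF _ lim] always_eventually) auto
  then have "((\<lambda>\<rho>. nrm (T \<rho>)) \<longlongrightarrow> nrm a) (at_left 1)" using Lim_null by blast
  then show ?thesis by (simp only: T_def[abs_def])
qed

text \<open>Fix k in the tail and let S be the primes of \<open>R k\<close>. The multiplier does not
  increase the norm of R k - R j, which is below e / 2, while it sends R j to 0 in norm as j grows.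
  Hence the multiplied R k has norm at most e / 2, and \<rho> tending to 1 removes the
  multiplier.\<close>

lemma Cauchy_coefficients_null:
  fixes R :: "nat \<Rightarrow> dseries"
  assumes R: "\<And>j. R j \<in> dirichlet_polys"
    and Cauchy: "\<And>e. e > 0 \<Longrightarrow> \<exists>N. \<forall>j\<ge>N. \<forall>k\<ge>N. nrm (\<lambda>n. R j n - R k n) < e"
    and coeff: "\<And>n. (\<lambda>j. R j n) \<longlonglongrightarrow> 0"
  shows "(\<lambda>j. nrm (R j)) \<longlonglongrightarrow> 0"
proof (rule LIMSEQ_I)
  fix e :: real assume e: "e > 0"
  obtain N where N: "\<And>j k. j \<ge> N \<Longrightarrow> k \<ge> N \<Longrightarrow> nrm (\<lambda>n. R j n - R k n) < e / 2"
    using Cauchy[of "e / 2"] e by auto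
  have "nrm (R k) \<le> e / 2" if k: "k \<ge> N" for k
  proof -
    define S where "S = (\<Union>n\<in>{n. R k n \<noteq> 0}. prime_factors n)"
    have S: "finite S" "\<And>q. q \<in> S \<Longrightarrow> prime q"
      using dirichlet_polys_finite[OF R[of k]] by (auto simp: S_def in_prime_factors_iff)
    define T where "T \<rho> a n = a n * torus_char (\<lambda>q. of_real (if q \<in> S then \<rho> else 0)) n"
      for \<rho> :: real and a :: dseries and n
    have "nrm (T \<rho> (R k)) \<le> e / 2" if \<rho>: "0 < \<rho>" "\<rho> < 1" for \<rho>
    proof -
      \<comment> \<open>Dropping the first N terms makes all norms at most nrm (R k) + e / 2, the
        uniform bound under which the multiplier turns coefficient convergence into norm
        convergence.\<close>
      define R' where "R' j = R (j + N)" for j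
      have lim: "(\<lambda>j. nrm (T \<rho> (R' j))) \<longlonglongrightarrow> 0"
        unfolding T_def
      proof (rule multiplier_null[OF _ _ _ S \<rho>])
        show "R' j \<in> dirichlet_polys" for j by (simp add: R'_def R)
        show "nrm (R' j) \<le> nrm (R k) + e / 2" for j
          using nrm_diff_le[OF R R, of "j + N" k] N[of "j + N" k] k by (simp add: R'_def)
        show "(\<lambda>j. R' j n) \<longlonglongrightarrow> 0" for n
          unfolding R'_def using LIMSEQ_ignore_initial_segment[OF coeff] .
      qed
      have "nrm (T \<rho> (R k)) \<le> e / 2 + nrm (T \<rho> (R' j))" for j
      proof -
        have D: "(\<lambda>n. R k n - R' j n) \<in> dirichlet_polys" by (simp add: R'_def R dirichlet_polys_diff)
        have TD: "T \<rho> a \<in> dirichlet_polys" if "a \<in> dirichlet_polys" for a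
          unfolding T_def[abs_def] by (rule dirichlet_polys_mult[OF that])
        have "T \<rho> (R k) = (\<lambda>n. T \<rho> (\<lambda>n. R k n - R' j n) n + T \<rho> (R' j) n)"
          by (auto simp: T_def algebra_simps)
        then have "nrm (T \<rho> (R k)) \<le> nrm (T \<rho> (\<lambda>n. R k n - R' j n)) + nrm (T \<rho> (R' j))"
          using nrm_triangle[OF TD[OF D] TD] by (simp add: R'_def R)
        also have "nrm (T \<rho> (\<lambda>n. R k n - R' j n)) \<le> nrm (\<lambda>n. R k n - R' j n)"
          unfolding T_def[abs_def] by (rule nrm_multiplier_le[OF D]) (use \<rho> in auto)
        also have "\<dots> \<le> e / 2" using N[of k "j + N"] k by (simp add: R'_def)
        finally show ?thesis by simp
      qed
      then have "nrm (T \<rho> (R k)) \<le> e / 2 + 0"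
        by (intro LIMSEQ_le_const[OF tendsto_add[OF tendsto_const lim]]) auto
      then show ?thesis by simp
    qed
    then have "\<forall>\<^sub>F \<rho> in at_left 1. nrm (T \<rho> (R k)) \<le> e / 2"
      using eventually_at_left_real[of 0 1] by (auto elim!: eventually_mono)
    moreover have "((\<lambda>\<rho>. nrm (T \<rho> (R k))) \<longlongrightarrow> nrm (R k)) (at_left 1)"
      unfolding T_def[abs_def] by (rule nrm_multiplier_tendsto[OF R]) (auto simp: S_def)
    ultimately show ?thesis
      by (intro tendsto_upperbound[of _ "nrm (R k)" "at_left 1"]) auto
  qed
  then show "\<exists>N. \<forall>k\<ge>N. norm (nrm (R k) - 0) < e"
    using e nrm_nonneg by (intro exI[of _ N]) fastforce
qed

lemma Ap_represents_limit_unique: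
  assumes P: "Ap_represents p \<alpha> P f" and Q: "Ap_represents p \<alpha> Q f"
  shows "(\<lambda>k. nrm (P k) - nrm (Q k)) \<longlonglongrightarrow> 0"
proof -
  define R where "R k n = P k n - Q k n" for k n
  have pol: "P k \<in> dirichlet_polys" "Q k \<in> dirichlet_polys" for k
    using P Q by (auto simp: Ap_represents_def)
  have R: "R k \<in> dirichlet_polys" for k
    unfolding R_def[abs_def] by (intro dirichlet_polys_diff pol)
  have "(\<lambda>k. nrm (R k)) \<longlonglongrightarrow> 0"
  proof (rule Cauchy_coefficients_null[OF R])
    fix e :: real assume e: "e > 0"
    obtain N1 where N1: "\<And>j k. j \<ge> N1 \<Longrightarrow> k \<ge> N1 \<Longrightarrow> nrm (\<lambda>n. P j n - P k n) < e / 2"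
      using P e unfolding Ap_represents_def by (meson half_gt_zero)
    obtain N2 where N2: "\<And>j k. j \<ge> N2 \<Longrightarrow> k \<ge> N2 \<Longrightarrow> nrm (\<lambda>n. Q j n - Q k n) < e / 2"
      using Q e unfolding Ap_represents_def by (meson half_gt_zero)
    have "nrm (\<lambda>n. R j n - R k n) < e" if "j \<ge> max N1 N2" "k \<ge> max N1 N2" for j k
    proof -
      have "(\<lambda>n. R j n - R k n) = (\<lambda>n. (P j n - P k n) + (Q k n - Q j n))"
        by (simp add: R_def algebra_simps)
      then have "nrm (\<lambda>n. R j n - R k n) \<le> nrm (\<lambda>n. P j n - P k n) + nrm (\<lambda>n. Q k n - Q j n)"
        using nrm_triangle[OF dirichlet_polys_diff dirichlet_polys_diff] pol by simp
      then show ?thesis using N1[of j k] N2[of k j] that by auto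
    qed
    then show "\<exists>N. \<forall>j\<ge>N. \<forall>k\<ge>N. nrm (\<lambda>n. R j n - R k n) < e" by blast
  next
    fix n
    have "(\<lambda>k. P k n - Q k n) \<longlonglongrightarrow> f n - f n"
      using P Q by (intro tendsto_diff) (auto simp: Ap_represents_def)
    then show "(\<lambda>j. R j n) \<longlonglongrightarrow> 0" by (simp add: R_def)
  qed
  then show ?thesis
    by (rule Lim_null_comparison[rotated]) (use nrm_diff_le[OF pol] in \<open>auto simp: R_def[abs_def]\<close>)
qed

text \<open>Justifies the definite description in \<open>Ap_norm\<close>: the norms of a
  representing sequence form a Cauchy sequence, and two representing sequences of the same series
  share the limit.\<close>

lemma Ap_represents_Ap_norm:
  assumes P: "Ap_represents p \<alpha> P f"
  shows "(\<lambda>k. nrm (P k)) \<longlonglongrightarrow> Ap_norm p \<alpha> f"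
proof -
  have pol: "P k \<in> dirichlet_polys" for k using P by (auto simp: Ap_represents_def)
  have "Cauchy (\<lambda>k. nrm (P k))"
  proof (rule metric_CauchyI)
    fix e :: real assume "e > 0"
    then obtain N where "\<And>j k. j \<ge> N \<Longrightarrow> k \<ge> N \<Longrightarrow> nrm (\<lambda>n. P j n - P k n) < e"
      using P unfolding Ap_represents_def by meson
    then show "\<exists>M. \<forall>m\<ge>M. \<forall>n\<ge>M. dist (nrm (P m)) (nrm (P n)) < e"
      using order.strict_trans1[OF nrm_diff_le[OF pol pol]]
      by (auto simp: dist_real_def intro!: exI[of _ N])
  qed
  then obtain L where L: "(\<lambda>k. nrm (P k)) \<longlonglongrightarrow> L"
    using Cauchy_convergent convergent_def by blast
  have "Ap_norm p \<alpha> f = L"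
    unfolding Ap_norm_def
  proof (rule the_equality)
    show "\<exists>P. Ap_represents p \<alpha> P f \<and> (\<lambda>k. nrm (P k)) \<longlonglongrightarrow> L" using P L by blast
    fix L' assume "\<exists>P. Ap_represents p \<alpha> P f \<and> (\<lambda>k. nrm (P k)) \<longlonglongrightarrow> L'"
    then obtain Q where Q: "Ap_represents p \<alpha> Q f" "(\<lambda>k. nrm (Q k)) \<longlonglongrightarrow> L'" by blast
    have "L' - L = 0"
      using LIMSEQ_unique[OF tendsto_diff[OF Q(2) L] Ap_represents_limit_unique[OF Q(1) P]] .
    then show "L' = L" by simp
  qed
  with L show ?thesis by simp
qed

lemma nrm_zero: "nrm (\<lambda>n. 0) = 0"
  using nrm_le_sum[of "\<lambda>n. 0" "{}"] nrm_nonneg[of "\<lambda>n. 0"] by (simp add: dirichlet_polys_def)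

lemma Ap_poly:
  assumes "a \<in> dirichlet_polys"
  shows "a \<in> Ap p \<alpha>" "Ap_norm p \<alpha> a = nrm a"
proof -
  have *: "Ap_represents p \<alpha> (\<lambda>k. a) a"
    using assms by (auto simp: Ap_represents_def nrm_zero)
  then show "a \<in> Ap p \<alpha>" by (auto simp: Ap_def)
  show "Ap_norm p \<alpha> a = nrm a"
    using LIMSEQ_unique[OF Ap_represents_Ap_norm[OF *] tendsto_const] .
qed

section \<open>Point evaluations on the completion\<close>

text \<open>The partial sums of the absolute series of P j - P k are uniformly small; letting j
  grow, so are those of f - P k. Thus f converges absolutely at s and
  \<open>dseries_eval f s\<close> is the sum of a convergent series, not the default value of a
  divergent one.\<close>

lemma point_evaluation_tendsto:
  assumes P: "Ap_represents p \<alpha> P f" and s: "Re s > 1/2"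
  shows "(\<lambda>k. dseries_eval (P k) s) \<longlonglongrightarrow> dseries_eval f s"
proof -
  have pol: "P k \<in> dirichlet_polys" for k using P by (auto simp: Ap_represents_def)
  obtain C where C: "C > 0" "\<And>a. a \<in> dirichlet_polys \<Longrightarrow>
    (\<Sum>n | a n \<noteq> 0. cmod (a n) * real n powr (- Re s)) \<le> C * nrm a"
    using nrm_abs_convergence[OF s] by auto
  have C': "(\<Sum>n<m. cmod (a n) * real n powr (- Re s)) \<le> C * nrm a" if "a \<in> dirichlet_polys" for a m
  proof -
    have "(\<Sum>n<m. cmod (a n) * real n powr (- Re s)) = (\<Sum>n\<in>{..<m} \<inter> {n. a n \<noteq> 0}. cmod (a n) * real n powr (- Re s))"
      by (rule sum.mono_neutral_right) auto
    also have "\<dots> \<le> (\<Sum>n | a n \<noteq> 0. cmod (a n) * real n powr (- Re s))"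
      by (rule sum_mono2) (use dirichlet_polys_finite[OF that] in auto)
    finally show ?thesis using C(2)[OF that] by linarith
  qed
  have nrms: "cmod (x * of_nat n powr (- s)) = cmod x * real n powr (- Re s)" for x n
    by (cases "n = 0") (simp_all add: norm_mult norm_powr_real_powr)
  show ?thesis
  proof (rule LIMSEQ_I)
    fix e :: real assume e: "e > 0"
    then have "e / (2 * C) > 0" using C by simp
    then obtain N where N: "\<And>j k. j \<ge> N \<Longrightarrow> k \<ge> N \<Longrightarrow> nrm (\<lambda>n. P j n - P k n) < e / (2 * C)"
      using P unfolding Ap_represents_def by meson
    have "norm (dseries_eval (P k) s - dseries_eval f s) < e" if k: "k \<ge> N" for k
    proof -
      define g where "g n = (f n - P k n) * of_nat n powr (- s)" for n
      have part: "(\<Sum>n<m. cmod (g n)) \<le> e / 2" for m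
      proof -
        have "(\<lambda>j. \<Sum>n<m. cmod (P j n - P k n) * real n powr (- Re s)) \<longlonglongrightarrow>
            (\<Sum>n<m. cmod (f n - P k n) * real n powr (- Re s))"
          using P by (intro tendsto_intros) (auto simp: Ap_represents_def)
        moreover have "(\<Sum>n<m. cmod (P j n - P k n) * real n powr (- Re s)) \<le> e / 2" if "j \<ge> N" for j
        proof -
          have "(\<Sum>n<m. cmod (P j n - P k n) * real n powr (- Re s)) \<le> C * nrm (\<lambda>n. P j n - P k n)"
            by (rule C'[OF dirichlet_polys_diff[OF pol pol]])
          also have "\<dots> \<le> C * (e / (2 * C))"
            using N[OF that k] C by (intro mult_left_mono) auto
          finally show ?thesis using C by simp
        qed
        ultimately have "(\<Sum>n<m. cmod (f n - P k n) * real n powr (- Re s)) \<le> e / 2"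
          by (intro LIMSEQ_le_const2) auto
        then show ?thesis by (simp add: g_def nrms)
      qed
      have summ: "summable (\<lambda>n. cmod (g n))"
        by (rule summableI_nonneg_bounded[OF _ part]) simp
      have "(\<Sum>n. cmod (g n)) \<le> e / 2"
        by (rule suminf_le_const[OF summ part])
      then have le: "cmod (suminf g) \<le> e / 2"
        using summable_norm[OF summ] by linarith
      have "summable (\<lambda>n. P k n * of_nat n powr (- s))"
        by (rule summable_finite[OF dirichlet_polys_finite[OF pol[of k]]]) auto
      then have "(\<Sum>n. g n + P k n * of_nat n powr (- s)) = suminf g + dseries_eval (P k) s"
        unfolding dseries_eval_def
        by (rule suminf_add[symmetric, OF summable_norm_cancel[OF summ]])
      moreover have "(\<Sum>n. g n + P k n * of_nat n powr (- s)) = dseries_eval f s"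
        unfolding dseries_eval_def by (simp add: g_def algebra_simps)
      ultimately show ?thesis using le e by (simp add: norm_minus_commute)
    qed
    then show "\<exists>N. \<forall>k\<ge>N. norm (dseries_eval (P k) s - dseries_eval f s) < e" by blast
  qed
qed

lemma delta_norm_Ap_le:
  assumes s: "Re s > 1/2"
  shows "delta_norm p \<alpha> (Ap p \<alpha>) s \<le> ennreal (point_eval_const * (Re s / (Re s - 1/2)) powr ((\<alpha> + 2) / p))"
  unfolding delta_norm_def
proof (rule SUP_least, rule ennreal_leI)
  fix f assume "f \<in> {f \<in> Ap p \<alpha>. Ap_norm p \<alpha> f \<le> 1}"
  then obtain P where P: "Ap_represents p \<alpha> P f" and f: "Ap_norm p \<alpha> f \<le> 1" by (auto simp: Ap_def)
  define K where "K = point_eval_const * (Re s / (Re s - 1/2)) powr ((\<alpha> + 2) / p)"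
  have K: "K \<ge> 0" using point_eval_const_pos by (simp add: K_def)
  have pol: "P k \<in> dirichlet_polys" for k using P by (auto simp: Ap_represents_def)
  have "cmod (dseries_eval f s) \<le> K * Ap_norm p \<alpha> f"
  proof (rule LIMSEQ_le)
    show "(\<lambda>k. cmod (dseries_eval (P k) s)) \<longlonglongrightarrow> cmod (dseries_eval f s)"
      by (intro tendsto_norm point_evaluation_tendsto P s)
    show "(\<lambda>k. K * nrm (P k)) \<longlonglongrightarrow> K * Ap_norm p \<alpha> f"
      by (intro tendsto_mult_left Ap_represents_Ap_norm P)
    show "\<exists>N. \<forall>k\<ge>N. cmod (dseries_eval (P k) s) \<le> K * nrm (P k)"
      using point_evaluation_poly[OF pol s] by (auto simp: K_def)
  qed
  also have "\<dots> \<le> K" using f K by (simp add: mult_left_le)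
  finally show "cmod (dseries_eval f s) \<le> K" .
qed

lemma delta_norm_mono: "X \<subseteq> Y \<Longrightarrow> delta_norm p \<alpha> X s \<le> delta_norm p \<alpha> Y s"
  unfolding delta_norm_def by (intro SUP_subset_mono) auto

lemma delta_norm_infty_le: "delta_norm p \<alpha> (Ap_infty p \<alpha>) s \<le> delta_norm p \<alpha> (Ap p \<alpha>) s"
  by (rule delta_norm_mono) (auto simp: Ap_infty_def)

lemma delta_norm_ge:
  assumes a: "a \<in> dirichlet_polys" and B: "nrm a \<le> B" "B > 0"
    and X: "\<And>c. (\<lambda>n. a n * c) \<in> X"
  shows "ennreal (cmod (dseries_eval a s) / B) \<le> delta_norm p \<alpha> X s"
proof -
  define b where "b n = a n * of_real (1 / B)" for n
  have b: "b \<in> dirichlet_polys" unfolding b_def[abs_def] by (rule dirichlet_polys_mult[OF a])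
  have "nrm b = nrm a / B"
    unfolding b_def[abs_def] using nrm_scale[OF a, of "of_real (1 / B)"] B by (simp add: norm_divide)
  then have "Ap_norm p \<alpha> b \<le> 1" using B by (simp add: Ap_poly(2)[OF b])
  moreover have "b \<in> X" unfolding b_def[abs_def] by (rule X)
  ultimately have "ennreal (cmod (dseries_eval b s)) \<le> delta_norm p \<alpha> X s"
    unfolding delta_norm_def by (intro SUP_upper) auto
  moreover have "dseries_eval b s = dseries_eval a s / of_real B"
  proof -
    have "{n. b n \<noteq> 0} = {n. a n \<noteq> 0}" using B by (auto simp: b_def)
    then show ?thesis
      unfolding dseries_eval_poly[OF a] dseries_eval_poly[OF b]
      by (simp add: b_def sum_divide_distrib)
  qed
  ultimately show ?thesis using B by (simp add: norm_divide)
qed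

lemma delta_norm_Ap_ge:
  assumes "a \<in> dirichlet_polys" "nrm a \<le> B" "B > 0"
  shows "ennreal (cmod (dseries_eval a s) / B) \<le> delta_norm p \<alpha> (Ap p \<alpha>) s"
  by (rule delta_norm_ge[OF assms]) (intro Ap_poly dirichlet_polys_mult assms)

lemma delta_norm_Ap_infty_ge:
  assumes "a \<in> dirichlet_polys" "a 1 = 0" "nrm a \<le> B" "B > 0"
  shows "ennreal (cmod (dseries_eval a s) / B) \<le> delta_norm p \<alpha> (Ap_infty p \<alpha>) s"
  by (rule delta_norm_ge) (use assms in \<open>auto simp: Ap_infty_def intro!: Ap_poly dirichlet_polys_mult\<close>)

end

section \<open>Extremal functions\<close>

text \<open>On the circle the integrand is the Poisson kernel at cnj w divided by 1 - (cmod
  w)^2.\<close>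

lemma nn_integral_circle_inverse_square:
  assumes "cmod w < 1"
  shows "(\<integral>\<^sup>+z. ennreal (1 / (cmod (1 - w * z))\<^sup>2) \<partial>circle_measure) = ennreal (1 / (1 - (cmod w)\<^sup>2))"
proof -
  have w: "(cmod w)\<^sup>2 < 1" using assms by (simp add: power_less_one_iff)
  have "(\<integral>\<^sup>+z. ennreal (1 / (cmod (1 - w * z))\<^sup>2) \<partial>circle_measure) =
      (\<integral>\<^sup>+z. ennreal (1 / (1 - (cmod w)\<^sup>2)) * ennreal (poisson (cnj w) z) \<partial>circle_measure)"
  proof (intro nn_integral_cong_AE, use AE_circle_measure in eventually_elim)
    fix z :: complex assume z: "cmod z = 1"
    then have "z * cnj z = 1" using complex_norm_square[of z] by simp
    then have "1 - w * z = z * cnj (z - cnj w)" by (simp add: algebra_simps)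
    then have "cmod (1 - w * z) = cmod (z - cnj w)" using z by (metis complex_mod_cnj mult.left_neutral norm_mult)
    then show "ennreal (1 / (cmod (1 - w * z))\<^sup>2) = ennreal (1 / (1 - (cmod w)\<^sup>2)) * ennreal (poisson (cnj w) z)"
      using w by (simp add: poisson_def flip: ennreal_mult')
  qed
  also have "\<dots> = ennreal (1 / (1 - (cmod w)\<^sup>2))"
    using assms by (subst nn_integral_cmult) (auto simp: nn_integral_poisson)
  finally show ?thesis .
qed

text \<open>The coordinates are independent, so the integral of the product is the product of the
  circle integrals; resampling carries this out one prime at a time.\<close>

lemma nn_integral_torus_inverse_square:
  assumes "finite S" "\<And>q. q \<in> S \<Longrightarrow> prime q" "\<And>q. q \<in> S \<Longrightarrow> cmod (w q) < 1"
  shows "(\<integral>\<^sup>+\<xi>. ennreal (\<Prod>q\<in>S. 1 / (cmod (1 - w q * \<xi> q))\<^sup>2) \<partial>torus_measure) =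
    ennreal (\<Prod>q\<in>S. 1 / (1 - (cmod (w q))\<^sup>2))"
  using assms
proof (induction S rule: finite_induct)
  case empty
  then show ?case by (simp add: torus.emeasure_space_1)
next
  case (insert q S)
  define G where "G S \<xi> = ennreal (\<Prod>q\<in>S. 1 / (cmod (1 - w q * \<xi> q))\<^sup>2)" for S and \<xi> :: "nat \<Rightarrow> complex"
  have meas: "G S' \<in> borel_measurable torus_measure" if "S' \<subseteq> insert q S" for S'
  proof -
    have [measurable]: "(\<lambda>\<xi>. \<xi> s) \<in> borel_measurable torus_measure" if "s \<in> S'" for s
      using torus_component_measurable insert.prems(1) \<open>S' \<subseteq> insert q S\<close> that by blast
    show ?thesis unfolding G_def by measurable
  qed
  have q: "prime q" "cmod (w q) < 1" using insert by auto
  have upd: "G (insert q S) (\<xi>(q := z)) = ennreal (1 / (cmod (1 - w q * z))\<^sup>2) * G S \<xi>" for \<xi> z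
  proof -
    have "(\<Prod>s\<in>S. 1 / (cmod (1 - w s * (\<xi>(q := z)) s))\<^sup>2) = (\<Prod>s\<in>S. 1 / (cmod (1 - w s * \<xi> s))\<^sup>2)"
      using insert(2) by (intro prod.cong) auto
    then have "(\<Prod>s\<in>insert q S. 1 / (cmod (1 - w s * (\<xi>(q := z)) s))\<^sup>2) =
        1 / (cmod (1 - w q * z))\<^sup>2 * (\<Prod>s\<in>S. 1 / (cmod (1 - w s * \<xi> s))\<^sup>2)"
      using insert(1,2) by (subst prod.insert) auto
    then show ?thesis unfolding G_def by (simp only:) (rule ennreal_mult', simp)
  qed
  have "(\<integral>\<^sup>+\<xi>. G (insert q S) \<xi> \<partial>torus_measure) =
      (\<integral>\<^sup>+\<xi>. \<integral>\<^sup>+z. ennreal (1 / (cmod (1 - w q * z))\<^sup>2) * G S \<xi> \<partial>circle_measure \<partial>torus_measure)"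
    unfolding upd[symmetric] by (rule nn_integral_torus_resample) (use q meas in auto)
  also have "\<dots> = (\<integral>\<^sup>+\<xi>. ennreal (1 / (1 - (cmod (w q))\<^sup>2)) * G S \<xi> \<partial>torus_measure)"
    by (intro nn_integral_cong) (simp add: nn_integral_multc nn_integral_circle_inverse_square[OF q(2)])
  also have "\<dots> = ennreal (1 / (1 - (cmod (w q))\<^sup>2)) * (\<integral>\<^sup>+\<xi>. G S \<xi> \<partial>torus_measure)"
    by (rule nn_integral_cmult) (use meas in auto)
  also have "(\<integral>\<^sup>+\<xi>. G S \<xi> \<partial>torus_measure) = ennreal (\<Prod>q\<in>S. 1 / (1 - (cmod (w q))\<^sup>2))"
    unfolding G_def by (rule insert.IH) (use insert in auto)
  also have "ennreal (1 / (1 - (cmod (w q))\<^sup>2)) * \<dots> = ennreal (\<Prod>q\<in>insert q S. 1 / (1 - (cmod (w q))\<^sup>2))"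
    using insert(1,2) q by (subst prod.insert) (auto simp: power_le_one simp flip: ennreal_mult')
  finally show ?case by (simp add: G_def)
qed

lemma higher_deriv_exp_times: "(deriv ^^ m) (\<lambda>z. exp (c * z)) = (\<lambda>z. c ^ m * exp (c * z :: complex))"
proof (induction m)
  case (Suc m)
  have "deriv (\<lambda>z. c ^ m * exp (c * z)) z = c ^ Suc m * exp (c * z)" for z
    by (rule DERIV_imp_deriv) (auto intro!: derivative_eq_intros)
  with Suc show ?case by auto
qed auto

text \<open>On the circle cnj z^m = z^(-m), so the integral is the m-th Taylor coefficient of the
  exponential. With c = - r * ln n it produces the factor (ln n)^m of an m-fold differentiated
  Dirichlet series.\<close>

lemma circle_integral_exp:
  "(LINT z|circle_measure. cnj z ^ m * exp (c * z)) = c ^ m / fact m"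
proof -
  have "((\<lambda>u. exp (c * u) / (u - 0) ^ Suc m) has_contour_integral
      (2 * pi * \<i>) / fact m * (deriv ^^ m) (\<lambda>z. exp (c * z)) 0) (circlepath 0 1)"
    by (rule Cauchy_has_contour_integral_higher_derivative_circlepath)
      (auto intro!: continuous_intros holomorphic_intros)
  then have "(LINT z|circle_measure. indicator (sphere 0 1) z *\<^sub>R (z * (exp (c * z) / z ^ Suc m))) =
      ((2 * pi * \<i>) / fact m * c ^ m) / (2 * pi * \<i>)"
    by (intro circle_integral_eq_contour_integral) (auto simp: higher_deriv_exp_times intro!: continuous_intros)
  also have "\<dots> = c ^ m / fact m" by simp
  finally have "(LINT z|circle_measure. indicator (sphere 0 1) z *\<^sub>R (z * (exp (c * z) / z ^ Suc m))) = c ^ m / fact m" .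
  moreover have "(LINT z|circle_measure. indicator (sphere 0 1) z *\<^sub>R (z * (exp (c * z) / z ^ Suc m))) =
      (LINT z|circle_measure. cnj z ^ m * exp (c * z))"
  proof (rule integral_cong_AE)
    show "(\<lambda>z. indicator (sphere 0 1) z *\<^sub>R (z * (exp (c * z) / z ^ Suc m))) \<in> borel_measurable circle_measure"
    proof -
      have "(\<lambda>z. indicator (sphere 0 1) z *\<^sub>R (z * (exp (c * z) / z ^ Suc m))) \<in> borel_measurable borel"
        by (rule continuous_on_sphere_measurable) (intro continuous_intros, auto)
      then show ?thesis using measurable_cong_sets[OF sets_circle_measure refl] by blast
    qed
    show "(\<lambda>z. cnj z ^ m * exp (c * z)) \<in> borel_measurable circle_measure"
      by (intro borel_measurable_integrable circle_integrable_continuous continuous_intros)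
    show "AE z in circle_measure. indicator (sphere 0 1) z *\<^sub>R (z * (exp (c * z) / z ^ Suc m)) = cnj z ^ m * exp (c * z)"
      using AE_circle_measure
    proof eventually_elim
      fix z :: complex assume z: "cmod z = 1"
      then have "z * cnj z = 1" using complex_norm_square[of z] by simp
      moreover have "z \<noteq> 0" using z by auto
      ultimately have "cnj z = 1 / z" by (simp add: eq_divide_eq mult.commute)
      then show "indicator (sphere 0 1) z *\<^sub>R (z * (exp (c * z) / z ^ Suc m)) = cnj z ^ m * exp (c * z)"
        using z by (auto simp: power_one_over field_simps)
    qed
  qed
  ultimately show ?thesis by simp
qed

section \<open>Finite Euler products with exponent 2 / p\<close>

locale extremal = bergman +
  fixes S :: "nat set" and m :: nat
  assumes S: "finite S" "\<And>q. q \<in> S \<Longrightarrow> prime q" and m: "m \<ge> 1" "real m > \<alpha>"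
begin

text \<open>With this exponent the p-th power of the modulus of an Euler factor is cmod (1 - w) powr
  (-2) whatever p is, and this has an explicit mean on the circle.\<close>

definition \<beta> :: real where "\<beta> = 2 / p"

text \<open>The Taylor coefficients of (1 - z) powr (- \<beta>). Their nonnegativity allows termwise
  comparison in the lower bound.\<close>

definition negbin :: "nat \<Rightarrow> real" where "negbin k = pochhammer \<beta> k / fact k"

text \<open>The Dirichlet coefficients of the Euler product \<open>\<Prod>q\<in>S. (1 - q powr (- s)) powr (- \<beta>)\<close>.\<close>

definition smooth_negbin :: "nat \<Rightarrow> real" where
  "smooth_negbin n = (if n \<in> smooth_numbers S then \<Prod>q\<in>S. negbin (multiplicity q n) else 0)"

lemma \<beta>_pos: "\<beta> > 0" using p by (simp add: \<beta>_def)

lemma negbin_nonneg: "negbin k \<ge> 0"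
  using \<beta>_pos by (simp add: negbin_def pochhammer_nonneg)

lemma smooth_negbin_nonneg: "smooth_negbin n \<ge> 0"
  by (auto simp: smooth_negbin_def negbin_nonneg intro!: prod_nonneg)

lemma smooth_negbin_0 [simp]: "smooth_negbin 0 = 0"
  by (simp add: smooth_negbin_def smooth_numbers_def)

lemma negbin_sums:
  assumes "cmod z < 1"
  shows "(\<lambda>k. of_real (negbin k) * z ^ k) sums (1 - z) powr (- of_real \<beta>)"
proof -
  have "(- of_real \<beta> gchoose k) * (- z) ^ k = of_real (negbin k) * z ^ k" for k
  proof -
    have "(- of_real \<beta> gchoose k) * (- z) ^ k = ((- 1) ^ k * (- 1) ^ k) * (pochhammer (of_real \<beta>) k / fact k * z ^ k)"
      by (simp add: gbinomial_pochhammer power_minus[of z] mult_ac)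
    also have "(- 1) ^ k * (- 1) ^ k = (1::complex)" by (simp flip: power_mult_distrib)
    finally show ?thesis by (simp add: negbin_def pochhammer_of_real)
  qed
  then show ?thesis using gen_binomial_complex[of "- z" "- of_real \<beta>"] assms by simp
qed

lemma negbin_abs_summable:
  assumes "cmod z < 1"
  shows "summable (\<lambda>k. norm (of_real (negbin k) * z ^ k))"
proof -
  have "summable (\<lambda>k. complex_of_real (negbin k * cmod z ^ k))"
    using sums_summable[OF negbin_sums[of "of_real (cmod z)"]] assms by simp
  then have "summable (\<lambda>k. negbin k * cmod z ^ k)" by (simp only: summable_complex_of_real)
  then show ?thesis by (simp add: norm_mult norm_power negbin_nonneg)
qed

lemma smooth_negbin_sums:
  assumes w: "\<And>q. q \<in> S \<Longrightarrow> cmod (w q) < 1"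
  shows "summable (\<lambda>n. norm (of_real (smooth_negbin n) * torus_char w n))"
    and "(\<lambda>n. of_real (smooth_negbin n) * torus_char w n) sums (\<Prod>q\<in>S. (1 - w q) powr (- of_real \<beta>))"
proof -
  define c where "c q k = complex_of_real (negbin k) * w q ^ k" for q k
  have eq: "(if n \<in> smooth_numbers S then \<Prod>q\<in>S. c q (multiplicity q n) else 0) =
      of_real (smooth_negbin n) * torus_char w n" for n
    by (auto simp: c_def smooth_negbin_def prod.distrib prod_multiplicity_smooth[OF S])
  have c: "summable (\<lambda>k. norm (c q k))" "(\<Sum>k. c q k) = (1 - w q) powr (- of_real \<beta>)" if "q \<in> S" for q
    unfolding c_def using negbin_abs_summable[OF w[OF that]] negbin_sums[OF w[OF that]] sums_unique by metis+
  have *: "summable (\<lambda>n. norm (if n \<in> smooth_numbers S then \<Prod>q\<in>S. c q (multiplicity q n) else 0))"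
    "(\<lambda>n. if n \<in> smooth_numbers S then \<Prod>q\<in>S. c q (multiplicity q n) else 0) sums (\<Prod>q\<in>S. \<Sum>k. c q k)"
    by (rule smooth_numbers_sums[OF S c(1)]; assumption)+
  show "summable (\<lambda>n. norm (of_real (smooth_negbin n) * torus_char w n))" using *(1) by (simp only: eq)
  show "(\<lambda>n. of_real (smooth_negbin n) * torus_char w n) sums (\<Prod>q\<in>S. (1 - w q) powr (- of_real \<beta>))"
    using *(2) c(2) by (simp only: eq) simp
qed

lemma smooth_negbin_powr_sums:
  assumes y: "y > 0"
  shows "(\<lambda>n. smooth_negbin n * real n powr (- y)) sums (\<Prod>q\<in>S. 1 / (1 - real q powr (- y))) powr \<beta>"
proof -
  define w where "w q = of_nat q powr (- complex_of_real y)" for q :: nat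
  have w: "w q = of_real (real q powr (- y))" for q
    unfolding w_def by (simp flip: powr_of_real of_real_minus)
  have lt: "real q powr (- y) < 1" if "q \<in> S" for q using powr_minus_lt_1[OF S(2)[OF that] y] .
  have "(\<lambda>n. of_real (smooth_negbin n) * torus_char w n) sums (\<Prod>q\<in>S. (1 - w q) powr (- of_real \<beta>))"
    by (rule smooth_negbin_sums) (use lt in \<open>auto simp: w\<close>)
  also have "(\<lambda>n. of_real (smooth_negbin n) * torus_char w n) = (\<lambda>n. complex_of_real (smooth_negbin n * real n powr (- y)))"
  proof
    fix n show "of_real (smooth_negbin n) * torus_char w n = complex_of_real (smooth_negbin n * real n powr (- y))"
    proof (cases "n = 0")
      case False
      then have "torus_char w n = of_nat n powr (- complex_of_real y)"
        unfolding w_def[abs_def] by (intro torus_char_powr) simp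
      then show ?thesis by (simp flip: powr_of_real of_real_minus)
    qed simp
  qed
  also have "(\<Prod>q\<in>S. (1 - w q) powr (- of_real \<beta>)) = of_real ((\<Prod>q\<in>S. 1 / (1 - real q powr (- y))) powr \<beta>)"
  proof -
    have "(1 - w q) powr (- of_real \<beta>) = of_real ((1 / (1 - real q powr (- y))) powr \<beta>)" if "q \<in> S" for q
    proof -
      have "(1 - w q) powr (- of_real \<beta>) = of_real (1 - real q powr (- y)) powr of_real (- \<beta>)"
        by (simp add: w)
      also have "\<dots> = of_real ((1 - real q powr (- y)) powr (- \<beta>))"
        using lt[OF that] by (subst powr_of_real) auto
      finally show ?thesis using lt[OF that] by (simp add: powr_minus_divide powr_divide)
    qed
    moreover have "(\<Prod>q\<in>S. 1 / (1 - real q powr (- y))) powr \<beta> = (\<Prod>q\<in>S. (1 / (1 - real q powr (- y))) powr \<beta>)"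
      by (rule prod_powr_distrib)
    ultimately show ?thesis by simp
  qed
  finally show ?thesis by (simp only: sums_of_real_iff)
qed

text \<open>Half of the exponent y pays for the logarithms: with e = y / (2 * m), ln n <= n powr e /
  e, whose m-th power is a multiple of n powr (y / 2).\<close>

lemma smooth_negbin_ln_summable:
  assumes y: "y > 0"
  shows "summable (\<lambda>n. smooth_negbin n * ln (real n) ^ m * real n powr (- y))"
proof (rule summable_comparison_test')
  define e where "e = y / (2 * real m)"
  have e: "e > 0" "e * real m = y / 2" using y m by (auto simp: e_def)
  show "summable (\<lambda>n. (1 / e) ^ m * (smooth_negbin n * real n powr (- (y / 2))))"
    using smooth_negbin_powr_sums[of "y / 2"] y by (intro summable_mult) (auto dest: sums_summable)
  fix n :: nat assume "n \<ge> 0"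
  show "norm (smooth_negbin n * ln (real n) ^ m * real n powr (- y)) \<le> (1 / e) ^ m * (smooth_negbin n * real n powr (- (y / 2)))"
  proof (cases "n = 0")
    case False
    then have n: "real n \<ge> 1" by simp
    have "ln (real n) \<le> real n powr e / e" by (rule ln_powr_bound[OF n e(1)])
    then have "ln (real n) ^ m \<le> (real n powr e / e) ^ m" using n by (intro power_mono) auto
    also have "\<dots> = (1 / e) ^ m * real n powr (y / 2)"
      unfolding e(2)[symmetric] using n e(1) by (simp add: power_divide power_one_over powr_realpow[symmetric] powr_powr field_simps)
    finally have "ln (real n) ^ m * real n powr (- y) \<le> (1 / e) ^ m * real n powr (y / 2) * real n powr (- y)"
      by (rule mult_right_mono) simp
    also have "\<dots> = (1 / e) ^ m * real n powr (- (y / 2))"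
      by (simp add: mult.assoc flip: powr_add)
    finally have "smooth_negbin n * (ln (real n) ^ m * real n powr (- y)) \<le> smooth_negbin n * ((1 / e) ^ m * real n powr (- (y / 2)))"
      by (intro mult_left_mono smooth_negbin_nonneg)
    then show ?thesis using n smooth_negbin_nonneg[of n] by (simp add: abs_mult mult_ac)
  qed simp
qed

text \<open>Rankin's trick. Where ln n < L, n powr (- x) is at most exp ((y - x) * L) * n powr (-
  y), so after subtracting the series at y these terms contribute nothing positive. The remaining
  terms satisfy ln n >= L, so L^m may be replaced by (ln n)^m. No derivative of the Euler product
  has to be computed.\<close>

lemma smooth_negbin_ln_suminf_ge:
  assumes x: "0 < x" "x < y" and L: "0 \<le> L"
  shows "(\<Sum>n. smooth_negbin n * ln (real n) ^ m * real n powr (- x)) \<ge>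
    L ^ m * ((\<Prod>q\<in>S. 1 / (1 - real q powr (- x))) powr \<beta> - exp ((y - x) * L) * (\<Prod>q\<in>S. 1 / (1 - real q powr (- y))) powr \<beta>)"
proof -
  define G where "G z = (\<Prod>q\<in>S. 1 / (1 - real q powr (- z))) powr \<beta>" for z
  have G: "(\<lambda>n. smooth_negbin n * real n powr (- z)) sums G z" if "z > 0" for z
    unfolding G_def by (rule smooth_negbin_powr_sums[OF that])
  have "(\<lambda>n. L ^ m * (smooth_negbin n * real n powr (- x) - exp ((y - x) * L) * (smooth_negbin n * real n powr (- y)))) sums
      (L ^ m * (G x - exp ((y - x) * L) * G y))"
    using x by (intro sums_mult sums_diff G) auto
  moreover have "(\<lambda>n. smooth_negbin n * ln (real n) ^ m * real n powr (- x)) sums (\<Sum>n. smooth_negbin n * ln (real n) ^ m * real n powr (- x))"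
    using smooth_negbin_ln_summable[OF x(1)] by (rule summable_sums)
  moreover have "L ^ m * (smooth_negbin n * real n powr (- x) - exp ((y - x) * L) * (smooth_negbin n * real n powr (- y))) \<le>
      smooth_negbin n * ln (real n) ^ m * real n powr (- x)" for n
  proof (cases "n = 0")
    case False
    then have n: "real n \<ge> 1" by simp
    show ?thesis
    proof (cases "L \<le> ln (real n)")
      case True
      have "L ^ m * (smooth_negbin n * real n powr (- x) - exp ((y - x) * L) * (smooth_negbin n * real n powr (- y))) \<le> L ^ m * (smooth_negbin n * real n powr (- x))"
        using L smooth_negbin_nonneg[of n] by (intro mult_left_mono) auto
      also have "\<dots> \<le> ln (real n) ^ m * (smooth_negbin n * real n powr (- x))"
        using L True smooth_negbin_nonneg[of n] by (intro mult_right_mono power_mono) auto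
      finally show ?thesis by (simp add: mult_ac)
    next
      case False
      have "real n powr (- x) = real n powr (y - x) * real n powr (- y)" by (simp flip: powr_add)
      also have "real n powr (y - x) \<le> exp ((y - x) * L)"
        using n False x by (simp add: powr_def)
      finally have "real n powr (- x) \<le> exp ((y - x) * L) * real n powr (- y)"
        by (simp add: mult_right_mono)
      then have "smooth_negbin n * real n powr (- x) \<le> smooth_negbin n * (exp ((y - x) * L) * real n powr (- y))"
        by (rule mult_left_mono[OF _ smooth_negbin_nonneg])
      then have "L ^ m * (smooth_negbin n * real n powr (- x) - exp ((y - x) * L) * (smooth_negbin n * real n powr (- y))) \<le> 0"
        using L by (intro mult_nonneg_nonpos) (auto simp: mult_ac)
      also have "0 \<le> smooth_negbin n * ln (real n) ^ m * real n powr (- x)"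
        using n smooth_negbin_nonneg[of n] by simp
      finally show ?thesis .
    qed
  qed simp
  ultimately show ?thesis unfolding G_def by (rule sums_le[rotated 1]) 
qed

end

section \<open>Averaging the Hardy norm bounds over the shift\<close>

context bergman
begin

text \<open>The density constant of \<open>mu \<alpha>\<close> times 2, multiplied by the sum of the
  contributions of shifts below and above \<delta>, which are 1 / (\<alpha> + 1) and 1 / (m * p -
  \<alpha>) in units of \<delta> powr (\<alpha> - m * p).\<close>

definition kernel_const :: "nat \<Rightarrow> real" where
  "kernel_const m = 2 * (2 powr (\<alpha> + 1) / Gamma (\<alpha> + 1)) * (1 / (\<alpha> + 1) + 1 / (real m * p - \<alpha>))"

lemma nn_integral_mu_kernel_le:
  assumes \<delta>: "0 < \<delta>" "\<delta> \<le> 1" and m: "real m * p > \<alpha>"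
  shows "(\<integral>\<^sup>+\<eta>. ennreal ((\<delta> + \<eta>) powr (- (real m * p)) * (1 + 1 / (\<delta> + \<eta>))) \<partial>mu \<alpha>) \<le>
    ennreal (kernel_const m * \<delta> powr (\<alpha> - real m * p))"
proof -
  define k where "k = 2 powr (\<alpha> + 1) / Gamma (\<alpha> + 1)"
  define M where "M = real m * p"
  have k: "k \<ge> 0" using mu_density_nonneg by (simp add: k_def)
  have M: "M \<ge> 0" "M > \<alpha>" using m p by (auto simp: M_def)
  \<comment> \<open>For \<eta> <= \<delta> the sum \<delta> + \<eta> is replaced by \<delta>, beyond
    that by \<eta>. \<open>A\<close> is integrable at 0 because \<alpha> > -1, and \<open>B\<close>
    at infinity because M > \<alpha>.\<close>
  define A where "A \<eta> = \<delta> powr (- M - 1) * (indicator {0..\<delta>} \<eta> * \<eta> powr \<alpha>)" for \<eta>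
  define B where "B \<eta> = indicator {\<delta>..} \<eta> * \<eta> powr (\<alpha> - M - 1)" for \<eta> :: real
  have [measurable]: "A \<in> borel_measurable borel" "B \<in> borel_measurable borel"
    unfolding A_def[abs_def] B_def[abs_def] by measurable
  have AB: "0 \<le> A \<eta>" "0 \<le> B \<eta>" for \<eta> by (auto simp: A_def B_def indicator_def)
  have "((\<lambda>\<eta>. if \<eta> \<in> {0..\<delta>} then \<eta> powr \<alpha> else 0) has_integral (\<delta> powr (\<alpha> + 1) / (\<alpha> + 1))) UNIV"
    using has_integral_powr_from_0[OF \<alpha>, of \<delta>] \<delta> by (simp only: has_integral_restrict_UNIV)
  moreover have "(\<lambda>\<eta>. indicator {0..\<delta>} \<eta> * \<eta> powr \<alpha>) = (\<lambda>\<eta>. if \<eta> \<in> {0..\<delta>} then \<eta> powr \<alpha> else 0)"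
    by (auto simp: indicator_def)
  ultimately have "(A has_integral (\<delta> powr (- M - 1) * (\<delta> powr (\<alpha> + 1) / (\<alpha> + 1)))) UNIV"
    unfolding A_def[abs_def] by (intro has_integral_mult_right) simp
  then have A: "(\<integral>\<^sup>+\<eta>. ennreal (A \<eta>) \<partial>lborel) = ennreal (\<delta> powr (- M - 1) * (\<delta> powr (\<alpha> + 1) / (\<alpha> + 1)))"
    by (rule nn_integral_has_integral_lborel[rotated 2]) (auto simp: AB)
  have "((\<lambda>\<eta>. if \<eta> \<in> {\<delta>..} then \<eta> powr (\<alpha> - M - 1) else 0) has_integral
      (- (\<delta> powr (\<alpha> - M - 1 + 1)) / (\<alpha> - M - 1 + 1))) UNIV"
    using has_integral_powr_to_inf[of "\<alpha> - M - 1" \<delta>] \<delta> M by (simp only: has_integral_restrict_UNIV)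
  moreover have "B = (\<lambda>\<eta>. if \<eta> \<in> {\<delta>..} then \<eta> powr (\<alpha> - M - 1) else 0)"
    by (auto simp: B_def indicator_def)
  moreover have "- (\<delta> powr (\<alpha> - M - 1 + 1)) / (\<alpha> - M - 1 + 1) = \<delta> powr (\<alpha> - M) / (M - \<alpha>)"
    using M by (simp add: field_simps)
  ultimately have "(B has_integral (\<delta> powr (\<alpha> - M) / (M - \<alpha>))) UNIV" by simp
  then have B: "(\<integral>\<^sup>+\<eta>. ennreal (B \<eta>) \<partial>lborel) = ennreal (\<delta> powr (\<alpha> - M) / (M - \<alpha>))"
    by (rule nn_integral_has_integral_lborel[rotated 2]) (auto simp: AB)
  have "(\<integral>\<^sup>+\<eta>. ennreal ((\<delta> + \<eta>) powr (- M) * (1 + 1 / (\<delta> + \<eta>))) \<partial>mu \<alpha>) =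
      (\<integral>\<^sup>+\<eta>. ennreal (k * \<eta> powr \<alpha> * exp (- 2 * \<eta>) * indicator {0<..} \<eta>) *
        ennreal ((\<delta> + \<eta>) powr (- M) * (1 + 1 / (\<delta> + \<eta>))) \<partial>lborel)"
    unfolding mu_def by (subst nn_integral_density) (auto simp: k_def)
  also have "\<dots> \<le> (\<integral>\<^sup>+\<eta>. ennreal (2 * k) * (ennreal (A \<eta>) + ennreal (B \<eta>)) \<partial>lborel)"
  proof (rule nn_integral_mono)
    fix \<eta> :: real
    show "ennreal (k * \<eta> powr \<alpha> * exp (- 2 * \<eta>) * indicator {0<..} \<eta>) *
        ennreal ((\<delta> + \<eta>) powr (- M) * (1 + 1 / (\<delta> + \<eta>))) \<le> ennreal (2 * k) * (ennreal (A \<eta>) + ennreal (B \<eta>))"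
    proof (cases "\<eta> > 0")
      case \<eta>: True
      \<comment> \<open>The exponential of the density absorbs the summand 1, so only the pole 1 /
        (\<delta> + \<eta>) survives; here \<delta> <= 1 enters.\<close>
      have e: "exp (- 2 * \<eta>) * (1 + 1 / (\<delta> + \<eta>)) \<le> 2 / (\<delta> + \<eta>)"
      proof -
        have "1 + \<delta> + \<eta> \<le> 2 * (1 + 2 * \<eta>)" using \<delta> \<eta> by simp
        also have "\<dots> \<le> 2 * exp (2 * \<eta>)" by (intro mult_left_mono exp_ge_add_one_self) simp
        finally have "exp (- 2 * \<eta>) * (1 + \<delta> + \<eta>) \<le> 2"
          by (simp add: exp_minus field_simps)
        moreover have "1 + 1 / (\<delta> + \<eta>) = (1 + \<delta> + \<eta>) / (\<delta> + \<eta>)" using \<delta> \<eta> by (simp add: field_simps)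
        ultimately show ?thesis using \<delta> \<eta> by (simp add: divide_right_mono)
      qed
      have "\<eta> powr \<alpha> * (\<delta> + \<eta>) powr (- M - 1) \<le> A \<eta> + B \<eta>"
      proof (cases "\<eta> \<le> \<delta>")
        case True
        have "(\<delta> + \<eta>) powr (- M - 1) \<le> \<delta> powr (- M - 1)"
          using \<delta> \<eta> M by (intro powr_mono2') auto
        then have "\<eta> powr \<alpha> * (\<delta> + \<eta>) powr (- M - 1) \<le> A \<eta>"
          using True \<eta> by (simp add: A_def mult.commute mult_left_mono)
        then show ?thesis using AB(2)[of \<eta>] by simp
      next
        case False
        have "(\<delta> + \<eta>) powr (- M - 1) \<le> \<eta> powr (- M - 1)"
          using \<delta> \<eta> M by (intro powr_mono2') auto
        then have "\<eta> powr \<alpha> * (\<delta> + \<eta>) powr (- M - 1) \<le> \<eta> powr \<alpha> * \<eta> powr (- M - 1)"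
          by (rule mult_left_mono) simp
        also have "\<dots> = B \<eta>" using False by (simp add: B_def algebra_simps flip: powr_add)
        finally show ?thesis using AB(1)[of \<eta>] by simp
      qed
      then have *: "2 * k * (\<eta> powr \<alpha> * (\<delta> + \<eta>) powr (- M - 1)) \<le> 2 * k * (A \<eta> + B \<eta>)"
        using k by (intro mult_left_mono) auto
      have "(\<delta> + \<eta>) powr (- M - 1) = (\<delta> + \<eta>) powr (- M) / (\<delta> + \<eta>)"
        using \<delta> \<eta> by (simp add: powr_diff)
      then have "k * \<eta> powr \<alpha> * exp (- 2 * \<eta>) * ((\<delta> + \<eta>) powr (- M) * (1 + 1 / (\<delta> + \<eta>))) =
          k * \<eta> powr \<alpha> * (\<delta> + \<eta>) powr (- M) * (exp (- 2 * \<eta>) * (1 + 1 / (\<delta> + \<eta>)))" by simp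
      also have "\<dots> \<le> k * \<eta> powr \<alpha> * (\<delta> + \<eta>) powr (- M) * (2 / (\<delta> + \<eta>))"
        using k by (intro mult_left_mono e) auto
      also have "\<dots> = 2 * k * (\<eta> powr \<alpha> * (\<delta> + \<eta>) powr (- M - 1))"
        using \<delta> \<eta> by (simp add: powr_diff)
      also note *
      finally have "ennreal (k * \<eta> powr \<alpha> * exp (- 2 * \<eta>) * ((\<delta> + \<eta>) powr (- M) * (1 + 1 / (\<delta> + \<eta>)))) \<le>
          ennreal (2 * k * (A \<eta> + B \<eta>))" by (rule ennreal_leI)
      then show ?thesis using \<eta> k AB[of \<eta>] \<delta> by (simp add: ennreal_mult')
    qed simp
  qed
  also have "\<dots> = ennreal (2 * k) * (ennreal (\<delta> powr (- M - 1) * (\<delta> powr (\<alpha> + 1) / (\<alpha> + 1))) + ennreal (\<delta> powr (\<alpha> - M) / (M - \<alpha>)))"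
    by (subst nn_integral_cmult, simp, subst nn_integral_add) (auto simp: A B)
  also have "\<delta> powr (- M - 1) * (\<delta> powr (\<alpha> + 1) / (\<alpha> + 1)) = \<delta> powr (\<alpha> - M) / (\<alpha> + 1)"
    by (simp flip: powr_add)
  also have "ennreal (2 * k) * (ennreal (\<delta> powr (\<alpha> - M) / (\<alpha> + 1)) + ennreal (\<delta> powr (\<alpha> - M) / (M - \<alpha>))) =
      ennreal (2 * k * (\<delta> powr (\<alpha> - M) / (\<alpha> + 1) + \<delta> powr (\<alpha> - M) / (M - \<alpha>)))"
    using k M \<alpha> by (simp add: ennreal_mult')
  also have "2 * k * (\<delta> powr (\<alpha> - M) / (\<alpha> + 1) + \<delta> powr (\<alpha> - M) / (M - \<alpha>)) = kernel_const m * \<delta> powr (\<alpha> - M)"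
    unfolding kernel_const_def k_def[symmetric] M_def[symmetric] by (simp add: algebra_simps)
  finally show ?thesis by (simp add: M_def)
qed

end

section \<open>Hardy norms of the differentiated Euler product\<close>

context extremal
begin

lemma \<beta>_times_p: "\<beta> * p = 2"
  using p by (simp add: \<beta>_def)

lemma of_nat_powr_exp:
  fixes z :: complex
  assumes "n > 0"
  shows "of_nat n powr (- (of_real r * z)) = exp (- of_real (r * ln (real n)) * z)"
proof -
  have "ln (of_nat n) = complex_of_real (ln (real n))"
    using Ln_of_real[of "real n"] assms by simp
  then show ?thesis using assms by (simp add: powr_def mult_ac)
qed

text \<open>Cauchy's formula for the \<open>m\<close>-th derivative at \<open>u\<close> along a circle of radius \<open>r\<close>, applied to
  \<open>\<Prod>q\<in>S. (1 - \<xi> q / q powr u) powr (- \<beta>)\<close>, whose \<open>p\<close>-th power has an explicit modulus since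
  \<open>\<beta> * p = 2\<close>.\<close>

lemma derivative_powr_le:
  assumes \<xi>: "\<And>q. prime q \<Longrightarrow> cmod (\<xi> q) = 1" and r: "0 < r" "r < Re u"
  shows "ennreal (cmod (\<Sum>n. of_real (smooth_negbin n * ln (real n) ^ m) * of_nat n powr (- u) * torus_char \<xi> n) powr p) \<le>
    ennreal ((fact m / r ^ m) powr p) *
      (\<integral>\<^sup>+z. ennreal (\<Prod>q\<in>S. 1 / (cmod (1 - of_nat q powr (- (u + of_real r * z)) * \<xi> q))\<^sup>2) \<partial>circle_measure)"
proof -
  define f where "f n = of_real (smooth_negbin n * ln (real n) ^ m) * of_nat n powr (- u) * torus_char \<xi> n" for n
  define w where "w z q = of_nat q powr (- (u + of_real r * z)) * \<xi> q" for z and q :: nat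
  \<comment> \<open>The integrand of Cauchy's formula, one Dirichlet term at a time. The mean of
    \<open>F n\<close> over the circle is the term \<open>f n\<close> times (- r)^m / m!.\<close>
  define F where "F n z = cnj z ^ m * (of_real (smooth_negbin n) * of_nat n powr (- u) * torus_char \<xi> n * exp (- of_real (r * ln (real n)) * z))"
    for n z
  \<comment> \<open>On the whole circle Re (u + r * z) >= Re u - r > 0. Thus \<open>B\<close>
    majorizes all \<open>F n\<close> and permits exchanging sum and integral.\<close>
  define B where "B n = smooth_negbin n * real n powr (- (Re u - r))" for n
  have B: "summable B" unfolding B_def using smooth_negbin_powr_sums[of "Re u - r"] r by (auto dest: sums_summable)
  have \<chi>: "cmod (torus_char \<xi> n) = 1" for n by (rule norm_torus_char_eq_1) (rule \<xi>)
  have re: "Re (u + of_real r * z) \<ge> Re u - r" if "cmod z = 1" for z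
  proof -
    have "- 1 \<le> Re z" using abs_Re_le_cmod[of z] that by linarith
    then have "r * (- 1) \<le> r * Re z" using r by (intro mult_left_mono) auto
    then show ?thesis by simp
  qed
  have F_w: "F n z = cnj z ^ m * (of_real (smooth_negbin n) * torus_char (w z) n)" for n z
  proof (cases "n = 0")
    case False
    then have n: "n > 0" by simp
    have "torus_char (w z) n = of_nat n powr (- (u + of_real r * z)) * torus_char \<xi> n"
      unfolding w_def torus_char_times torus_char_powr[OF n] ..
    also have "of_nat n powr (- (u + of_real r * z)) = of_nat n powr (- u) * of_nat n powr (- (of_real r * z))"
      by (simp flip: powr_add)
    also have "of_nat n powr (- (of_real r * z)) = exp (- of_real (r * ln (real n)) * z)"
      by (rule of_nat_powr_exp[OF n])
    finally show ?thesis by (simp add: F_def mult_ac)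
  qed (simp add: F_def)
  have F_le: "cmod (F n z) \<le> B n" if z: "cmod z = 1" for n z
  proof (cases "n = 0")
    case False
    then have n: "real n \<ge> 1" by simp
    have "torus_char (w z) n = of_nat n powr (- (u + of_real r * z)) * torus_char \<xi> n"
      using False unfolding w_def torus_char_times by (subst torus_char_powr) auto
    then have "cmod (F n z) = smooth_negbin n * real n powr (- Re (u + of_real r * z))"
      using n z \<chi> smooth_negbin_nonneg[of n] unfolding F_w
      by (simp add: norm_mult norm_power norm_powr_real_powr)
    also have "\<dots> \<le> B n"
      unfolding B_def using n re[OF z] by (intro mult_left_mono powr_mono smooth_negbin_nonneg) auto
    finally show ?thesis .
  qed (simp add: F_def B_def)
  have int: "integrable circle_measure (F n)" for n
    unfolding F_def[abs_def] by (intro circle_integrable_continuous continuous_intros)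
  have intF: "(LINT z|circle_measure. F n z) = ((- of_real r) ^ m / fact m) * f n" for n
  proof -
    have "(LINT z|circle_measure. F n z) = (LINT z|circle_measure. (of_real (smooth_negbin n) * of_nat n powr (- u) * torus_char \<xi> n) *
        (cnj z ^ m * exp (- of_real (r * ln (real n)) * z)))"
      by (simp add: F_def mult_ac)
    also have "\<dots> = (of_real (smooth_negbin n) * of_nat n powr (- u) * torus_char \<xi> n) * ((- of_real (r * ln (real n))) ^ m / fact m)"
      by (subst integral_mult_right_zero) (simp only: circle_integral_exp)
    also have "(- complex_of_real (r * ln (real n))) ^ m = (- of_real r) ^ m * of_real (ln (real n) ^ m)"
      by (simp flip: power_mult_distrib)
    finally show ?thesis by (simp add: f_def mult_ac)
  qed
  have sum1: "AE z in circle_measure. summable (\<lambda>n. norm (F n z))"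
    using AE_circle_measure
    by eventually_elim (rule summable_comparison_test'[OF B], use F_le in auto)
  have sum2: "summable (\<lambda>n. LINT z|circle_measure. norm (F n z))"
  proof (rule summable_comparison_test'[OF B])
    fix n :: nat assume "n \<ge> 0"
    have "(LINT z|circle_measure. norm (F n z)) \<le> (LINT z|circle_measure. B n)"
      by (intro integral_mono_AE) (use int AE_circle_measure in \<open>auto intro: F_le elim!: eventually_mono\<close>)
    then show "norm (LINT z|circle_measure. norm (F n z)) \<le> B n"
      using circle.prob_space by simp
  qed
  define X where "X z = (\<Sum>n. F n z)" for z
  have X: "integrable circle_measure X"
    unfolding X_def[abs_def] by (rule integrable_suminf[OF int sum1 sum2])
  have "(LINT z|circle_measure. X z) = (\<Sum>n. ((- of_real r) ^ m / fact m) * f n)"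
    unfolding X_def intF[symmetric] by (rule integral_suminf[OF int sum1 sum2])
  moreover have summf: "summable f"
  proof (rule summable_norm_cancel, rule summable_comparison_test'[OF smooth_negbin_ln_summable])
    show "Re u > 0" using r by simp
    fix n :: nat assume "n \<ge> 0"
    show "norm (norm (f n)) \<le> smooth_negbin n * ln (real n) ^ m * real n powr (- Re u)"
      by (cases "n = 0") (simp_all add: f_def norm_mult \<chi> norm_powr_real_powr norm_power abs_mult smooth_negbin_nonneg)
  qed
  ultimately have "(LINT z|circle_measure. X z) = ((- of_real r) ^ m / fact m) * suminf f"
    by (simp only: suminf_mult)
  then have "cmod (LINT z|circle_measure. X z) = (r ^ m / fact m) * cmod (suminf f)"
    using r by (simp add: norm_mult norm_divide norm_power)
  then have "cmod (suminf f) = (fact m / r ^ m) * cmod (LINT z|circle_measure. X z)"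
    using r by (simp add: field_simps)
  then have "ennreal (cmod (suminf f) powr p) = ennreal ((fact m / r ^ m) powr p) * ennreal (cmod (LINT z|circle_measure. X z) powr p)"
    using r powr_mult[of "fact m / r ^ m" "cmod (LINT z|circle_measure. X z)" p]
    by (simp only:) (rule ennreal_mult', simp)
  also have "\<dots> \<le> ennreal ((fact m / r ^ m) powr p) * (\<integral>\<^sup>+z. ennreal (cmod (X z) powr p) \<partial>circle_measure)"
    by (intro mult_left_mono circle.nn_jensen_powr[OF X p]) simp
  also have "(\<integral>\<^sup>+z. ennreal (cmod (X z) powr p) \<partial>circle_measure) =
      (\<integral>\<^sup>+z. ennreal (\<Prod>q\<in>S. 1 / (cmod (1 - w z q))\<^sup>2) \<partial>circle_measure)"
  proof (intro nn_integral_cong_AE, use AE_circle_measure in eventually_elim)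
    fix z :: complex assume z: "cmod z = 1"
    have w: "cmod (w z q) < 1" if "q \<in> S" for q
    proof -
      have q: "prime q" using S that by auto
      have "cmod (w z q) = real q powr (- Re (u + of_real r * z))"
        using prime_gt_0_nat[OF q] \<xi>[OF q] by (simp add: w_def norm_mult norm_powr_real_powr)
      also have "\<dots> < 1" using re[OF z] r by (intro powr_minus_lt_1 q) linarith
      finally show ?thesis .
    qed
    note sums = smooth_negbin_sums[of "w z", OF w]
    have "X z = cnj z ^ m * (\<Sum>n. of_real (smooth_negbin n) * torus_char (w z) n)"
      unfolding X_def F_w using sums(2) by (intro suminf_mult sums_summable) auto
    also have "(\<Sum>n. of_real (smooth_negbin n) * torus_char (w z) n) = (\<Prod>q\<in>S. (1 - w z q) powr (- of_real \<beta>))"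
      using sums(2) sums_unique by metis
    finally have "cmod (X z) = (\<Prod>q\<in>S. cmod ((1 - w z q) powr of_real (- \<beta>)))"
      using z by (simp add: norm_mult norm_power prod_norm)
    also have "\<dots> powr p = (\<Prod>q\<in>S. cmod ((1 - w z q) powr of_real (- \<beta>)) powr p)"
      by (rule prod_powr_distrib)
    also have "\<dots> = (\<Prod>q\<in>S. 1 / (cmod (1 - w z q))\<^sup>2)"
    proof (rule prod.cong[OF refl])
      fix q assume "q \<in> S"
      then have nz: "1 - w z q \<noteq> 0" using w[of q] by auto
      then have "cmod ((1 - w z q) powr of_real (- \<beta>)) = cmod (1 - w z q) powr (- \<beta>)"
        using norm_powr_real_powr'[of "of_real (- \<beta>)" "1 - w z q"] by simp
      then have "cmod ((1 - w z q) powr of_real (- \<beta>)) powr p = cmod (1 - w z q) powr (- 2)"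
        using \<beta>_times_p by (simp add: powr_powr)
      then show "cmod ((1 - w z q) powr of_real (- \<beta>)) powr p = 1 / (cmod (1 - w z q))\<^sup>2"
        using nz by (simp add: powr_minus_divide)
    qed
    finally show "ennreal (cmod (X z) powr p) = ennreal (\<Prod>q\<in>S. 1 / (cmod (1 - w z q))\<^sup>2)"
      by simp
  qed
  finally show ?thesis by (simp add: f_def w_def)
qed

lemma inverse_square_measurable:
  "(\<lambda>(\<xi>, z). ennreal (\<Prod>q\<in>S. 1 / (cmod (1 - of_nat q powr (- (u + of_real r * z)) * \<xi> q))\<^sup>2))
    \<in> borel_measurable (torus_measure \<Otimes>\<^sub>M circle_measure)"
proof -
  have [measurable]: "(\<lambda>x. (fst x) q) \<in> borel_measurable (torus_measure \<Otimes>\<^sub>M circle_measure)" if "q \<in> S" for q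
    using S that by (intro measurable_compose[OF measurable_fst] torus_component_measurable) auto
  have [measurable]: "(\<lambda>z. of_nat q powr (- (u + of_real r * z))) \<in> borel_measurable borel" if "q \<in> S" for q
  proof -
    have "q \<noteq> 0" using prime_gt_0_nat[OF S(2)[OF that]] by simp
    then show ?thesis
      unfolding powr_def by (auto intro!: borel_measurable_continuous_onI continuous_intros)
  qed
  show ?thesis unfolding case_prod_beta by measurable
qed

text \<open>After exchanging the integrals, the torus integral for fixed z is an explicit Euler
  product at 2 * Re (u + r * z), which is at least 1 + t; the bound for smooth zeta products is
  uniform in S.\<close>

lemma nn_integral_inverse_square_le:
  assumes t: "t > 0" and u: "(1 + t) / 2 \<le> Re u - r" and r: "0 \<le> r"
  shows "(\<integral>\<^sup>+\<xi>. \<integral>\<^sup>+z. ennreal (\<Prod>q\<in>S. 1 / (cmod (1 - of_nat q powr (- (u + of_real r * z)) * \<xi> q))\<^sup>2)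
    \<partial>circle_measure \<partial>torus_measure) \<le> ennreal (1 + 1 / t)"
proof -
  interpret pair_prob_space torus_measure circle_measure ..
  have "(\<integral>\<^sup>+\<xi>. \<integral>\<^sup>+z. ennreal (\<Prod>q\<in>S. 1 / (cmod (1 - of_nat q powr (- (u + of_real r * z)) * \<xi> q))\<^sup>2)
    \<partial>circle_measure \<partial>torus_measure) =
    (\<integral>\<^sup>+z. \<integral>\<^sup>+\<xi>. ennreal (\<Prod>q\<in>S. 1 / (cmod (1 - of_nat q powr (- (u + of_real r * z)) * \<xi> q))\<^sup>2)
    \<partial>torus_measure \<partial>circle_measure)"
    by (rule Fubini'[symmetric]) (rule inverse_square_measurable)
  also have "\<dots> \<le> (\<integral>\<^sup>+z. ennreal (1 + 1 / t) \<partial>circle_measure)"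
  proof (intro nn_integral_mono_AE, use AE_circle_measure in eventually_elim)
    fix z :: complex assume z: "cmod z = 1"
    define w where "w q = of_nat q powr (- (u + of_real r * z))" for q :: nat
    have "- 1 \<le> Re z" using abs_Re_le_cmod[of z] z by linarith
    then have "r * (- 1) \<le> r * Re z" using r by (intro mult_left_mono) auto
    then have re: "Re (u + of_real r * z) \<ge> (1 + t) / 2" using u by simp
    have w: "(cmod (w q))\<^sup>2 \<le> real q powr (- (1 + t))" "real q powr (- (1 + t)) < 1" "cmod (w q) < 1" if "q \<in> S" for q
    proof -
      have q: "prime q" using S that by auto
      then have q1: "real q \<ge> 1" using prime_gt_0_nat[of q] by simp
      have n: "cmod (w q) = real q powr (- Re (u + of_real r * z))"
        using q1 by (simp add: w_def norm_powr_real_powr)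
      have "(cmod (w q))\<^sup>2 = real q powr (- (2 * Re (u + of_real r * z)))"
        unfolding n by (simp add: power2_eq_square flip: powr_add)
      also have "\<dots> \<le> real q powr (- (1 + t))" using re q1 by (intro powr_mono) (auto simp: field_simps)
      finally show "(cmod (w q))\<^sup>2 \<le> real q powr (- (1 + t))" .
      show lt: "real q powr (- (1 + t)) < 1" using t by (intro powr_minus_lt_1 q) auto
      show "cmod (w q) < 1" unfolding n using re t by (intro powr_minus_lt_1 q) (auto simp: field_simps)
    qed
    have "(\<integral>\<^sup>+\<xi>. ennreal (\<Prod>q\<in>S. 1 / (cmod (1 - w q * \<xi> q))\<^sup>2) \<partial>torus_measure) =
        ennreal (\<Prod>q\<in>S. 1 / (1 - (cmod (w q))\<^sup>2))"
      by (rule nn_integral_torus_inverse_square[OF S w(3)])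
    also have "\<dots> \<le> ennreal (\<Prod>q\<in>S. 1 / (1 - real q powr (- (1 + t))))"
    proof (intro ennreal_leI prod_mono conjI)
      fix q assume q: "q \<in> S"
      show "0 \<le> 1 / (1 - (cmod (w q))\<^sup>2)" using w[OF q] by simp
      show "1 / (1 - (cmod (w q))\<^sup>2) \<le> 1 / (1 - real q powr (- (1 + t)))"
        using w[OF q] by (intro divide_left_mono) auto
    qed
    also have "\<dots> \<le> ennreal (1 + 1 / (1 + t - 1))"
      by (intro ennreal_leI zeta_smooth_le S) (use t in auto)
    finally show "(\<integral>\<^sup>+\<xi>. ennreal (\<Prod>q\<in>S. 1 / (cmod (1 - of_nat q powr (- (u + of_real r * z)) * \<xi> q))\<^sup>2) \<partial>torus_measure)
        \<le> ennreal (1 + 1 / t)" by (simp add: w_def)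
  qed
  also have "\<dots> = ennreal (1 + 1 / t)" using circle.emeasure_space_1 by simp
  finally show ?thesis .
qed

end

context bergman
begin

text \<open>The factor (m! * 2^m) powr p is Cauchy's estimate with radius half of t. The outer 2
  powr p and the summand 1 pay for replacing the infinite series by a polynomial.\<close>

definition test_const :: "nat \<Rightarrow> real" where
  "test_const m = 2 powr p * ((fact m * 2 ^ m) powr p * kernel_const m + 1)"

lemma kernel_const_pos:
  assumes "real m * p > \<alpha>"
  shows "kernel_const m > 0"
proof -
  have "1 / (\<alpha> + 1) > 0" "1 / (real m * p - \<alpha>) > 0" using \<alpha> assms by auto
  then have "1 / (\<alpha> + 1) + 1 / (real m * p - \<alpha>) > 0" by (rule add_pos_pos)
  moreover have "2 powr (\<alpha> + 1) / Gamma (\<alpha> + 1) > 0"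
    using \<alpha> Gamma_real_pos[of "\<alpha> + 1"] by simp
  ultimately show ?thesis unfolding kernel_const_def by (intro mult_pos_pos) auto
qed

lemma test_const_pos: "real m * p > \<alpha> \<Longrightarrow> test_const m > 0"
  using kernel_const_pos[of m] by (auto simp: test_const_def intro!: mult_pos_pos add_nonneg_pos)

end

section \<open>The truncated test function\<close>

context extremal
begin

lemma m_times_p_gt: "real m * p > \<alpha>"
proof -
  have "real m * 1 \<le> real m * p" using p by (intro mult_left_mono) auto
  with m show ?thesis by linarith
qed

text \<open>The sign (-1)^m of the derivative is dropped. Conjugating s makes every term of the
  value at s nonnegative, namely a multiple of n powr (- 2 * Re s), so the estimates depend on Re s
  alone.\<close>

definition test_coeff :: "complex \<Rightarrow> dseries" where
  "test_coeff s n = of_real (smooth_negbin n * ln (real n) ^ m) * of_nat n powr (- cnj s)"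

definition test_poly :: "complex \<Rightarrow> nat \<Rightarrow> dseries" where
  "test_poly s K n = (if n \<le> K then test_coeff s n else 0)"

lemma test_poly_in_polys: "test_poly s K \<in> dirichlet_polys"
  unfolding dirichlet_polys_def
  by (auto simp: test_poly_def test_coeff_def intro: finite_subset[of _ "{..K}"])

lemma test_poly_1: "test_poly s K 1 = 0"
  using m by (simp add: test_poly_def test_coeff_def)

lemma norm_test_coeff: "cmod (test_coeff s n) = smooth_negbin n * ln (real n) ^ m * real n powr (- Re s)"
  by (cases "n = 0")
    (simp_all add: test_coeff_def norm_mult norm_powr_real_powr norm_power abs_mult smooth_negbin_nonneg)

lemma test_poly_eval:
  "dseries_eval (test_poly s K) s = of_real (\<Sum>n\<le>K. smooth_negbin n * ln (real n) ^ m * real n powr (- (2 * Re s)))"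
proof -
  have "dseries_eval (test_poly s K) s = (\<Sum>n\<le>K. test_poly s K n * of_nat n powr (- s))"
    unfolding dseries_eval_def by (rule suminf_finite) (auto simp: test_poly_def)
  also have "\<dots> = (\<Sum>n\<le>K. of_real (smooth_negbin n * ln (real n) ^ m * real n powr (- (2 * Re s))))"
  proof (rule sum.cong[OF refl])
    fix n assume n: "n \<in> {..K}"
    have "- cnj s + - s = of_real (- (2 * Re s))"
      using complex_add_cnj[of s] by (simp add: algebra_simps)
    then have "of_nat n powr (- cnj s) * of_nat n powr (- s) = (of_nat n powr of_real (- (2 * Re s)) :: complex)"
      by (metis powr_add)
    also have "\<dots> = of_real (real n powr (- (2 * Re s)))"
      using powr_of_real[of "real n" "- (2 * Re s)"] by simp
    finally show "test_poly s K n * of_nat n powr (- s) = of_real (smooth_negbin n * ln (real n) ^ m * real n powr (- (2 * Re s)))"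
      using n by (simp add: test_poly_def test_coeff_def mult.assoc)
  qed
  finally show ?thesis by simp
qed

lemma powr_add_1_le:
  assumes "0 \<le> (x::real)" "0 \<le> t" "t \<le> 1"
  shows "(x + t) powr p \<le> 2 powr p * (x powr p + 1)"
proof -
  have "(x + t) powr p \<le> (2 * max x 1) powr p" using assms p by (intro powr_mono2) auto
  also have "\<dots> = 2 powr p * max x 1 powr p" using assms by (simp add: powr_mult)
  also have "max x 1 powr p \<le> x powr p + 1" using assms by (auto simp: max_def)
  finally show ?thesis by simp
qed

lemma test_poly_moment_le:
  assumes s: "Re s > 1/2" and \<eta>: "\<eta> > 0"
    and K: "(\<Sum>n. cmod (test_coeff s (n + Suc K))) \<le> 1"
  defines "t \<equiv> Re s - 1/2 + \<eta>"
  shows "torus_moment p (dseries_shift \<eta> (test_poly s K)) \<le>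
    ennreal (2 powr p) * (ennreal ((fact m * 2 ^ m) powr p) * ennreal (t powr (- (real m * p)) * (1 + 1 / t)) + 1)"
proof -
  define u where "u = cnj s + of_real \<eta>"
  \<comment> \<open>Half the distance from u to the line Re = 1/2. The circle around u then stays in
    Re >= (1 + t) / 2, where the Euler products are bounded by 1 + 1 / t.\<close>
  define r where "r = t / 2"
  have t: "t > 0" "(1 + t) / 2 = Re u - r" and r: "0 < r" "r < Re u"
    using s \<eta> by (auto simp: t_def u_def r_def field_simps)
  define J where "J \<xi> = (\<integral>\<^sup>+z. ennreal (\<Prod>q\<in>S. 1 / (cmod (1 - of_nat q powr (- (u + of_real r * z)) * \<xi> q))\<^sup>2) \<partial>circle_measure)" for \<xi>
  have [measurable]: "J \<in> borel_measurable torus_measure"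
    unfolding J_def[abs_def] by (rule circle.borel_measurable_nn_integral) (rule inverse_square_measurable)
  define E where "E = ennreal ((fact m / r ^ m) powr p)"
  have summ: "summable (\<lambda>n. cmod (test_coeff s n))"
    unfolding norm_test_coeff by (rule smooth_negbin_ln_summable) (use s in auto)
  have "torus_moment p (dseries_shift \<eta> (test_poly s K)) \<le> (\<integral>\<^sup>+\<xi>. ennreal (2 powr p) * (E * J \<xi> + 1) \<partial>torus_measure)"
    unfolding torus_moment_def
  proof (intro nn_integral_mono_AE, use AE_torus in eventually_elim)
    fix \<xi> :: "nat \<Rightarrow> complex" assume \<xi>: "\<forall>q. prime q \<longrightarrow> cmod (\<xi> q) = 1"
    define f where "f n = of_real (smooth_negbin n * ln (real n) ^ m) * of_nat n powr (- u) * torus_char \<xi> n" for n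
    have \<chi>: "cmod (torus_char \<xi> n) = 1" for n by (rule norm_torus_char_eq_1) (use \<xi> in auto)
    have f_eq: "f n = dseries_shift \<eta> (test_coeff s) n * torus_char \<xi> n" for n
    proof -
      have "of_nat n powr (- u) = of_nat n powr (- cnj s) * (of_nat n powr of_real (- \<eta>) :: complex)"
        by (simp add: u_def flip: powr_add)
      also have "of_nat n powr of_real (- \<eta>) = complex_of_real (real n powr (- \<eta>))"
        using powr_of_real[of "real n" "- \<eta>"] by simp
      finally show ?thesis by (simp add: f_def dseries_shift_def test_coeff_def)
    qed
    have f_le: "cmod (f n) \<le> cmod (test_coeff s n)" for n
      using norm_dseries_shift_le[of \<eta> "test_coeff s" n] \<eta> \<chi> by (simp add: f_eq norm_mult)
    have summf: "summable (\<lambda>n. cmod (f n))"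
      by (rule summable_comparison_test'[OF summ]) (use f_le in auto)
    have "torus_poly (dseries_shift \<eta> (test_poly s K)) \<xi> =
        (\<Sum>n\<le>K. dseries_shift \<eta> (test_poly s K) n * torus_char \<xi> n)"
      by (rule torus_poly_eq_sum) (auto simp: dseries_shift_def test_poly_def split: if_splits)
    also have "\<dots> = (\<Sum>n\<le>K. f n)"
      by (intro sum.cong refl) (simp add: f_eq dseries_shift_def test_poly_def)
    \<comment> \<open>Cauchy's estimate concerns the full series, so the polynomial is written as
      series minus tail; by the choice of K the tail is at most 1 at every unimodular point.\<close>
    also have "\<dots> = suminf f - (\<Sum>n. f (n + Suc K))"
      using suminf_split_initial_segment[OF summable_norm_cancel[OF summf], of "Suc K"]
      by (simp add: lessThan_Suc_atMost)
    finally have "cmod (torus_poly (dseries_shift \<eta> (test_poly s K)) \<xi>) \<le> cmod (suminf f) + cmod (\<Sum>n. f (n + Suc K))"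
      by (simp add: norm_triangle_ineq4)
    also have "cmod (\<Sum>n. f (n + Suc K)) \<le> (\<Sum>n. cmod (f (n + Suc K)))"
      by (rule summable_norm) (use summf summable_iff_shift[of "\<lambda>n. cmod (f n)" "Suc K"] in simp)
    also have "\<dots> \<le> (\<Sum>n. cmod (test_coeff s (n + Suc K)))"
      using summf summ summable_iff_shift[of "\<lambda>n. cmod (f n)" "Suc K"]
        summable_iff_shift[of "\<lambda>n. cmod (test_coeff s n)" "Suc K"]
      by (intro suminf_le f_le) auto
    also note K
    finally have "cmod (torus_poly (dseries_shift \<eta> (test_poly s K)) \<xi>) powr p \<le> (cmod (suminf f) + 1) powr p"
      using p by (intro powr_mono2) auto
    also have "\<dots> \<le> 2 powr p * (cmod (suminf f) powr p + 1)"
      by (rule powr_add_1_le) auto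
    finally have "ennreal (cmod (torus_poly (dseries_shift \<eta> (test_poly s K)) \<xi>) powr p) \<le>
        ennreal (2 powr p * (cmod (suminf f) powr p + 1))" by (rule ennreal_leI)
    also have "\<dots> = ennreal (2 powr p) * (ennreal (cmod (suminf f) powr p) + 1)"
      by (simp add: ennreal_mult')
    also have "\<dots> \<le> ennreal (2 powr p) * (E * J \<xi> + 1)"
      unfolding E_def J_def f_def using \<xi> r
      by (intro mult_left_mono add_right_mono derivative_powr_le) auto
    finally show "ennreal (cmod (torus_poly (dseries_shift \<eta> (test_poly s K)) \<xi>) powr p) \<le> ennreal (2 powr p) * (E * J \<xi> + 1)" .
  qed
  also have "\<dots> = ennreal (2 powr p) * (E * (\<integral>\<^sup>+\<xi>. J \<xi> \<partial>torus_measure) + 1)"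
    using torus.emeasure_space_1
    by (subst nn_integral_cmult, simp, subst nn_integral_add) (auto simp: nn_integral_cmult)
  also have "\<dots> \<le> ennreal (2 powr p) * (E * ennreal (1 + 1 / t) + 1)"
    unfolding J_def using t r
    by (intro mult_left_mono add_right_mono nn_integral_inverse_square_le) auto
  also have "E = ennreal ((fact m * 2 ^ m) powr p) * ennreal (t powr (- (real m * p)))"
  proof -
    have "t powr (- real m) = 1 / t ^ m" using t by (simp add: powr_minus_divide powr_realpow)
    then have "fact m / r ^ m = (fact m * 2 ^ m) * t powr (- real m)"
      by (simp add: r_def power_divide)
    then have "(fact m / r ^ m) powr p = (fact m * 2 ^ m) powr p * t powr (- (real m * p))"
      using t by (simp add: powr_mult powr_powr)
    then show ?thesis by (simp add: E_def ennreal_mult')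
  qed
  finally show ?thesis by (simp only: ennreal_mult'[OF powr_ge_zero] mult.assoc)
qed

lemma test_poly_nrm_le:
  assumes s: "1/2 < Re s" "Re s - 1/2 \<le> 1"
    and K: "(\<Sum>n. cmod (test_coeff s (n + Suc K))) \<le> 1"
  shows "nrm (test_poly s K) \<le> (test_const m * (Re s - 1/2) powr (\<alpha> - real m * p)) powr (1 / p)"
proof -
  define \<delta> where "\<delta> = Re s - 1/2"
  define D where "D = (fact m * 2 ^ m :: real) powr p"
  define k where "k \<eta> = (\<delta> + \<eta>) powr (- (real m * p)) * (1 + 1 / (\<delta> + \<eta>))" for \<eta>
  have \<delta>: "0 < \<delta>" "\<delta> \<le> 1" using s by (auto simp: \<delta>_def)
  have [measurable]: "k \<in> borel_measurable borel" unfolding k_def[abs_def] by measurable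
  have C: "test_const m > 0" by (rule test_const_pos[OF m_times_p_gt])
  have "Ap_moment p \<alpha> (test_poly s K) \<le> (\<integral>\<^sup>+\<eta>. ennreal (2 powr p) * (ennreal D * ennreal (k \<eta>) + 1) \<partial>mu \<alpha>)"
    unfolding Ap_moment_def
  proof (intro nn_integral_mono_AE, use AE_mu in eventually_elim)
    fix \<eta> :: real assume "\<eta> > 0"
    then show "torus_moment p (dseries_shift \<eta> (test_poly s K)) \<le> ennreal (2 powr p) * (ennreal D * ennreal (k \<eta>) + 1)"
      using test_poly_moment_le[OF s(1) _ K, of \<eta>] by (simp add: D_def k_def \<delta>_def)
  qed
  also have "\<dots> = ennreal (2 powr p) * (ennreal D * (\<integral>\<^sup>+\<eta>. ennreal (k \<eta>) \<partial>mu \<alpha>) + 1)"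
    using mu.emeasure_space_1
    by (subst nn_integral_cmult, simp, subst nn_integral_add) (auto simp: nn_integral_cmult)
  also have "\<dots> \<le> ennreal (2 powr p) * (ennreal D * ennreal (kernel_const m * \<delta> powr (\<alpha> - real m * p)) + 1)"
    unfolding k_def by (intro mult_left_mono add_right_mono nn_integral_mu_kernel_le \<delta> m_times_p_gt) auto
  also have "\<dots> = ennreal (2 powr p * (D * (kernel_const m * \<delta> powr (\<alpha> - real m * p)) + 1))"
    using kernel_const_pos[OF m_times_p_gt] by (simp add: ennreal_mult' D_def)
  also have "\<dots> \<le> ennreal (test_const m * \<delta> powr (\<alpha> - real m * p))"
  proof (rule ennreal_leI)
    \<comment> \<open>The exponent is negative and \<delta> <= 1, so the truncation error 1 is
      absorbed by the main term.\<close>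
    have "1 \<le> \<delta> powr (\<alpha> - real m * p)"
      using powr_mono'[of "\<alpha> - real m * p" 0 \<delta>] \<delta> m_times_p_gt by simp
    then show "2 powr p * (D * (kernel_const m * \<delta> powr (\<alpha> - real m * p)) + 1) \<le> test_const m * \<delta> powr (\<alpha> - real m * p)"
      unfolding test_const_def D_def[symmetric] by (simp add: algebra_simps)
  qed
  also have "\<dots> = ennreal (((test_const m * \<delta> powr (\<alpha> - real m * p)) powr (1 / p)) powr p)"
    using C \<delta> p by (simp add: powr_powr)
  finally show ?thesis
    by (simp add: nrm_le_iff test_poly_in_polys \<delta>_def)
qed

text \<open>K is taken so large that the truncated sum keeps more than T / 2 and the neglected
  coefficients sum to less than 1. It may depend on s and S, as neither bound involves it.\<close>

lemma delta_norm_infty_ge_test: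
  assumes s: "1/2 < Re s" "Re s - 1/2 \<le> 1"
    and T: "0 < T" "T \<le> (\<Sum>n. smooth_negbin n * ln (real n) ^ m * real n powr (- (2 * Re s)))"
  shows "ennreal ((T / 2) / (test_const m * (Re s - 1/2) powr (\<alpha> - real m * p)) powr (1 / p)) \<le>
    delta_norm p \<alpha> (Ap_infty p \<alpha>) s"
proof -
  define \<gamma> where "\<gamma> n = smooth_negbin n * ln (real n) ^ m * real n powr (- (2 * Re s))" for n
  have "summable \<gamma>" unfolding \<gamma>_def by (rule smooth_negbin_ln_summable) (use s in auto)
  then have "(\<lambda>K. \<Sum>n\<le>K. \<gamma> n) \<longlonglongrightarrow> suminf \<gamma>" by (rule summable_LIMSEQ')
  then have "\<forall>\<^sub>F K in sequentially. T / 2 < (\<Sum>n\<le>K. \<gamma> n)"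
  proof (rule order_tendstoD)
    show "T / 2 < suminf \<gamma>" using T unfolding \<gamma>_def[abs_def] by linarith
  qed
  moreover have "\<forall>\<^sub>F K in sequentially. (\<Sum>n. cmod (test_coeff s (n + Suc K))) < 1"
  proof -
    have "summable (\<lambda>n. cmod (test_coeff s n))"
      unfolding norm_test_coeff by (rule smooth_negbin_ln_summable) (use s in auto)
    then have "(\<lambda>K. \<Sum>n. cmod (test_coeff s (n + K))) \<longlonglongrightarrow> 0" by (rule suminf_exist_split2)
    then have "(\<lambda>K. \<Sum>n. cmod (test_coeff s (n + Suc K))) \<longlonglongrightarrow> 0" by (rule LIMSEQ_Suc)
    then show ?thesis by (rule order_tendstoD) simp
  qed
  ultimately have "\<forall>\<^sub>F K in sequentially. T / 2 < (\<Sum>n\<le>K. \<gamma> n) \<and> (\<Sum>n. cmod (test_coeff s (n + Suc K))) < 1"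
    by (rule eventually_conj)
  then obtain K where K: "T / 2 < (\<Sum>n\<le>K. \<gamma> n)" "(\<Sum>n. cmod (test_coeff s (n + Suc K))) < 1"
    using eventually_happens by fastforce
  define B where "B = (test_const m * (Re s - 1/2) powr (\<alpha> - real m * p)) powr (1 / p)"
  have B: "B > 0" using test_const_pos[OF m_times_p_gt] s by (simp add: B_def)
  have "T / 2 \<le> cmod (dseries_eval (test_poly s K) s)"
    using K(1) by (simp add: test_poly_eval \<gamma>_def del: of_real_sum)
  then have "ennreal ((T / 2) / B) \<le> ennreal (cmod (dseries_eval (test_poly s K) s) / B)"
    using B by (intro ennreal_leI divide_right_mono) auto
  also have "\<dots> \<le> delta_norm p \<alpha> (Ap_infty p \<alpha>) s"
    by (rule delta_norm_Ap_infty_ge)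
      (use B test_poly_nrm_le[OF s, of K] K(2) test_poly_1 in \<open>auto simp: B_def test_poly_in_polys\<close>)
  finally show ?thesis by (simp add: B_def)
qed

end

section \<open>Lower bounds near the critical line and from monomials\<close>

context bergman
begin

lemma delta_norm_infty_ge_near:
  obtains c d where "c > 0" "d > 0"
    "\<And>s. 1/2 < Re s \<Longrightarrow> Re s \<le> 1/2 + d \<Longrightarrow>
      ennreal (c * (Re s - 1/2) powr (- ((\<alpha> + 2) / p))) \<le> delta_norm p \<alpha> (Ap_infty p \<alpha>) s"
proof -
  obtain m where m: "m \<ge> 1" "real m > \<alpha>"
  proof -
    obtain n :: nat where "\<alpha> < real n" using reals_Archimedean2 by blast
    then show ?thesis using that[of "Suc n"] by simp
  qed
  define \<kappa> where "\<kappa> = 2 / p"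
  have \<kappa>: "\<kappa> > 0" using p by (simp add: \<kappa>_def)
  \<comment> \<open>Solves exp 1 * (1 / (A * \<delta>)) powr \<kappa> = (1/2) * (1 / (4 * \<delta>))
    powr \<kappa>: the series subtracted at y is then at most half of the lower bound for the series
    at x.\<close>
  define A where "A = 4 * (2 * exp 1) powr (1 / \<kappa>)"
  have A\<kappa>: "A powr \<kappa> = 4 powr \<kappa> * (2 * exp 1)" using \<kappa> by (simp add: A_def powr_mult powr_powr)
  have "(2 * exp 1 :: real) \<ge> 1" using exp_ge_add_one_self[of "1::real"] by linarith
  then have A: "A \<ge> 4" using ge_one_powr_ge_zero[of "2 * exp 1" "1 / \<kappa>"] \<kappa> by (simp add: A_def)
  \<comment> \<open>Guarantees 2 * A * \<delta> <= 1, whence 1 + 1 / (2 * A * \<delta>) <= 1 / (A *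
    \<delta>) in the zeta bound at y.\<close>
  define d where "d = 1 / (2 * A)"
  define c where "c = (1 / 4) * (1 / (2 * A)) ^ m * (1 / 4) powr \<kappa> / test_const m powr (1 / p)"
  have m_times_p_gt: "real m * p > \<alpha>"
  proof -
    have "real m * 1 \<le> real m * p" using p by (intro mult_left_mono) auto
    with m show ?thesis by linarith
  qed
  note C = test_const_pos[OF m_times_p_gt]
  have cd: "c > 0" "d > 0" using A C by (auto simp: c_def d_def)
  have "ennreal (c * (Re s - 1/2) powr (- ((\<alpha> + 2) / p))) \<le> delta_norm p \<alpha> (Ap_infty p \<alpha>) s"
    if s: "1/2 < Re s" "Re s \<le> 1/2 + d" for s
  proof -
    define \<delta> where "\<delta> = Re s - 1/2"
    have \<delta>: "0 < \<delta>" "2 * A * \<delta> \<le> 1"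
      using s A by (auto simp: \<delta>_def d_def field_simps)
    have \<delta>1: "\<delta> \<le> 1"
    proof -
      have "1 * \<delta> \<le> (2 * A) * \<delta>" using A \<delta> by (intro mult_right_mono) auto
      also note \<delta>(2)
      finally show ?thesis by simp
    qed
    \<comment> \<open>The cut-off L for ln n is of order 1 / \<delta>, and (y - x) * L <= 1 keeps
      the exponential factor below exp 1. The factor L^m supplies the power \<delta> powr (-
      m).\<close>
    define x y L where "x = 2 * Re s" and "y = 1 + 2 * A * \<delta>" and "L = 1 / (2 * A * \<delta>)"
    have x: "x = 1 + 2 * \<delta>" by (simp add: x_def \<delta>_def)
    have xy: "1 < x" "x < y" "1 < y"
    proof -
      have "1 * \<delta> < A * \<delta>" using A \<delta> by (intro mult_strict_right_mono) auto
      then show "1 < x" "x < y" "1 < y" using \<delta> by (auto simp: x y_def)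
    qed
    \<comment> \<open>The finite set of primes is adapted to s, while c and d were fixed before
      s.\<close>
    obtain N where N: "1 / (2 * (x - 1)) \<le> (\<Prod>q | prime q \<and> q \<le> N. 1 / (1 - real q powr (- x)))"
      using zeta_smooth_ge[OF xy(1)] by auto
    define S where "S = {q. prime q \<and> q \<le> N}"
    interpret extremal p \<alpha> S m
      by unfold_locales (use m in \<open>auto simp: S_def intro: finite_subset[of _ "{..N}"]\<close>)
    have \<beta>_eq: "\<beta> = \<kappa>" by (simp add: \<beta>_def \<kappa>_def)
    define Gx where "Gx = (\<Prod>q\<in>S. 1 / (1 - real q powr (- x))) powr \<kappa>"
    define Gy where "Gy = (\<Prod>q\<in>S. 1 / (1 - real q powr (- y))) powr \<kappa>"
    define U where "U = (1 / (4 * \<delta>)) powr \<kappa>"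
    have Gx: "U \<le> Gx"
      unfolding U_def Gx_def using N \<kappa> \<delta> by (intro powr_mono2) (auto simp: x S_def)
    have Gy: "exp ((y - x) * L) * Gy \<le> U / 2"
    proof -
      have "(\<Prod>q\<in>S. 1 / (1 - real q powr (- y))) \<le> 1 + 1 / (y - 1)"
        by (rule zeta_smooth_le[OF S xy(3)])
      also have "\<dots> \<le> 1 / (A * \<delta>)"
      proof -
        have "1 + 1 / z \<le> 2 / z" if "0 < z" "z \<le> 1" for z :: real
          using that by (simp add: field_simps)
        from this[of "2 * A * \<delta>"] show ?thesis using \<delta> A by (simp add: y_def)
      qed
      finally have "Gy \<le> (1 / (A * \<delta>)) powr \<kappa>"
        unfolding Gy_def using \<kappa> S powr_minus_lt_1 xy
        by (intro powr_mono2 prod_nonneg) (auto simp: less_imp_le)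
      moreover have "exp ((y - x) * L) \<le> exp 1"
      proof -
        have "(y - x) * L = (2 * A * \<delta> - 2 * \<delta>) / (2 * A * \<delta>)"
          by (simp add: x y_def L_def)
        also have "\<dots> \<le> 1" using \<delta> A by (simp add: divide_le_eq)
        finally show ?thesis by simp
      qed
      ultimately have "exp ((y - x) * L) * Gy \<le> exp 1 * (1 / (A * \<delta>)) powr \<kappa>"
        by (intro mult_mono) (auto simp: Gy_def)
      also have "\<dots> = U / 2"
        using \<delta> A by (simp add: U_def powr_divide powr_mult A\<kappa>)
      finally show ?thesis .
    qed
    have "L ^ m * (U / 2) \<le> L ^ m * (Gx - exp ((y - x) * L) * Gy)"
      using Gx Gy \<delta> A by (intro mult_left_mono) (auto simp: L_def)
    also have "\<dots> \<le> (\<Sum>n. smooth_negbin n * ln (real n) ^ m * real n powr (- x))"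
      using smooth_negbin_ln_suminf_ge[of x y L] xy \<delta> A by (simp add: Gx_def Gy_def \<beta>_eq L_def)
    finally have T: "L ^ m * (U / 2) \<le> (\<Sum>n. smooth_negbin n * ln (real n) ^ m * real n powr (- (2 * Re s)))"
      by (simp add: x_def)
    have "0 < L ^ m * (U / 2)" using \<delta> A by (simp add: L_def U_def)
    from delta_norm_infty_ge_test[OF s(1) _ this T] \<delta>1
    have "ennreal ((L ^ m * (U / 2) / 2) / (test_const m * \<delta> powr (\<alpha> - real m * p)) powr (1 / p))
        \<le> delta_norm p \<alpha> (Ap_infty p \<alpha>) s" by (simp add: \<delta>_def)
    moreover have "(L ^ m * (U / 2) / 2) / (test_const m * \<delta> powr (\<alpha> - real m * p)) powr (1 / p) =
        c * \<delta> powr (- ((\<alpha> + 2) / p))"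
    proof -
      have L: "L ^ m = (1 / (2 * A)) ^ m * \<delta> powr (- real m)"
      proof -
        have "L ^ m = (1 / (2 * A) * (1 / \<delta>)) ^ m" by (simp add: L_def)
        also have "\<dots> = (1 / (2 * A)) ^ m * (1 / \<delta>) ^ m" by (rule power_mult_distrib)
        also have "(1 / \<delta>) ^ m = \<delta> powr (- real m)"
          using \<delta>(1) by (simp add: powr_minus_divide powr_realpow power_one_over)
        finally show ?thesis .
      qed
      have U: "U = (1 / 4) powr \<kappa> * \<delta> powr (- \<kappa>)"
      proof -
        have "U = (1 / 4 * (1 / \<delta>)) powr \<kappa>" by (simp add: U_def)
        also have "\<dots> = (1 / 4) powr \<kappa> * (1 / \<delta>) powr \<kappa>" by (rule powr_mult)
        also have "(1 / \<delta>) powr \<kappa> = \<delta> powr (- \<kappa>)"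
          using \<delta>(1) by (simp add: powr_divide powr_minus_divide)
        finally show ?thesis .
      qed
      have B: "(test_const m * \<delta> powr (\<alpha> - real m * p)) powr (1 / p) =
          test_const m powr (1 / p) * \<delta> powr ((\<alpha> - real m * p) / p)"
        using C \<delta> by (simp add: powr_mult powr_powr)
      have "\<delta> powr (- real m) * \<delta> powr (- \<kappa>) / \<delta> powr ((\<alpha> - real m * p) / p) =
          \<delta> powr (- real m + - \<kappa> - (\<alpha> - real m * p) / p)"
        by (simp only: powr_add powr_diff)
      also have "- real m + - \<kappa> - (\<alpha> - real m * p) / p = - ((\<alpha> + 2) / p)"
        using p by (simp add: \<kappa>_def field_simps)
      finally have pw: "\<delta> powr (- real m) * \<delta> powr (- \<kappa>) / \<delta> powr ((\<alpha> - real m * p) / p) = \<delta> powr (- ((\<alpha> + 2) / p))" .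
      have rearrange: "(X * x * (Y * y / 2) / 2) / (Z * z) = 1 / 4 * X * Y / Z * (x * y / z)"
        for X Y Z x y z :: real
      proof -
        have "X * x * (Y * y / 2) / 2 = 1 / 4 * X * Y * (x * y)" by (simp add: mult_ac)
        then show ?thesis by (simp only: times_divide_times_eq)
      qed
      have "(L ^ m * (U / 2) / 2) / (test_const m * \<delta> powr (\<alpha> - real m * p)) powr (1 / p) =
          c * (\<delta> powr (- real m) * \<delta> powr (- \<kappa>) / \<delta> powr ((\<alpha> - real m * p) / p))"
        unfolding L U B c_def by (rule rearrange)
      then show ?thesis unfolding pw .
    qed
    ultimately show ?thesis by (simp add: \<delta>_def)
  qed
  with cd that show ?thesis by blast
qed

text \<open>A monomial has norm at most 1. The constant function serves the full space, and n = 2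
  the subspace with vanishing first coefficient, when Re s stays away from 1/2.\<close>

lemma delta_norm_monomial:
  assumes "n > 0"
  shows "ennreal (real n powr (- Re s)) \<le> delta_norm p \<alpha> (Ap p \<alpha>) s"
    and "n \<noteq> 1 \<Longrightarrow> ennreal (real n powr (- Re s)) \<le> delta_norm p \<alpha> (Ap_infty p \<alpha>) s"
proof -
  define a :: dseries where "a k = (if k = n then 1 else 0)" for k
  have supp: "{k. a k \<noteq> 0} = {n}" by (auto simp: a_def)
  have a: "a \<in> dirichlet_polys" using assms by (simp add: dirichlet_polys_def supp) (simp add: a_def)
  have nrm: "nrm a \<le> 1" using nrm_le_sum[OF a, of "{n}"] by (simp add: supp) (simp add: a_def)
  have "dseries_eval a s = of_nat n powr (- s)"
    unfolding dseries_eval_poly[OF a] supp by (simp add: a_def)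
  then have e: "cmod (dseries_eval a s) = real n powr (- Re s)"
    using assms by (simp add: norm_powr_real_powr)
  show "ennreal (real n powr (- Re s)) \<le> delta_norm p \<alpha> (Ap p \<alpha>) s"
    using delta_norm_Ap_ge[OF a nrm, of s] by (simp add: e)
  show "ennreal (real n powr (- Re s)) \<le> delta_norm p \<alpha> (Ap_infty p \<alpha>) s" if "n \<noteq> 1"
    using delta_norm_Ap_infty_ge[OF a _ nrm, of s] that by (simp add: e a_def)
qed

end

theorem theorem5p2:
  fixes p \<alpha> :: real
  assumes "1 \<le> p" and "- 1 < \<alpha>"
  shows
    "(\<forall>a::real. 1/2 < a \<longrightarrow>
       (\<exists>c1 C1 :: real. 0 < c1 \<and> 0 < C1 \<and>
         (\<forall>s::complex. 1/2 < Re s \<and> Re s < a \<longrightarrow>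
            ennreal (c1 / (Re s - 1/2) powr ((\<alpha> + 2) / p)) \<le> delta_norm p \<alpha> (Ap_infty p \<alpha>) s \<and>
            delta_norm p \<alpha> (Ap_infty p \<alpha>) s \<le> ennreal (C1 / (Re s - 1/2) powr ((\<alpha> + 2) / p)))))
     \<and>
     (\<exists>c2 C2 :: real. 0 < c2 \<and> 0 < C2 \<and>
       (\<forall>s::complex. 1/2 < Re s \<longrightarrow>
          ennreal (c2 * (Re s / (Re s - 1/2)) powr ((\<alpha> + 2) / p)) \<le> delta_norm p \<alpha> (Ap p \<alpha>) s \<and>
          delta_norm p \<alpha> (Ap p \<alpha>) s \<le> ennreal (C2 * (Re s / (Re s - 1/2)) powr ((\<alpha> + 2) / p))))
     \<and>
     (\<exists>\<sigma>0 c3 C3 :: real. 1/2 < \<sigma>0 \<and> 0 < c3 \<and> 0 < C3 \<and>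
       (\<forall>s::complex. 1/2 < Re s \<and> Re s < \<sigma>0 \<longrightarrow>
          ennreal (c3 * (Re s - 1/2) powr (- ((\<alpha> + 2) / p))) \<le> delta_norm p \<alpha> (Ap_infty p \<alpha>) s \<and>
          delta_norm p \<alpha> (Ap_infty p \<alpha>) s \<le> ennreal (C3 * (Re s - 1/2) powr (- ((\<alpha> + 2) / p))) \<and>
          ennreal (c3 * (Re s - 1/2) powr (- ((\<alpha> + 2) / p))) \<le> delta_norm p \<alpha> (Ap p \<alpha>) s \<and>
          delta_norm p \<alpha> (Ap p \<alpha>) s \<le> ennreal (C3 * (Re s - 1/2) powr (- ((\<alpha> + 2) / p)))))"
proof -
  interpret bergman p \<alpha> by unfold_locales (use assms in auto)
  define g where "g = (\<alpha> + 2) / p"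
  have g: "g > 0" using p \<alpha> by (simp add: g_def)
  define P where "P = point_eval_const"
  have P: "P > 0" using point_eval_const_pos by (simp add: P_def)
  obtain c d where cd: "c > 0" "d > 0" and near: "\<And>s. 1/2 < Re s \<Longrightarrow> Re s \<le> 1/2 + d \<Longrightarrow>
      ennreal (c * (Re s - 1/2) powr (- g)) \<le> delta_norm p \<alpha> (Ap_infty p \<alpha>) s"
    using delta_norm_infty_ge_near unfolding g_def by blast
  have upper: "delta_norm p \<alpha> (Ap p \<alpha>) s \<le> ennreal (P * (Re s / (Re s - 1/2)) powr g)" if "1/2 < Re s" for s
    using delta_norm_Ap_le[OF that] by (simp add: P_def g_def)
  \<comment> \<open>Below a fixed bound \<open>b\<close> the numerator Re s contributes only b powr
    g, leaving a pure power of Re s - 1/2.\<close>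
  have upper_b: "delta_norm p \<alpha> (Ap p \<alpha>) s \<le> ennreal (P * b powr g / (Re s - 1/2) powr g)"
    if "1/2 < Re s" "Re s \<le> b" for s b
  proof (rule order_trans[OF upper[OF that(1)]], rule ennreal_leI)
    have "(Re s / (Re s - 1/2)) powr g = Re s powr g / (Re s - 1/2) powr g"
      using that by (simp add: powr_divide)
    also have "\<dots> \<le> b powr g / (Re s - 1/2) powr g"
      using that g by (intro divide_right_mono powr_mono2) auto
    finally have "P * (Re s / (Re s - 1/2)) powr g \<le> P * (b powr g / (Re s - 1/2) powr g)"
      using P by (intro mult_left_mono) auto
    then show "P * (Re s / (Re s - 1/2)) powr g \<le> P * b powr g / (Re s - 1/2) powr g" by simp
  qed
  have part1: "\<exists>c1 C1 :: real. 0 < c1 \<and> 0 < C1 \<and>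
         (\<forall>s::complex. 1/2 < Re s \<and> Re s < a \<longrightarrow>
            ennreal (c1 / (Re s - 1/2) powr g) \<le> delta_norm p \<alpha> (Ap_infty p \<alpha>) s \<and>
            delta_norm p \<alpha> (Ap_infty p \<alpha>) s \<le> ennreal (C1 / (Re s - 1/2) powr g))" if a: "1/2 < a" for a
  proof (intro exI conjI allI impI)
    \<comment> \<open>The second entry serves 1/2 + d < Re s < a: there the monomial for n = 2 has
      modulus at least 2 powr (- a), and (Re s - 1/2) powr g is at least d powr g.\<close>
    define c1 where "c1 = min c (2 powr (- a) * d powr g)"
    show "0 < c1" using cd by (simp add: c1_def)
    show "0 < P * a powr g" using P a by simp
    fix s :: complex assume s: "1/2 < Re s \<and> Re s < a"
    show "delta_norm p \<alpha> (Ap_infty p \<alpha>) s \<le> ennreal (P * a powr g / (Re s - 1/2) powr g)"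
      using order_trans[OF delta_norm_infty_le upper_b[of s a]] s by simp
    show "ennreal (c1 / (Re s - 1/2) powr g) \<le> delta_norm p \<alpha> (Ap_infty p \<alpha>) s"
    proof (cases "Re s \<le> 1/2 + d")
      case True
      have "c1 / (Re s - 1/2) powr g \<le> c * (Re s - 1/2) powr (- g)"
        by (simp add: c1_def powr_minus_divide divide_right_mono)
      then show ?thesis using near[of s] s True by (meson ennreal_leI order_trans)
    next
      case False
      have "c1 / (Re s - 1/2) powr g \<le> (2 powr (- a) * d powr g) / (Re s - 1/2) powr g"
        by (intro divide_right_mono) (auto simp: c1_def)
      also have "\<dots> \<le> (2 powr (- a) * d powr g) / d powr g"
        using False cd g by (intro divide_left_mono powr_mono2 mult_pos_pos) auto
      also have "\<dots> \<le> real 2 powr (- Re s)"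
        using cd s by simp
      finally show ?thesis
        using delta_norm_monomial(2)[of 2 s] by (meson ennreal_leI order_trans zero_less_numeral numeral_eq_one_iff semiring_norm(85))
    qed
  qed
  have part2: "\<exists>c2 C2 :: real. 0 < c2 \<and> 0 < C2 \<and>
       (\<forall>s::complex. 1/2 < Re s \<longrightarrow>
          ennreal (c2 * (Re s / (Re s - 1/2)) powr g) \<le> delta_norm p \<alpha> (Ap p \<alpha>) s \<and>
          delta_norm p \<alpha> (Ap p \<alpha>) s \<le> ennreal (C2 * (Re s / (Re s - 1/2)) powr g))"
  proof (intro exI conjI allI impI)
    \<comment> \<open>The first entry uses Re s <= 1/2 + d near the line. Beyond it the constant
      function 1 has value 1, and Re s / (Re s - 1/2) is at most (1/2 + d) / d.\<close>
    define c2 where "c2 = min (c / (1/2 + d) powr g) (1 / ((1/2 + d) / d) powr g)"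
    show "0 < c2" using cd by (simp add: c2_def)
    show "0 < P" by (rule P)
    fix s :: complex assume s: "1/2 < Re s"
    show "delta_norm p \<alpha> (Ap p \<alpha>) s \<le> ennreal (P * (Re s / (Re s - 1/2)) powr g)" by (rule upper[OF s])
    show "ennreal (c2 * (Re s / (Re s - 1/2)) powr g) \<le> delta_norm p \<alpha> (Ap p \<alpha>) s"
    proof (cases "Re s \<le> 1/2 + d")
      case True
      have "c2 * (Re s / (Re s - 1/2)) powr g \<le> (c / (1/2 + d) powr g) * ((1/2 + d) / (Re s - 1/2)) powr g"
        using s True g cd by (intro mult_mono powr_mono2 divide_right_mono) (auto simp: c2_def)
      also have "\<dots> = c * (Re s - 1/2) powr (- g)"
        using s cd by (simp add: powr_divide powr_minus_divide)
      finally show ?thesis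
        using near[OF s True] delta_norm_infty_le[of s] by (meson ennreal_leI order_trans)
    next
      case False
      have "Re s / (Re s - 1/2) \<le> (1/2 + d) / d"
        using False cd by (simp add: field_simps)
      then have "c2 * (Re s / (Re s - 1/2)) powr g \<le> (1 / ((1/2 + d) / d) powr g) * ((1/2 + d) / d) powr g"
        using s cd g by (intro mult_mono powr_mono2) (auto simp: c2_def)
      also have "\<dots> = real 1 powr (- Re s)" using cd by simp
      finally show ?thesis
        using delta_norm_monomial(1)[of 1 s] by (meson ennreal_leI order_trans zero_less_one)
    qed
  qed
  have part3: "\<exists>\<sigma>0 c3 C3 :: real. 1/2 < \<sigma>0 \<and> 0 < c3 \<and> 0 < C3 \<and>
       (\<forall>s::complex. 1/2 < Re s \<and> Re s < \<sigma>0 \<longrightarrow>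
          ennreal (c3 * (Re s - 1/2) powr (- g)) \<le> delta_norm p \<alpha> (Ap_infty p \<alpha>) s \<and>
          delta_norm p \<alpha> (Ap_infty p \<alpha>) s \<le> ennreal (C3 * (Re s - 1/2) powr (- g)) \<and>
          ennreal (c3 * (Re s - 1/2) powr (- g)) \<le> delta_norm p \<alpha> (Ap p \<alpha>) s \<and>
          delta_norm p \<alpha> (Ap p \<alpha>) s \<le> ennreal (C3 * (Re s - 1/2) powr (- g)))"
  proof (rule exI[of _ "1/2 + d"], rule exI[of _ c], rule exI[of _ "P * (1/2 + d) powr g"], intro conjI allI impI)
    fix s :: complex assume s: "1/2 < Re s \<and> Re s < 1/2 + d"
    show lo: "ennreal (c * (Re s - 1/2) powr (- g)) \<le> delta_norm p \<alpha> (Ap_infty p \<alpha>) s"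
      using near[of s] s by simp
    show up: "delta_norm p \<alpha> (Ap p \<alpha>) s \<le> ennreal (P * (1/2 + d) powr g * (Re s - 1/2) powr (- g))"
      using upper_b[of s "1/2 + d"] s by (simp add: powr_minus_divide)
    show "delta_norm p \<alpha> (Ap_infty p \<alpha>) s \<le> ennreal (P * (1/2 + d) powr g * (Re s - 1/2) powr (- g))"
      using delta_norm_infty_le up by (rule order_trans)
    show "ennreal (c * (Re s - 1/2) powr (- g)) \<le> delta_norm p \<alpha> (Ap p \<alpha>) s"
      using lo delta_norm_infty_le by (rule order_trans)
  qed (use cd P in auto)
  show ?thesis
    using part1 part2 part3 unfolding g_def by blast
qed

end
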